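(* Let $0<r<s<\infty$. \begin{itemize} \item If $s\ge 2$, then $\Lambda(L_s(\ell_r))=\{2,r,s\}$. \item If $s\le 2$, then $\Lambda(L_s(\ell_r))=\{r\}\cup[s,2]$. \end{itemize}
   Context: Spaces are over the real or complex field. For a quasi-Banach space $X$, $\Lambda(X)=\{p\in(0,\infty] : \ell_p \text{ isomorphically embeds into } X\}$, with the convention that for $p=\infty$ the symbol $\ell_\infty$ means $c_0$. "Isomorphically embeds" means that there is a linear homeomorphism onto a closed subspace. $L_s(\ell_r)$ is the mixed-norm quasi-Banach space of (classes of) measurable functions $f$ on $[0,1]\times\mathbb{N}$ (Lebesgue measure times counting measure) with quasi-norm $\left(\int_0^1\left(\sum_{n=1}^\infty|f(x,n)|^r\right)^{s/r}dx\right)^{1/s}<\infty$. *)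

theory Defs
  imports "HOL-Analysis.Analysis" "HOL-Library.Function_Algebras"
begin

text \<open>
  The scalar field is a type variable \<open>'k\<close>; the instances of interest are \<^typ>\<open>real\<close> and
  \<^typ>\<open>complex\<close>. A quasi-normed space over \<open>'k\<close> is given by its carrier inside an ambient abelian
  group, its scalar multiplication and its quasi-norm; the last two matter on the carrier only.
\<close>

record ('k, 'a) qn_space =
  carrier :: "'a set"
  scale :: "'k \<Rightarrow> 'a \<Rightarrow> 'a"
  qnorm :: "'a \<Rightarrow> real"

text \<open>
  The vector topology of a quasi-norm. The balls need not be open themselves, but they are a
  neighbourhood base.
\<close>

definition qn_topology :: "('k, 'a::ab_group_add) qn_space \<Rightarrow> 'a topology" where
  "qn_topology X = topology (\<lambda>U. U \<subseteq> carrier X \<and>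
     (\<forall>x\<in>U. \<exists>e>0. \<forall>y\<in>carrier X. qnorm X (y - x) < e \<longrightarrow> y \<in> U))"

lemma openin_qn_topology:
  "openin (qn_topology X) U \<longleftrightarrow> U \<subseteq> carrier X \<and>
     (\<forall>x\<in>U. \<exists>e>0. \<forall>y\<in>carrier X. qnorm X (y - x) < e \<longrightarrow> y \<in> U)"
proof -
  let ?nhd = "\<lambda>U x. \<exists>e>0. \<forall>y\<in>carrier X. qnorm X (y - x) < e \<longrightarrow> y \<in> U"
  have mono: "?nhd V x" if "?nhd U x" "U \<subseteq> V" for U V x
    using that by blast
  have inter: "?nhd (S \<inter> T) x" if S: "?nhd S x" and T: "?nhd T x" for S T x
  proof -
    obtain d where d: "d > 0" "\<forall>y\<in>carrier X. qnorm X (y - x) < d \<longrightarrow> y \<in> S"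
      using S by blast
    obtain e where e: "e > 0" "\<forall>y\<in>carrier X. qnorm X (y - x) < e \<longrightarrow> y \<in> T"
      using T by blast
    show ?thesis
      by (rule exI[of _ "min d e"]) (use d e in simp)
  qed
  have "istopology (\<lambda>U. U \<subseteq> carrier X \<and> (\<forall>x\<in>U. ?nhd U x))"
    unfolding istopology_def
  proof (rule conjI; intro allI impI)
    fix S T
    assume S: "S \<subseteq> carrier X \<and> (\<forall>x\<in>S. ?nhd S x)"
      and T: "T \<subseteq> carrier X \<and> (\<forall>x\<in>T. ?nhd T x)"
    have "?nhd (S \<inter> T) x" if "x \<in> S \<inter> T" for x
      by (rule inter) (use S T that in auto)
    then show "S \<inter> T \<subseteq> carrier X \<and> (\<forall>x\<in>S \<inter> T. ?nhd (S \<inter> T) x)"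
      using S by blast
  next
    fix K
    assume K: "\<forall>U\<in>K. U \<subseteq> carrier X \<and> (\<forall>x\<in>U. ?nhd U x)"
    have "?nhd (\<Union> K) x" if "U \<in> K" "x \<in> U" for U x
      by (rule mono[where U = U]) (use K that in auto)
    then show "\<Union> K \<subseteq> carrier X \<and> (\<forall>x\<in>\<Union> K. ?nhd (\<Union> K) x)"
      using K by blast
  qed
  then show ?thesis
    unfolding qn_topology_def by (simp add: topology_inverse')
qed

lemma topspace_qn_topology [simp]: "topspace (qn_topology X) = carrier X"
proof -
  have "openin (qn_topology X) (carrier X)"
    unfolding openin_qn_topology by (auto intro: exI[of _ 1])
  then show ?thesis
    by (auto simp: topspace_def openin_qn_topology)
qed

definition linear_operator ::
  "('k, 'a::ab_group_add) qn_space \<Rightarrow> ('k, 'b::ab_group_add) qn_space \<Rightarrow> ('a \<Rightarrow> 'b) \<Rightarrow> bool" where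
  "linear_operator X Y T \<longleftrightarrow> T ` carrier X \<subseteq> carrier Y \<and>
     (\<forall>x\<in>carrier X. \<forall>y\<in>carrier X. T (x + y) = T x + T y) \<and>
     (\<forall>c. \<forall>x\<in>carrier X. T (scale X c x) = scale Y c (T x))"

definition isomorphically_embeds ::
  "('k, 'a::ab_group_add) qn_space \<Rightarrow> ('k, 'b::ab_group_add) qn_space \<Rightarrow> bool" where
  "isomorphically_embeds X Y \<longleftrightarrow> (\<exists>T. linear_operator X Y T \<and>
     embedding_map (qn_topology X) (qn_topology Y) T \<and>
     closedin (qn_topology Y) (T ` carrier X))"

definition lp_space :: "real \<Rightarrow> ('k::real_normed_field, nat \<Rightarrow> 'k) qn_space" where
  "lp_space p = \<lparr>carrier = {x. summable (\<lambda>n. norm (x n) powr p)},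
     scale = (\<lambda>c x n. c * x n),
     qnorm = (\<lambda>x. (\<Sum>n. norm (x n) powr p) powr (1 / p))\<rparr>"

definition c0_space :: "('k::real_normed_field, nat \<Rightarrow> 'k) qn_space" where
  "c0_space = \<lparr>carrier = {x. x \<longlonglongrightarrow> 0},
     scale = (\<lambda>c x n. c * x n),
     qnorm = (\<lambda>x. SUP n. norm (x n))\<rparr>"

text \<open>The index set \<open>\<Lambda>(X)\<close> is a subset of \<open>(0, \<infinity>]\<close>, where \<open>p = \<infinity>\<close> stands for \<open>c\<^sub>0\<close>.\<close>

definition Lambda :: "('k::real_normed_field, 'a::ab_group_add) qn_space \<Rightarrow> ereal set" where
  "Lambda X = {p. 0 < p \<and>
     isomorphically_embeds (if p = \<infinity> then c0_space else lp_space (real_of_ereal p)) X}"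

text \<open>Classes of measurable functions on \<open>[0,1] \<times> \<nat>\<close> modulo equality almost everywhere.\<close>

definition mixed_measure :: "(real \<times> nat) measure" where
  "mixed_measure = lebesgue_on {0..1} \<Otimes>\<^sub>M count_space UNIV"

definition ae_eq :: "(real \<times> nat \<Rightarrow> 'k::{real_normed_field, second_countable_topology}) \<Rightarrow>
    (real \<times> nat \<Rightarrow> 'k) \<Rightarrow> bool" where
  "ae_eq f g \<longleftrightarrow> f \<in> borel_measurable mixed_measure \<and> g \<in> borel_measurable mixed_measure \<and>
     (AE z in mixed_measure. f z = g z)"

quotient_type (overloaded) 'k mixed_L0 =
  "real \<times> nat \<Rightarrow> 'k::{real_normed_field, second_countable_topology}" / partial: ae_eq
proof (rule part_equivpI)
  show "\<exists>f :: real \<times> nat \<Rightarrow> 'k. ae_eq f f"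
    by (rule exI[of _ "\<lambda>_. 0"]) (simp add: ae_eq_def)
  show "symp (ae_eq :: (real \<times> nat \<Rightarrow> 'k) \<Rightarrow> _)"
    by (rule sympI) (simp add: ae_eq_def eq_commute)
  show "transp (ae_eq :: (real \<times> nat \<Rightarrow> 'k) \<Rightarrow> _)"
  proof (rule transpI)
    fix f g h :: "real \<times> nat \<Rightarrow> 'k"
    assume fg: "ae_eq f g" and gh: "ae_eq g h"
    have "AE z in mixed_measure. f z = g z" "AE z in mixed_measure. g z = h z"
      using fg gh by (simp_all add: ae_eq_def)
    then have "AE z in mixed_measure. f z = h z"
      by eventually_elim simp
    then show "ae_eq f h"
      using fg gh by (simp add: ae_eq_def)
  qed
qed

lemma ae_eq_map1:
  assumes "ae_eq f g" "h \<in> borel_measurable borel"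
  shows "ae_eq (\<lambda>z. h (f z)) (\<lambda>z. h (g z))"
proof -
  have "AE z in mixed_measure. f z = g z"
    using assms by (simp add: ae_eq_def)
  then have "AE z in mixed_measure. h (f z) = h (g z)"
    by eventually_elim simp
  then show ?thesis
    using assms by (auto simp: ae_eq_def intro: measurable_compose[where N = borel])
qed

lemma ae_eq_plus:
  assumes "ae_eq f f'" "ae_eq g g'"
  shows "ae_eq (\<lambda>z. f z + g z) (\<lambda>z. f' z + g' z)"
proof -
  have "AE z in mixed_measure. f z = f' z" "AE z in mixed_measure. g z = g' z"
    using assms by (simp_all add: ae_eq_def)
  then have "AE z in mixed_measure. f z + g z = f' z + g' z"
    by eventually_elim simp
  then show ?thesis
    using assms by (auto simp: ae_eq_def intro: borel_measurable_add)
qed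

lemma ae_eq_uminus: "ae_eq f g \<Longrightarrow> ae_eq (\<lambda>z. - f z) (\<lambda>z. - g z)"
  by (rule ae_eq_map1) simp_all

lemma ae_eq_minus:
  assumes "ae_eq f f'" "ae_eq g g'"
  shows "ae_eq (\<lambda>z. f z - g z) (\<lambda>z. f' z - g' z)"
  using ae_eq_plus[OF assms(1) ae_eq_uminus[OF assms(2)]] by simp

lemma ae_eq_scale: "ae_eq f g \<Longrightarrow> ae_eq (\<lambda>z. c * f z) (\<lambda>z. c * g z)"
  by (rule ae_eq_map1) simp_all

instantiation mixed_L0 :: ("{real_normed_field, second_countable_topology}") ab_group_add
begin

lift_definition zero_mixed_L0 :: "'a mixed_L0" is "\<lambda>_. 0"
  by (simp add: ae_eq_def)

lift_definition plus_mixed_L0 :: "'a mixed_L0 \<Rightarrow> 'a mixed_L0 \<Rightarrow> 'a mixed_L0"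
  is "\<lambda>f g z. f z + g z"
  by (rule ae_eq_plus)

lift_definition minus_mixed_L0 :: "'a mixed_L0 \<Rightarrow> 'a mixed_L0 \<Rightarrow> 'a mixed_L0"
  is "\<lambda>f g z. f z - g z"
  by (rule ae_eq_minus)

lift_definition uminus_mixed_L0 :: "'a mixed_L0 \<Rightarrow> 'a mixed_L0"
  is "\<lambda>f z. - f z"
  by (rule ae_eq_uminus)

instance
proof
  fix a b c :: "'a mixed_L0"
  show "a + b + c = a + (b + c)"
    by transfer (simp add: ae_eq_def add.assoc)
  show "a + b = b + a"
    by transfer (simp add: ae_eq_def add.commute)
  show "0 + a = a"
    by transfer (simp add: ae_eq_def)
  show "- a + a = 0"
    by transfer (simp add: ae_eq_def)
  show "a - b = a + - b"
    by transfer (simp add: ae_eq_def)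
qed

end

lift_definition scale_mixed_L0 ::
  "'k::{real_normed_field, second_countable_topology} \<Rightarrow> 'k mixed_L0 \<Rightarrow> 'k mixed_L0"
  is "\<lambda>c f z. c * f z"
  by (rule ae_eq_scale)

text \<open>Powers with values in \<open>[0, \<infinity>]\<close>, for exponents \<open>a > 0\<close>.\<close>

definition ennpowr :: "ennreal \<Rightarrow> real \<Rightarrow> ennreal" where
  "ennpowr t a = (if t = \<infinity> then \<infinity> else ennreal (enn2real t powr a))"

lemma ae_eq_sections:
  assumes "ae_eq f g"
  shows "AE x in lebesgue_on {0..1}. \<forall>n. f (x, n) = g (x, n)"
proof -
  interpret M: finite_measure "lebesgue_on {0..1::real}"
    by (rule finite_measure_lebesgue_on) auto
  interpret N: sigma_finite_measure "count_space (UNIV :: nat set)"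
    by (rule sigma_finite_measure_count_space)
  interpret P: pair_sigma_finite "lebesgue_on {0..1::real}" "count_space (UNIV :: nat set)" ..
  from assms have "AE z in lebesgue_on {0..1} \<Otimes>\<^sub>M count_space UNIV. f z = g z"
    unfolding ae_eq_def mixed_measure_def by blast
  from P.AE_pair[OF this] show ?thesis
    by (simp add: AE_count_space)
qed

lift_definition mixed_enorm ::
  "real \<Rightarrow> real \<Rightarrow> 'k::{real_normed_field, second_countable_topology} mixed_L0 \<Rightarrow> ennreal"
  is "\<lambda>s r f. ennpowr (\<integral>\<^sup>+ x. ennpowr (\<Sum>n. ennreal (norm (f (x, n)) powr r)) (s / r)
    \<partial>lebesgue_on {0..1}) (1 / s)"
proof -
  fix s r :: real and f g :: "real \<times> nat \<Rightarrow> 'k"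
  assume "ae_eq f g"
  then have "AE x in lebesgue_on {0..1}. \<forall>n. f (x, n) = g (x, n)"
    by (rule ae_eq_sections)
  then have "(\<integral>\<^sup>+ x. ennpowr (\<Sum>n. ennreal (norm (f (x, n)) powr r)) (s / r) \<partial>lebesgue_on {0..1}) =
    (\<integral>\<^sup>+ x. ennpowr (\<Sum>n. ennreal (norm (g (x, n)) powr r)) (s / r) \<partial>lebesgue_on {0..1})"
    by (intro nn_integral_cong_AE) (auto elim!: eventually_mono)
  then show "ennpowr (\<integral>\<^sup>+ x. ennpowr (\<Sum>n. ennreal (norm (f (x, n)) powr r)) (s / r)
      \<partial>lebesgue_on {0..1}) (1 / s) =
    ennpowr (\<integral>\<^sup>+ x. ennpowr (\<Sum>n. ennreal (norm (g (x, n)) powr r)) (s / r)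
      \<partial>lebesgue_on {0..1}) (1 / s)"
    by simp
qed

text \<open>\<open>L\<^sub>s(\<ell>\<^sub>r)\<close>; note the order of the arguments: the outer exponent comes first.\<close>

definition Ls_lr :: "real \<Rightarrow> real \<Rightarrow>
    ('k::{real_normed_field, second_countable_topology}, 'k mixed_L0) qn_space" where
  "Ls_lr s r = \<lparr>carrier = {f. mixed_enorm s r f < \<infinity>},
     scale = scale_mixed_L0,
     qnorm = (\<lambda>f. enn2real (mixed_enorm s r f))\<rparr>"

end

theory Submission
  imports Defs "HOL-Probability.Probability" "HOL-Real_Asymp.Real_Asymp"
begin

text \<open>
  Let \<open>\<Phi>(f) = \<integral> (\<Sum>\<^sub>n |f(x, n)|\<^sup>r)\<^bsup>s/r\<^esup> dx\<close>, the \<open>s\<close>-th power of the quasi-norm, and let \<open>\<theta> = 1/p\<close>, with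
  \<open>\<theta> = 0\<close> for \<open>c\<^sub>0\<close>. In \<open>\<ell>\<^sub>p\<close> and in \<open>c\<^sub>0\<close> a sum of \<open>n\<close> disjointly supported unit vectors has norm
  \<open>n\<^sup>\<theta>\<close>; this growth is what an embedding has to reproduce.

  Which exponents are possible. Let \<open>T\<close> be an embedding. Either some finite set of coordinates
  \<open>n < N\<close> carries a fixed proportion of \<open>\<Phi>(T u)\<close> for all \<open>u\<close> supported far out; then the average of
  \<open>\<Phi>\<close>, restricted to these coordinates, over all signed sums of the vectors \<open>T e\<^sub>i\<close>, \<open>i \<in> S\<close>, is by
  Khinchine's inequality comparable to
  \<open>\<integral> (\<Sum>\<^sub>i h\<^sub>i)\<^bsup>s/2\<^esup>\<close> with \<open>h\<^sub>i(x) = \<Sum>\<^sub>n |T e\<^sub>i(x, n)|\<^sup>2\<close>, \<open>n < N\<close> (\<open>finite_coordinates_growth\<close>). Or there is no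
  such set; then a gliding hump produces normalized blocks \<open>u\<^sub>k\<close> whose images are, up to a small error,
  supported on disjoint blocks of coordinates, and \<open>\<Phi>(\<Sum>\<^sub>k T u\<^sub>k)\<close> is comparable to \<open>\<integral> (\<Sum>\<^sub>k h\<^sub>k)\<^bsup>s/r\<^esup>\<close> with
  \<open>h\<^sub>k(x) = \<Sum>\<^sub>n |T u\<^sub>k(x, n)|\<^sup>r\<close> (\<open>disjoint_coordinates_growth\<close>, \<open>exponent_if_spread\<close>). In both cases one has
  nonnegative functions on the unit interval for which \<open>\<integral> (\<Sum>\<^sub>i h\<^sub>i)\<^sup>q\<close>, \<open>i \<in> S\<close>, is comparable to
  \<open>|S|\<^sup>\<beta>\<close> with \<open>\<beta> = s\<theta>\<close>, and \<open>positive_sums_growth\<close> tells which \<open>\<beta>\<close> can occur: \<open>q \<le> \<beta> \<le> 1\<close> if \<open>q \<le> 1\<close>, and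
  only \<open>\<beta> = 1\<close> or \<open>\<beta> = q\<close> if \<open>q > 1\<close>, because a sequence bounded in \<open>L\<^sub>q\<close> either keeps its \<open>L\<^sub>1\<close> norms away
  from zero along an infinite set or has nearly disjoint members. Taking \<open>q = s/2\<close> and \<open>q = s/r > 1\<close> leaves
  exactly the exponents of the theorem.

  Which exponents occur. The coordinate vectors span \<open>\<ell>\<^sub>r\<close>, functions on disjoint intervals span \<open>\<ell>\<^sub>s\<close>, and
  independent signs span \<open>\<ell>\<^sub>2\<close>. For \<open>s < p < 2\<close> the space \<open>\<ell>\<^sub>p\<close> is spanned by independent symmetric
  variables \<open>Y\<^sub>i\<close> with \<open>P(|Y\<^sub>i| \<ge> t) = t\<^bsup>-p\<^esup>\<close> for \<open>t \<ge> 1\<close>. They replace \<open>p\<close>-stable variables: the span is only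
  isomorphic to \<open>\<ell>\<^sub>p\<close>, but all estimates are elementary. By symmetry and Khinchine's inequality the norm
  of \<open>\<Sum> a\<^sub>i Y\<^sub>i\<close> is comparable to that of the square function; if \<open>\<Sum> |a\<^sub>i|\<^sup>p = 1\<close>, truncating \<open>a\<^sub>i Y\<^sub>i\<close> at
  height one bounds the square function from above, and with probability at least \<open>1 - 1/e\<close> some
  \<open>|a\<^sub>i Y\<^sub>i|\<close> is at least one. The variables are built on the unit interval from the binary digits of
  the point.

  The topological notion of an embedding is turned into two-sided bounds of quasi-norms by
  \<open>isomorphically_embeds_imp_bounds\<close> and, for bounds on finite sums only, by
  \<open>lp_embeds_if_basis_bounds\<close>, which rests on the completeness of both spaces. Real and complex scalars
  are treated together, as a normed field that is a Euclidean space.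
\<close>

section \<open>Growth of sums of nonnegative functions\<close>

text \<open>
  Either \<open>t \<le> l\<close>, or \<open>t\<close> is at most \<open>t (t/l)\<^bsup>q-1\<^esup>\<close>. If \<open>l\<close> is half of a mean value of \<open>t\<close>, then the first
  summand can be absorbed after averaging; in this way the inequality stands in for those of Jensen
  and Hoelder wherever a constant factor is harmless.
\<close>

lemma le_add_powr_scaled:
  fixes q l t :: real
  assumes "1 \<le> q" "0 < l" "0 \<le> t"
  shows "t \<le> l + l powr (1 - q) * t powr q"
proof (cases "t \<le> l")
  case True
  then show ?thesis using assms by (simp add: add_increasing2)
next
  case False
  then have t: "0 < t" "l < t" using assms by auto
  have "t powr (1 - q) \<le> l powr (1 - q)"
    using t assms by (intro powr_mono2') auto
  then have "t powr (1 - q) * t powr q \<le> l powr (1 - q) * t powr q"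
    by (intro mult_right_mono) auto
  moreover have "t powr (1 - q) * t powr q = t"
    using t by (simp add: powr_add[symmetric])
  ultimately show ?thesis using assms by linarith
qed

text \<open>
  After division by the sum every entry lies in \<open>[0, 1]\<close>, where \<open>t\<^sup>q \<le> t\<close>.
\<close>

lemma sum_powr_le_powr_sum:
  fixes a :: "'i \<Rightarrow> real"
  assumes "finite S" "\<And>i. i \<in> S \<Longrightarrow> 0 \<le> a i" "1 \<le> q"
  shows "(\<Sum>i\<in>S. a i powr q) \<le> (\<Sum>i\<in>S. a i) powr q"
proof (cases "(\<Sum>i\<in>S. a i) = 0")
  case True
  then have "\<forall>i\<in>S. a i = 0" using assms by (simp add: sum_nonneg_eq_0_iff)
  then show ?thesis by simp
next
  case False
  let ?s = "\<Sum>i\<in>S. a i"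
  have s: "?s > 0" using False assms by (simp add: sum_nonneg order.not_eq_order_implies_strict)
  have "a i powr q \<le> ?s powr (q - 1) * a i" if "i \<in> S" for i
  proof (cases "a i = 0")
    case False
    then have "a i > 0" using assms that by (simp add: order.not_eq_order_implies_strict)
    have "a i \<le> ?s" using assms that by (intro member_le_sum) auto
    then have "a i powr (q - 1) \<le> ?s powr (q - 1)"
      using assms that by (intro powr_mono2) auto
    then have "a i powr (q - 1) * a i \<le> ?s powr (q - 1) * a i"
      using \<open>a i > 0\<close> by (intro mult_right_mono) auto
    then show ?thesis using \<open>a i > 0\<close> by (simp add: powr_diff)
  qed simp
  then have "(\<Sum>i\<in>S. a i powr q) \<le> (\<Sum>i\<in>S. ?s powr (q - 1) * a i)"
    by (rule sum_mono)
  also have "\<dots> = ?s powr q"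
    unfolding sum_distrib_left[symmetric] using s by (simp add: powr_diff)
  finally show ?thesis .
qed

lemma powr_sum_le_sum_powr:
  fixes a :: "'i \<Rightarrow> real"
  assumes "finite S" "\<And>i. i \<in> S \<Longrightarrow> 0 \<le> a i" "0 < q" "q \<le> 1"
  shows "(\<Sum>i\<in>S. a i) powr q \<le> (\<Sum>i\<in>S. a i powr q)"
proof -
  have "(\<Sum>i\<in>S. (a i powr q) powr (1 / q)) \<le> (\<Sum>i\<in>S. a i powr q) powr (1 / q)"
    using assms by (intro sum_powr_le_powr_sum) auto
  moreover have "(\<Sum>i\<in>S. (a i powr q) powr (1 / q)) = (\<Sum>i\<in>S. a i)"
    using assms by (intro sum.cong) (auto simp: powr_powr)
  ultimately have "(\<Sum>i\<in>S. a i) powr q \<le> ((\<Sum>i\<in>S. a i powr q) powr (1 / q)) powr q"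
    using assms by (intro powr_mono2) (auto intro: sum_nonneg)
  then show ?thesis using assms by (simp add: powr_powr sum_nonneg)
qed

lemma powr_sum_le_card_sum_powr:
  fixes a :: "'i \<Rightarrow> real"
  assumes "finite S" "\<And>i. i \<in> S \<Longrightarrow> 0 \<le> a i" "1 \<le> q"
  shows "(\<Sum>i\<in>S. a i) powr q \<le> 2 powr q * real (card S) powr (q - 1) * (\<Sum>i\<in>S. a i powr q)"
proof (cases "(\<Sum>i\<in>S. a i) = 0")
  case True
  then show ?thesis by (simp add: sum_nonneg)
next
  case False
  let ?s = "\<Sum>i\<in>S. a i" and ?n = "real (card S)"
  \<comment> \<open>Half of the mean: the constant terms then add up to half of the left side.\<close>
  define l where "l = ?s / (2 * ?n)"
  have s: "?s > 0" using False assms by (simp add: sum_nonneg order.not_eq_order_implies_strict)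
  have "S \<noteq> {}" using False by auto
  then have n: "?n > 0" using assms by (simp add: card_gt_0_iff)
  have l: "l > 0" using s n by (simp add: l_def)
  have "?s \<le> (\<Sum>i\<in>S. l + l powr (1 - q) * a i powr q)"
    using assms l by (intro sum_mono le_add_powr_scaled) auto
  also have "\<dots> = ?s / 2 + l powr (1 - q) * (\<Sum>i\<in>S. a i powr q)"
    unfolding sum.distrib sum_distrib_left[symmetric] using n by (simp add: l_def)
  finally have "?s / 2 \<le> l powr (1 - q) * (\<Sum>i\<in>S. a i powr q)" by simp
  moreover have "?s / 2 = ?n * l" using n by (simp add: l_def)
  ultimately have "l powr (q - 1) * (?n * l) \<le> l powr (q - 1) * (l powr (1 - q) * (\<Sum>i\<in>S. a i powr q))"
    by (intro mult_left_mono) auto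
  then have main: "?n * l powr q \<le> (\<Sum>i\<in>S. a i powr q)"
    using l by (simp add: mult.assoc[symmetric] powr_add[symmetric]) (simp add: powr_diff mult_ac)
  have "?s powr q = (2 * ?n * l) powr q" using n by (simp add: l_def)
  also have "\<dots> = 2 powr q * ?n powr (q - 1) * (?n * l powr q)"
    using n l by (simp add: powr_mult powr_diff)
  also have "\<dots> \<le> 2 powr q * ?n powr (q - 1) * (\<Sum>i\<in>S. a i powr q)"
    using main by (intro mult_left_mono) auto
  finally show ?thesis .
qed

lemma card_sum_powr_le_powr_sum:
  fixes a :: "'i \<Rightarrow> real"
  assumes "finite S" "\<And>i. i \<in> S \<Longrightarrow> 0 \<le> a i" "0 < q" "q \<le> 1"
  shows "real (card S) powr (q - 1) * (\<Sum>i\<in>S. a i powr q) \<le> 2 * (\<Sum>i\<in>S. a i) powr q"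
proof (cases "S = {}")
  case False
  let ?n = "real (card S)"
  have n: "?n > 0" using False assms by (simp add: card_gt_0_iff)
  have "(\<Sum>i\<in>S. a i powr q) powr (1/q) \<le>
      2 powr (1/q) * ?n powr (1/q - 1) * (\<Sum>i\<in>S. (a i powr q) powr (1/q))"
    using assms by (intro powr_sum_le_card_sum_powr) auto
  moreover have "(\<Sum>i\<in>S. (a i powr q) powr (1 / q)) = (\<Sum>i\<in>S. a i)"
    using assms by (intro sum.cong) (auto simp: powr_powr)
  ultimately have "((\<Sum>i\<in>S. a i powr q) powr (1/q)) powr q \<le>
      (2 powr (1/q) * ?n powr (1/q - 1) * (\<Sum>i\<in>S. a i)) powr q"
    using assms by (intro powr_mono2) auto
  then have "(\<Sum>i\<in>S. a i powr q) \<le> 2 * ?n powr (1 - q) * (\<Sum>i\<in>S. a i) powr q"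
    using assms by (simp add: powr_powr sum_nonneg powr_mult left_diff_distrib)
  then have "?n powr (q - 1) * (\<Sum>i\<in>S. a i powr q) \<le>
      ?n powr (q - 1) * (2 * ?n powr (1 - q) * (\<Sum>i\<in>S. a i) powr q)"
    by (intro mult_left_mono) auto
  also have "\<dots> = 2 * (?n powr (q - 1) * ?n powr (1 - q)) * (\<Sum>i\<in>S. a i) powr q" by simp
  also have "\<dots> = 2 * (\<Sum>i\<in>S. a i) powr q"
    using n by (simp add: powr_add[symmetric])
  finally show ?thesis .
qed simp

lemma powr_growth_imp_le:
  fixes c C \<alpha> \<beta> :: real
  assumes "0 < c" and le: "\<And>n::nat. 1 \<le> n \<Longrightarrow> c * real n powr \<alpha> \<le> C * real n powr \<beta>"
  shows "\<alpha> \<le> \<beta>"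
proof (rule ccontr)
  assume "\<not> \<alpha> \<le> \<beta>"
  then have pos: "\<alpha> - \<beta> > 0" by simp
  have "filterlim (\<lambda>n::nat. real n powr (\<alpha> - \<beta>)) at_top at_top"
    using pos by real_asymp
  then have "\<forall>\<^sub>F n in at_top. real n powr (\<alpha> - \<beta>) > C / c"
    by (rule filterlim_at_top_dense[THEN iffD1, rule_format])
  then obtain n :: nat where n: "real n powr (\<alpha> - \<beta>) > C / c" "1 \<le> n"
    by (metis eventually_at_top_linorder le_cases)
  have "C < c * real n powr (\<alpha> - \<beta>)" using n assms by (simp add: field_simps)
  then have "C * real n powr \<beta> < c * real n powr (\<alpha> - \<beta>) * real n powr \<beta>"
    using n by (intro mult_strict_right_mono) auto
  also have "\<dots> = c * real n powr \<alpha>" using n by (simp add: powr_add[symmetric] mult.assoc)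
  finally show False using le[OF n(2)] by simp
qed

text \<open>
  If one of \<open>A\<close>, \<open>h\<close> is at most \<open>\<rho>\<close> times the other one, then the power of the sum is additive up to a
  factor near one. In the remaining case \<open>A\<close> and \<open>h\<close> are comparable, and a multiple of the power of
  \<open>A\<close> alone bounds that of the sum; this term only matters where \<open>h\<close> is not small against \<open>A\<close>.
\<close>

lemma powr_add_le_split:
  fixes A h q \<rho> :: real
  assumes "0 \<le> A" "0 \<le> h" "0 < q" "0 < \<rho>"
  shows "(A + h) powr q \<le> (1 + \<rho>) powr q * (A powr q + h powr q)
    + (1 + 1 / \<rho>) powr q * (if h \<le> \<rho> * A then 0 else A powr q)"
proof -
  consider "h \<le> \<rho> * A" | "h > \<rho> * A" "A \<le> \<rho> * h" | "h > \<rho> * A" "A > \<rho> * h" by linarith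
  then show ?thesis
  proof cases
    case 1
    have "(A + h) powr q \<le> ((1 + \<rho>) * A) powr q"
      using assms 1 by (intro powr_mono2) (auto simp: algebra_simps)
    also have "\<dots> = (1 + \<rho>) powr q * A powr q" using assms by (simp add: powr_mult)
    also have "\<dots> \<le> (1 + \<rho>) powr q * (A powr q + h powr q)" by (intro mult_left_mono) auto
    finally show ?thesis using 1 by simp
  next
    case 2
    have "(A + h) powr q \<le> ((1 + \<rho>) * h) powr q"
      using assms 2 by (intro powr_mono2) (auto simp: algebra_simps)
    also have "\<dots> = (1 + \<rho>) powr q * h powr q" using assms by (simp add: powr_mult)
    also have "\<dots> \<le> (1 + \<rho>) powr q * (A powr q + h powr q)" by (intro mult_left_mono) auto
    finally show ?thesis by (simp add: add_increasing2)
  next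
    case 3
    have "h \<le> A / \<rho>" using 3 assms by (simp add: field_simps)
    then have "(A + h) powr q \<le> ((1 + 1 / \<rho>) * A) powr q"
      using assms by (intro powr_mono2) (auto simp: algebra_simps)
    also have "\<dots> = (1 + 1 / \<rho>) powr q * A powr q" using assms by (simp add: powr_mult)
    finally show ?thesis using 3 by (simp add: add_increasing)
  qed
qed

text \<open>
  A form of the Brezis-Lieb lemma. As \<open>h\<^sub>k\<close> tends to zero almost everywhere, the part of \<open>A\<^sup>q\<close> on the
  set where \<open>h\<^sub>k > \<rho> A\<close> has integral tending to zero, so \<open>h\<^sub>k\<close> is eventually almost disjoint from \<open>A\<close>.
\<close>

lemma nearly_disjoint_step:
  fixes h :: "nat \<Rightarrow> 'a \<Rightarrow> real" and A :: "'a \<Rightarrow> real"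
  assumes q: "0 < q"
    and meas [measurable]: "A \<in> borel_measurable M" "\<And>k. h k \<in> borel_measurable M"
    and nonneg: "\<And>x. 0 \<le> A x" "\<And>k x. 0 \<le> h k x"
    and intA: "integrable M (\<lambda>x. A x powr q)"
    and inth: "\<And>k. integrable M (\<lambda>x. h k x powr q)"
    and intS: "\<And>k. integrable M (\<lambda>x. (A x + h k x) powr q)"
    and bound: "\<And>k. (\<integral>x. h k x powr q \<partial>M) \<le> C"
    and lim: "AE x in M. (\<lambda>k. h k x) \<longlonglongrightarrow> 0"
  shows "\<forall>\<^sub>F k in sequentially. (\<integral>x. (A x + h k x) powr q \<partial>M) \<le> (\<integral>x. A x powr q \<partial>M) + C + 1"
proof -
  let ?a = "\<integral>x. A x powr q \<partial>M"
  have "(\<lambda>\<rho>. (1 + \<rho>) powr q * (?a + C)) \<midarrow>0\<rightarrow> (1 + 0) powr q * (?a + C)"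
    by (intro tendsto_intros) auto
  then have "\<forall>\<^sub>F \<rho> in at 0. (1 + \<rho>) powr q * (?a + C) < ?a + C + 1 / 2"
    by (rule order_tendstoD) simp
  then have "\<forall>\<^sub>F \<rho> in at_right 0. (1 + \<rho>) powr q * (?a + C) < ?a + C + 1 / 2"
    by (simp add: eventually_at_split)
  moreover have "\<forall>\<^sub>F \<rho>::real in at_right 0. 0 < \<rho>" by (simp add: eventually_at_right_less)
  ultimately have "\<forall>\<^sub>F \<rho> in at_right 0. (1 + \<rho>) powr q * (?a + C) < ?a + C + 1 / 2 \<and> 0 < \<rho>"
    by (rule eventually_conj)
  then obtain \<rho> where \<rho>: "(1 + \<rho>) powr q * (?a + C) < ?a + C + 1 / 2" "0 < \<rho>"
    using eventually_happens'[OF trivial_limit_at_right_real] by blast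
  define D where "D k x = (if h k x \<le> \<rho> * A x then 0 else A x powr q)" for k x
  have [measurable]: "D k \<in> borel_measurable M" for k unfolding D_def by measurable
  have Dlim: "(\<lambda>k. D k x) \<longlonglongrightarrow> 0" if "(\<lambda>k. h k x) \<longlonglongrightarrow> 0" for x
  proof (cases "A x = 0")
    case True
    then show ?thesis by (simp add: D_def cong: if_cong)
  next
    case False
    then have "\<rho> * A x > 0" using nonneg(1)[of x] \<rho> by simp
    then have "\<forall>\<^sub>F k in sequentially. h k x < \<rho> * A x"
      using that by (rule order_tendstoD(2)[rotated])
    then have "\<forall>\<^sub>F k in sequentially. D k x = 0"
      by eventually_elim (simp add: D_def)
    then show ?thesis by (rule tendsto_eventually)
  qed
  have "(\<lambda>k. \<integral>x. D k x \<partial>M) \<longlonglongrightarrow> (\<integral>x. 0 \<partial>M)"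
  proof (rule integral_dominated_convergence[where w = "\<lambda>x. A x powr q"])
    show "AE x in M. (\<lambda>k. D k x) \<longlonglongrightarrow> 0" using lim by eventually_elim (rule Dlim)
    show "AE x in M. norm (D k x) \<le> A x powr q" for k by (auto simp: D_def)
  qed (use intA in auto)
  then have "(\<lambda>k. (1 + 1 / \<rho>) powr q * (\<integral>x. D k x \<partial>M)) \<longlonglongrightarrow> (1 + 1 / \<rho>) powr q * 0"
    by (intro tendsto_intros) simp
  then have "\<forall>\<^sub>F k in sequentially. (1 + 1 / \<rho>) powr q * (\<integral>x. D k x \<partial>M) < 1 / 2"
    by (rule order_tendstoD) simp
  then show ?thesis
  proof eventually_elim
    case (elim k)
    have intD: "integrable M (D k)"
      by (rule Bochner_Integration.integrable_bound[OF intA]) (auto simp: D_def)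
    have "(\<integral>x. (A x + h k x) powr q \<partial>M) \<le>
        (\<integral>x. (1 + \<rho>) powr q * (A x powr q + h k x powr q) + (1 + 1 / \<rho>) powr q * D k x \<partial>M)"
      unfolding D_def
      by (intro integral_mono intS powr_add_le_split Bochner_Integration.integrable_add
        integrable_mult_right intA inth intD[unfolded D_def]) (use nonneg q \<rho> in auto)
    also have "\<dots> = (1 + \<rho>) powr q * (?a + (\<integral>x. h k x powr q \<partial>M)) + (1 + 1 / \<rho>) powr q * (\<integral>x. D k x \<partial>M)"
      using intA inth intD by simp
    also have "\<dots> \<le> (1 + \<rho>) powr q * (?a + C) + 1 / 2"
      using elim bound[of k] by (intro add_mono mult_left_mono) auto
    finally show ?case using \<rho> by linarith
  qed
qed

text \<open>
  For \<open>q \<le> 1\<close> both bounds hold pointwise. Let \<open>q > 1\<close>. If \<open>\<integral> h\<^sub>i \<ge> \<delta>\<close> for infinitely many \<open>i\<close>, then,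
  since the integral is additive, sums of \<open>n\<close> of these functions have integral at least \<open>n\<delta>\<close>, and on a
  finite measure space this forces growth of order \<open>n\<^sup>q\<close>. Otherwise \<open>\<integral> h\<^sub>i\<close> tends to zero, a subsequence
  tends to zero almost everywhere, and its members can be chosen one after the other almost disjoint
  from those chosen before; this gives growth of order \<open>n\<close>.
\<close>

lemma (in finite_measure) positive_sums_growth:
  fixes h :: "nat \<Rightarrow> 'a \<Rightarrow> real"
  assumes q: "0 < q" and c: "0 < c"
    and meas [measurable]: "\<And>i. h i \<in> borel_measurable M"
    and nonneg: "\<And>i x. 0 \<le> h i x"
    and int: "\<And>S. finite S \<Longrightarrow> integrable M (\<lambda>x. (\<Sum>i\<in>S. h i x) powr q)"
    and lower: "\<And>S. finite S \<Longrightarrow> S \<noteq> {} \<Longrightarrow>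
        c * real (card S) powr \<beta> \<le> (\<integral>x. (\<Sum>i\<in>S. h i x) powr q \<partial>M)"
    and upper: "\<And>S. finite S \<Longrightarrow> S \<noteq> {} \<Longrightarrow>
        (\<integral>x. (\<Sum>i\<in>S. h i x) powr q \<partial>M) \<le> C * real (card S) powr \<beta>"
  shows "if q \<le> 1 then q \<le> \<beta> \<and> \<beta> \<le> 1 else \<beta> = 1 \<or> \<beta> = q"
proof -
  have int1: "integrable M (\<lambda>x. h i x powr q)" for i using int[of "{i}"] by simp
  have low1: "c \<le> (\<integral>x. h i x powr q \<partial>M)" for i using lower[of "{i}"] by simp
  have up1: "(\<integral>x. h i x powr q \<partial>M) \<le> C" for i using upper[of "{i}"] by simp
  have C: "C > 0" using low1[of 0] up1[of 0] c by linarith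
  have sum1: "(\<integral>x. (\<Sum>i\<in>S. h i x powr q) \<partial>M) = (\<Sum>i\<in>S. \<integral>x. h i x powr q \<partial>M)" for S
    by (rule Bochner_Integration.integral_sum) (rule int1)
  have sum_low: "c * real (card S) \<le> (\<integral>x. (\<Sum>i\<in>S. h i x powr q) \<partial>M)" for S
    unfolding sum1 using sum_bounded_below[of S c "\<lambda>i. \<integral>x. h i x powr q \<partial>M"] low1
    by (simp add: mult.commute)
  have sum_up: "(\<integral>x. (\<Sum>i\<in>S. h i x powr q) \<partial>M) \<le> C * real (card S)" for S
    unfolding sum1 using sum_bounded_above[of S "\<lambda>i. \<integral>x. h i x powr q \<partial>M" C] up1
    by (simp add: mult.commute)
  show ?thesis
  proof (cases "q \<le> 1")
    case True
    have "\<beta> \<le> 1"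
    proof (rule powr_growth_imp_le[of c _ C])
      fix n :: nat assume "1 \<le> n"
      let ?S = "{..<n}"
      have "c * real n powr \<beta> \<le> (\<integral>x. (\<Sum>i\<in>?S. h i x) powr q \<partial>M)"
        using lower[of ?S] \<open>1 \<le> n\<close> by (auto simp: lessThan_empty_iff)
      also have "\<dots> \<le> (\<integral>x. (\<Sum>i\<in>?S. h i x powr q) \<partial>M)"
        using True q nonneg int int1 by (intro integral_mono powr_sum_le_sum_powr) auto
      also have "\<dots> \<le> C * real n powr 1" using sum_up[of ?S] by simp
      finally show "c * real n powr \<beta> \<le> C * real n powr 1" .
    qed (rule c)
    moreover have "q \<le> \<beta>"
    proof (rule powr_growth_imp_le[of c _ "2 * C"])
      fix n :: nat assume "1 \<le> n"
      let ?S = "{..<n}"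
      have "c * real n powr q = real n powr (q - 1) * (c * real n)"
        using \<open>1 \<le> n\<close> by (simp add: powr_diff)
      also have "\<dots> \<le> real n powr (q - 1) * (\<integral>x. (\<Sum>i\<in>?S. h i x powr q) \<partial>M)"
        using sum_low[of ?S] by (intro mult_left_mono) auto
      also have "\<dots> = (\<integral>x. real n powr (q - 1) * (\<Sum>i\<in>?S. h i x powr q) \<partial>M)"
        by simp
      also have "\<dots> \<le> (\<integral>x. 2 * (\<Sum>i\<in>?S. h i x) powr q \<partial>M)"
        using True q nonneg int int1 card_sum_powr_le_powr_sum[of ?S _ q] by (intro integral_mono) auto
      also have "\<dots> \<le> 2 * C * real n powr \<beta>"
        using upper[of ?S] \<open>1 \<le> n\<close> by (auto simp: lessThan_empty_iff)
      finally show "c * real n powr q \<le> 2 * C * real n powr \<beta>" .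
    qed (rule c)
    ultimately show ?thesis using True by simp
  next
    case False
    then have q1: "1 \<le> q" by simp
    have ge1: "1 \<le> \<beta>"
    proof (rule powr_growth_imp_le[of c _ C])
      fix n :: nat assume "1 \<le> n"
      let ?S = "{..<n}"
      have "c * real n powr 1 \<le> (\<integral>x. (\<Sum>i\<in>?S. h i x powr q) \<partial>M)" using sum_low[of ?S] by simp
      also have "\<dots> \<le> (\<integral>x. (\<Sum>i\<in>?S. h i x) powr q \<partial>M)"
        using q1 nonneg int int1 by (intro integral_mono sum_powr_le_powr_sum) auto
      also have "\<dots> \<le> C * real n powr \<beta>"
        using upper[of ?S] \<open>1 \<le> n\<close> by (auto simp: lessThan_empty_iff)
      finally show "c * real n powr 1 \<le> C * real n powr \<beta>" .
    qed (rule c)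
    have leq: "\<beta> \<le> q"
    proof (rule powr_growth_imp_le[of c _ "2 powr q * C"])
      fix n :: nat assume "1 \<le> n"
      let ?S = "{..<n}"
      have "c * real n powr \<beta> \<le> (\<integral>x. (\<Sum>i\<in>?S. h i x) powr q \<partial>M)"
        using lower[of ?S] \<open>1 \<le> n\<close> by (auto simp: lessThan_empty_iff)
      also have "\<dots> \<le> (\<integral>x. 2 powr q * real n powr (q - 1) * (\<Sum>i\<in>?S. h i x powr q) \<partial>M)"
        using q1 nonneg int int1 powr_sum_le_card_sum_powr[of ?S _ q] by (intro integral_mono) auto
      also have "\<dots> = 2 powr q * real n powr (q - 1) * (\<integral>x. (\<Sum>i\<in>?S. h i x powr q) \<partial>M)"
        by simp
      also have "\<dots> \<le> 2 powr q * real n powr (q - 1) * (C * real n)"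
        using sum_up[of ?S] by (intro mult_left_mono) auto
      also have "\<dots> = 2 powr q * C * real n powr q"
        using \<open>1 \<le> n\<close> by (simp add: powr_diff)
      finally show "c * real n powr \<beta> \<le> 2 powr q * C * real n powr q" .
    qed (rule c)
    have inth: "integrable M (h i)" for i
    proof (rule Bochner_Integration.integrable_bound[of _ "\<lambda>x. 1 + h i x powr q"])
      show "AE x in M. norm (h i x) \<le> norm (1 + h i x powr q)"
        using le_add_powr_scaled[of q 1] q1 nonneg by (auto intro!: AE_I2)
    qed (use int1 in auto)
    show ?thesis
    proof (cases "\<exists>\<delta>>0. infinite {i. \<delta> \<le> (\<integral>x. h i x \<partial>M)}")
      case True
      then obtain \<delta> where \<delta>: "\<delta> > 0" "infinite {i. \<delta> \<le> (\<integral>x. h i x \<partial>M)}" by blast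
      define m where "m = measure M (space M)"
      have m: "m \<ge> 0" by (simp add: m_def)
      define l where "l = \<delta> / (2 * (m + 1))"
      have l: "l > 0" "l * measure M (space M) \<le> \<delta> / 2"
        using \<delta>(1) m by (auto simp: l_def m_def[symmetric] divide_simps)
      have "q \<le> \<beta>"
      proof (rule powr_growth_imp_le[of "\<delta> / 2" _ "l powr (1 - q) * C"])
        fix n :: nat assume n: "1 \<le> n"
        obtain S where S: "S \<subseteq> {i. \<delta> \<le> (\<integral>x. h i x \<partial>M)}" "finite S" "card S = n"
          using infinite_arbitrarily_large[OF \<delta>(2)] by blast
        have "S \<noteq> {}" using S n by auto
        have "n * \<delta> \<le> (\<Sum>i\<in>S. \<integral>x. h i x \<partial>M)"
          using S sum_bounded_below[of S \<delta> "\<lambda>i. \<integral>x. h i x \<partial>M"] by auto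
        also have "\<dots> = (\<integral>x. (\<Sum>i\<in>S. h i x) \<partial>M)"
          by (rule Bochner_Integration.integral_sum[symmetric]) (rule inth)
        also have "\<dots> \<le> (\<integral>x. n * l + (n * l) powr (1 - q) * (\<Sum>i\<in>S. h i x) powr q \<partial>M)"
        proof (intro integral_mono)
          show "(\<Sum>i\<in>S. h i x) \<le> n * l + (n * l) powr (1 - q) * (\<Sum>i\<in>S. h i x) powr q" for x
            using n l q1 nonneg by (intro le_add_powr_scaled) (auto intro: sum_nonneg)
        qed (use S int inth in auto)
        also have "\<dots> = n * (l * measure M (space M)) + (n * l) powr (1 - q) * (\<integral>x. (\<Sum>i\<in>S. h i x) powr q \<partial>M)"
          using S int by (simp add: mult_ac)
        also have "\<dots> \<le> n * (\<delta> / 2) + (n * l) powr (1 - q) * (C * n powr \<beta>)"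
          using l S \<open>S \<noteq> {}\<close> upper[of S] by (intro add_mono mult_left_mono) auto
        finally have "n * (\<delta> / 2) \<le> n powr (1 - q) * (l powr (1 - q) * C * n powr \<beta>)"
          using n l by (simp add: powr_mult mult_ac)
        then have "n powr (q - 1) * (n * (\<delta> / 2)) \<le>
            n powr (q - 1) * (n powr (1 - q) * (l powr (1 - q) * C * n powr \<beta>))"
          by (intro mult_left_mono) auto
        moreover have "n powr (q - 1) * (n * (\<delta> / 2)) = \<delta> / 2 * n powr q"
          using n by (simp add: powr_diff)
        moreover have "n powr (q - 1) * (n powr (1 - q) * (l powr (1 - q) * C * n powr \<beta>))
            = l powr (1 - q) * C * n powr \<beta>"
          using n by (simp add: mult.assoc[symmetric] powr_add[symmetric])
        ultimately show "\<delta> / 2 * n powr q \<le> l powr (1 - q) * C * n powr \<beta>" by linarith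
      qed (use \<delta> in simp)
      with leq False show ?thesis by simp
    next
      case fin: False
      have "(\<lambda>i. \<integral>x. norm (h i x) \<partial>M) \<longlonglongrightarrow> 0"
      proof (rule order_tendstoI)
        fix a :: real assume "0 < a"
        then have "finite {i. a \<le> (\<integral>x. h i x \<partial>M)}" using fin by blast
        then have "\<forall>\<^sub>F i in cofinite. \<not> a \<le> (\<integral>x. h i x \<partial>M)" by (simp add: eventually_cofinite)
        then show "\<forall>\<^sub>F i in sequentially. (\<integral>x. norm (h i x) \<partial>M) < a"
          using nonneg by (simp add: cofinite_eq_sequentially not_le)
      next
        fix a :: real assume "a < 0"
        then show "\<forall>\<^sub>F i in sequentially. a < (\<integral>x. norm (h i x) \<partial>M)"
          by (intro always_eventually allI less_le_trans[OF _ Bochner_Integration.integral_nonneg]) auto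
      qed
      from tendsto_L1_AE_subseq[OF inth this] obtain \<sigma> where \<sigma>: "strict_mono (\<sigma> :: nat \<Rightarrow> nat)"
        "AE x in M. (\<lambda>n. h (\<sigma> n) x) \<longlonglongrightarrow> 0" by blast
      have select: "\<exists>S. finite S \<and> card S = n \<and> (\<integral>x. (\<Sum>i\<in>S. h i x) powr q \<partial>M) \<le> (C + 1) * real n" for n
      proof (induction n)
        case 0
        then show ?case by (intro exI[of _ "{}"]) simp
      next
        case (Suc n)
        then obtain S where S: "finite S" "card S = n"
          "(\<integral>x. (\<Sum>i\<in>S. h i x) powr q \<partial>M) \<le> (C + 1) * real n" by blast
        define A where "A x = (\<Sum>i\<in>S. h i x)" for x
        have fin: "finite {k. \<sigma> k \<in> S}"
          using finite_vimageI[OF S(1) strict_mono_imp_inj_on[OF \<sigma>(1)]] by (simp add: vimage_def)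
        have new: "\<forall>\<^sub>F k in sequentially. \<sigma> k \<notin> S"
          using fin unfolding cofinite_eq_sequentially[symmetric] eventually_cofinite by simp
        define B where "B k = insert (\<sigma> k) S" for k
        \<comment> \<open>Indices that are already in \<open>S\<close> are few; setting their term to zero keeps one formula for all \<open>k\<close>.\<close>
        define g where "g k x = (if \<sigma> k \<in> S then 0 else h (\<sigma> k) x)" for k x
        have gsum: "A x + g k x = (\<Sum>i\<in>B k. h i x)" for k x
          using S by (simp add: A_def g_def B_def insert_absorb)
        have "\<forall>\<^sub>F k in sequentially. (\<integral>x. (A x + g k x) powr q \<partial>M) \<le> (\<integral>x. A x powr q \<partial>M) + C + 1"
        proof (rule nearly_disjoint_step)
          show "g k \<in> borel_measurable M" for k unfolding g_def by measurable
          show "integrable M (\<lambda>x. g k x powr q)" for k unfolding g_def using int1 by (cases "\<sigma> k \<in> S") auto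
          show "integrable M (\<lambda>x. (A x + g k x) powr q)" for k
            unfolding gsum using S by (intro int) (simp add: B_def)
          show "(\<integral>x. g k x powr q \<partial>M) \<le> C" for k
            unfolding g_def using up1 C by (cases "\<sigma> k \<in> S") auto
          show "AE x in M. (\<lambda>k. g k x) \<longlonglongrightarrow> 0" using \<sigma>(2)
          proof eventually_elim
            case (elim x)
            then show ?case
              by (rule Lim_null_comparison[rotated]) (auto simp: g_def nonneg)
          qed
          show "0 \<le> A x" for x unfolding A_def using nonneg by (intro sum_nonneg)
          show "integrable M (\<lambda>x. A x powr q)" unfolding A_def using S int by simp
        qed (use q nonneg in \<open>auto simp: A_def g_def\<close>)
        with new have "\<forall>\<^sub>F k in sequentially. \<sigma> k \<notin> S \<and>
            (\<integral>x. (A x + g k x) powr q \<partial>M) \<le> (\<integral>x. A x powr q \<partial>M) + C + 1"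
          by (rule eventually_conj)
        then obtain k where k: "\<sigma> k \<notin> S"
          "(\<integral>x. (A x + g k x) powr q \<partial>M) \<le> (\<integral>x. A x powr q \<partial>M) + C + 1"
          using eventually_happens'[OF sequentially_bot] by blast
        show ?case
        proof (intro exI conjI)
          show "finite (B k)" "card (B k) = Suc n" using k S by (auto simp: B_def)
          have "(\<integral>x. (\<Sum>i\<in>B k. h i x) powr q \<partial>M) \<le> (\<integral>x. A x powr q \<partial>M) + C + 1"
            using k(2) unfolding gsum .
          also have "\<dots> \<le> (C + 1) * real n + C + 1" using S(3) by (simp add: A_def)
          also have "\<dots> = (C + 1) * real (Suc n)" by (simp add: algebra_simps)
          finally show "(\<integral>x. (\<Sum>i\<in>B k. h i x) powr q \<partial>M) \<le> (C + 1) * real (Suc n)" .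
        qed
      qed
      have "\<beta> \<le> 1"
      proof (rule powr_growth_imp_le[of c _ "C + 1"])
        fix n :: nat assume n: "1 \<le> n"
        obtain S where S: "finite S" "card S = n"
          "(\<integral>x. (\<Sum>i\<in>S. h i x) powr q \<partial>M) \<le> (C + 1) * real n" using select by blast
        have "S \<noteq> {}" using S n by auto
        then show "c * real n powr \<beta> \<le> (C + 1) * real n powr 1" using lower[of S] S by simp
      qed (rule c)
      with ge1 False show ?thesis by simp
    qed
  qed
qed

section \<open>Khinchine inequalities for tuples\<close>

text \<open>
  The set \<open>A\<close> holds the indices with a plus sign, so a mean over all choices of signs on \<open>S\<close> is a mean
  over the subsets of \<open>S\<close>.
\<close>

definition signed_sum :: "'i set \<Rightarrow> 'i set \<Rightarrow> ('i \<Rightarrow> 'a::ab_group_add) \<Rightarrow> 'a" where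
  "signed_sum S A v = (\<Sum>i\<in>S. if i \<in> A then v i else - v i)"

lemma fact_double_ge: "2 ^ n * fact n \<le> (fact (2 * n) :: real)"
proof (induction n)
  case (Suc n)
  have "2 ^ Suc n * fact (Suc n) = (2 * (real n + 1)) * (2 ^ n * fact n)" by simp
  also have "\<dots> \<le> (2 * (real n + 1)) * fact (2 * n)"
    using Suc by (intro mult_left_mono) auto
  also have "\<dots> \<le> (2 * real n + 1) * (2 * (real n + 1)) * fact (2 * n)"
    by (simp add: algebra_simps)
  also have "\<dots> = fact (2 * Suc n)" by (simp add: algebra_simps)
  finally show ?case .
qed simp

text \<open>
  The power series are compared term by term.
\<close>

lemma cosh_le_exp_half_square: "cosh x \<le> exp (x\<^sup>2 / 2)" for x :: real
proof -
  have e: "(\<lambda>n. (x\<^sup>2 / 2) ^ n / fact n) sums exp (x\<^sup>2 / 2)"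
    using exp_converges[of "x\<^sup>2 / 2"] unfolding real_scaleR_def divide_inverse_commute[symmetric] .
  have s1: "(\<lambda>n. if even n then (x\<^sup>2 / 2) ^ (n div 2) / fact (n div 2) else 0) sums (0 + exp (x\<^sup>2 / 2))"
    using sums_if[OF sums_zero e] by simp
  have s2: "(\<lambda>n. if even n then x ^ n /\<^sub>R fact n else 0) sums cosh x" by (rule cosh_converges)
  have "cosh x \<le> 0 + exp (x\<^sup>2 / 2)"
  proof (rule sums_le[OF _ s2 s1])
    fix n
    show "(if even n then x ^ n /\<^sub>R fact n else 0) \<le>
        (if even n then (x\<^sup>2 / 2) ^ (n div 2) / fact (n div 2) else 0)"
    proof (cases "even n")
      case True
      then obtain k where n: "n = 2 * k" by blast
      have "(x\<^sup>2) ^ k / fact (2 * k) \<le> (x\<^sup>2) ^ k / (2 ^ k * fact k)"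
        using fact_double_ge[of k] by (intro divide_left_mono) auto
      then show ?thesis 
        unfolding n real_scaleR_def divide_inverse_commute[symmetric] by (simp add: power_mult power_divide)
    qed simp
  qed
  then show ?thesis by simp
qed

text \<open>
  The combinatorial form of the independence of signs: the sum over all subsets factors into a product
  of hyperbolic cosines.
\<close>

lemma sum_exp_signed_sum_le:
  fixes v :: "'i \<Rightarrow> real"
  assumes S: "finite S"
  shows "(\<Sum>A\<in>Pow S. exp (signed_sum S A v)) \<le> 2 ^ card S * exp ((\<Sum>i\<in>S. (v i)\<^sup>2) / 2)"
proof -
  have "(\<Sum>A\<in>Pow S. exp (signed_sum S A v)) =
      (\<Sum>A\<in>Pow S. (\<Prod>i\<in>A. exp (v i)) * (\<Prod>i\<in>S - A. exp (- v i)))"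
  proof (rule sum.cong[OF refl])
    fix A assume A: "A \<in> Pow S"
    have "exp (signed_sum S A v) = (\<Prod>i\<in>S. exp (if i \<in> A then v i else - v i))"
      using S by (simp add: signed_sum_def exp_sum)
    also have "\<dots> = (\<Prod>i\<in>S - A. exp (if i \<in> A then v i else - v i)) *
        (\<Prod>i\<in>A. exp (if i \<in> A then v i else - v i))"
      using A S by (intro prod.subset_diff) auto
    also have "(\<Prod>i\<in>A. exp (if i \<in> A then v i else - v i)) = (\<Prod>i\<in>A. exp (v i))"
      by (intro prod.cong) auto
    also have "(\<Prod>i\<in>S - A. exp (if i \<in> A then v i else - v i)) = (\<Prod>i\<in>S - A. exp (- v i))"
      by (intro prod.cong) auto
    finally show "exp (signed_sum S A v) = (\<Prod>i\<in>A. exp (v i)) * (\<Prod>i\<in>S - A. exp (- v i))"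
      by (simp add: mult.commute)
  qed
  also have "\<dots> = (\<Prod>i\<in>S. exp (v i) + exp (- v i))"
    using S by (rule prod_add[symmetric])
  also have "\<dots> = (\<Prod>i\<in>S. 2 * cosh (v i))"
    by (intro prod.cong) (auto simp: cosh_field_def)
  also have "\<dots> \<le> (\<Prod>i\<in>S. 2 * exp ((v i)\<^sup>2 / 2))"
    by (intro prod_mono) (auto intro: cosh_le_exp_half_square)
  also have "\<dots> = 2 ^ card S * exp ((\<Sum>i\<in>S. (v i)\<^sup>2) / 2)"
    using S by (simp add: prod.distrib exp_sum[symmetric] sum_divide_distrib)
  finally show ?thesis .
qed

lemma sum_Pow_insert:
  assumes "finite S" "x \<notin> S"
  shows "(\<Sum>A\<in>Pow (insert x S). f A) = (\<Sum>A\<in>Pow S. f A + f (insert x A))"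
proof -
  have inj: "inj_on (insert x) (Pow S)" using assms by (auto simp: inj_on_def)
  have "(\<Sum>A\<in>Pow (insert x S). f A) = (\<Sum>A\<in>Pow S. f A) + (\<Sum>A\<in>insert x ` Pow S. f A)"
    unfolding Pow_insert using assms by (intro sum.union_disjoint) auto
  also have "(\<Sum>A\<in>insert x ` Pow S. f A) = (\<Sum>A\<in>Pow S. f (insert x A))"
    using inj by (simp add: sum.reindex)
  finally show ?thesis by (simp add: sum.distrib)
qed

lemma sum_signed_sum_square:
  fixes v :: "'i \<Rightarrow> real"
  assumes "finite S"
  shows "(\<Sum>A\<in>Pow S. (signed_sum S A v)\<^sup>2) = 2 ^ card S * (\<Sum>i\<in>S. (v i)\<^sup>2)"
  using assms
proof (induction S)
  case empty
  then show ?case by (simp add: signed_sum_def)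
next
  case (insert x S)
  have 1: "signed_sum (insert x S) A v = signed_sum S A v - v x" if "A \<subseteq> S" for A
    using insert that by (auto simp: signed_sum_def)
  have 2: "signed_sum (insert x S) (insert x A) v = signed_sum S A v + v x" if "A \<subseteq> S" for A
  proof -
    have "(\<Sum>i\<in>S. if i \<in> insert x A then v i else - v i) = (\<Sum>i\<in>S. if i \<in> A then v i else - v i)"
      using insert by (intro sum.cong) auto
    then show ?thesis using insert by (simp add: signed_sum_def)
  qed
  have "(\<Sum>A\<in>Pow (insert x S). (signed_sum (insert x S) A v)\<^sup>2) =
      (\<Sum>A\<in>Pow S. (signed_sum S A v - v x)\<^sup>2 + (signed_sum S A v + v x)\<^sup>2)"
    using insert by (subst sum_Pow_insert) (auto simp: 1 2 intro!: sum.cong)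
  also have "\<dots> = (\<Sum>A\<in>Pow S. 2 * (signed_sum S A v)\<^sup>2 + 2 * (v x)\<^sup>2)"
    by (intro sum.cong) (auto simp: power2_eq_square algebra_simps)
  also have "\<dots> = 2 * (\<Sum>A\<in>Pow S. (signed_sum S A v)\<^sup>2) + 2 ^ card S * (2 * (v x)\<^sup>2)"
    using insert unfolding sum.distrib sum_distrib_left[symmetric] by (simp add: card_Pow)
  also have "\<dots> = 2 ^ card (insert x S) * (\<Sum>i\<in>insert x S. (v i)\<^sup>2)"
    using insert by (simp add: algebra_simps)
  finally show ?case .
qed

lemma powr_le_exp:
  fixes t y :: real
  assumes "0 < t" "0 \<le> y"
  shows "y powr t \<le> t powr t * exp y"
proof -
  have "y / t \<le> exp (y / t)" using exp_ge_add_one_self[of "y / t"] by linarith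
  then have "(y / t) powr t \<le> exp (y / t) powr t" using assms by (intro powr_mono2) auto
  also have "\<dots> = exp y" using assms by (simp add: powr_def)
  finally show ?thesis using assms by (simp add: powr_divide field_simps)
qed

text \<open>
  For \<open>\<Sum> v\<^sub>i\<^sup>2 = 1\<close> the exponential moment is bounded, and it dominates all power moments. The general
  case follows by homogeneity.
\<close>

lemma sum_signed_sum_powr_le:
  fixes v :: "'i \<Rightarrow> real"
  assumes S: "finite S" and t: "0 < t"
  shows "(\<Sum>A\<in>Pow S. \<bar>signed_sum S A v\<bar> powr t) \<le>
    2 * t powr t * exp (1 / 2) * 2 ^ card S * (\<Sum>i\<in>S. (v i)\<^sup>2) powr (t / 2)"
proof (cases "(\<Sum>i\<in>S. (v i)\<^sup>2) = 0")
  case True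
  then have "\<forall>i\<in>S. v i = 0" using S by (simp add: sum_nonneg_eq_0_iff)
  then have "signed_sum S A v = 0" for A unfolding signed_sum_def by (intro sum.neutral) auto
  then show ?thesis by (simp add: True)
next
  case False
  define \<sigma> where "\<sigma> = sqrt (\<Sum>i\<in>S. (v i)\<^sup>2)"
  have nn: "(\<Sum>i\<in>S. (v i)\<^sup>2) \<ge> 0" by (intro sum_nonneg) auto
  have \<sigma>: "\<sigma> > 0" using False nn by (simp add: \<sigma>_def)
  define w where "w i = v i / \<sigma>" for i
  have w: "(\<Sum>i\<in>S. (w i)\<^sup>2) = 1"
    using False nn by (simp add: w_def power_divide sum_divide_distrib[symmetric] \<sigma>_def)
  have w': "(\<Sum>i\<in>S. (- w i)\<^sup>2) = 1" using w by simp
  have scal: "signed_sum S A v = \<sigma> * signed_sum S A w" for A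
    using \<sigma> by (auto simp: signed_sum_def w_def sum_distrib_left intro!: sum.cong)
  have neg: "signed_sum S A (\<lambda>i. - w i) = - signed_sum S A w" for A
    by (auto simp: signed_sum_def sum_negf[symmetric] intro!: sum.cong)
  have "\<bar>signed_sum S A w\<bar> powr t \<le>
      t powr t * (exp (signed_sum S A w) + exp (signed_sum S A (\<lambda>i. - w i)))" for A
  proof -
    have "\<bar>signed_sum S A w\<bar> powr t \<le> t powr t * exp \<bar>signed_sum S A w\<bar>"
      using t by (intro powr_le_exp) auto
    also have "exp \<bar>signed_sum S A w\<bar> \<le> exp (signed_sum S A w) + exp (signed_sum S A (\<lambda>i. - w i))"
      by (simp add: neg abs_if)
    finally show ?thesis by (simp add: mult_left_mono)
  qed
  then have "(\<Sum>A\<in>Pow S. \<bar>signed_sum S A w\<bar> powr t) \<le>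
      (\<Sum>A\<in>Pow S. t powr t * (exp (signed_sum S A w) + exp (signed_sum S A (\<lambda>i. - w i))))"
    by (rule sum_mono)
  also have "\<dots> = t powr t * ((\<Sum>A\<in>Pow S. exp (signed_sum S A w)) +
      (\<Sum>A\<in>Pow S. exp (signed_sum S A (\<lambda>i. - w i))))"
    by (simp only: sum_distrib_left[symmetric] sum.distrib)
  also have "\<dots> \<le> t powr t * (2 ^ card S * exp (1 / 2) + 2 ^ card S * exp (1 / 2))"
    using sum_exp_signed_sum_le[OF S, of w] sum_exp_signed_sum_le[OF S, of "\<lambda>i. - w i"]
    unfolding w w' by (intro mult_left_mono add_mono) auto
  finally have *: "(\<Sum>A\<in>Pow S. \<bar>signed_sum S A w\<bar> powr t) \<le> 2 * t powr t * exp (1 / 2) * 2 ^ card S"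
    by (simp add: mult_ac)
  have "(\<Sum>A\<in>Pow S. \<bar>signed_sum S A v\<bar> powr t) = \<sigma> powr t * (\<Sum>A\<in>Pow S. \<bar>signed_sum S A w\<bar> powr t)"
    using \<sigma> by (simp add: scal abs_mult powr_mult sum_distrib_left)
  also have "\<dots> \<le> \<sigma> powr t * (2 * t powr t * exp (1 / 2) * 2 ^ card S)"
    using * by (intro mult_left_mono) auto
  also have "\<sigma> powr t = (\<Sum>i\<in>S. (v i)\<^sup>2) powr (t / 2)"
    using nn by (simp add: \<sigma>_def powr_half_sqrt[symmetric] powr_powr)
  finally show ?thesis by (simp add: mult_ac)
qed

text \<open>
  Each entry is at most the \<open>\<beta>\<close>-mean of the tuple; so all power means of tuples of a fixed length are
  comparable.
\<close>

lemma sum_powr_powr_le: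
  fixes y :: "'j \<Rightarrow> real"
  assumes J: "finite J" and y: "\<And>j. j \<in> J \<Longrightarrow> 0 \<le> y j" and pos: "0 < \<alpha>" "0 < \<beta>" "0 < q"
  shows "(\<Sum>j\<in>J. y j powr \<alpha>) powr (q / \<alpha>) \<le> real (card J) powr (q / \<alpha>) * (\<Sum>j\<in>J. y j powr \<beta>) powr (q / \<beta>)"
proof -
  let ?m = "(\<Sum>j\<in>J. y j powr \<beta>) powr (1 / \<beta>)"
  have le: "y j \<le> ?m" if "j \<in> J" for j
  proof -
    have "y j powr \<beta> \<le> (\<Sum>j\<in>J. y j powr \<beta>)" using J that by (intro member_le_sum) auto
    then have "(y j powr \<beta>) powr (1 / \<beta>) \<le> ?m" using pos by (intro powr_mono2) auto
    then show ?thesis using pos y[OF that] by (simp add: powr_powr)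
  qed
  have "(\<Sum>j\<in>J. y j powr \<alpha>) \<le> (\<Sum>j\<in>J. ?m powr \<alpha>)"
    using pos y le by (intro sum_mono powr_mono2) auto
  then have "(\<Sum>j\<in>J. y j powr \<alpha>) powr (q / \<alpha>) \<le> (real (card J) * ?m powr \<alpha>) powr (q / \<alpha>)"
    using pos by (intro powr_mono2) (auto intro: sum_nonneg)
  then show ?thesis using pos by (simp add: powr_mult powr_powr)
qed

text \<open>
  Khinchine's inequality for vectors with finitely many real components, written for the squared norm \<open>R\<close>
  of the signed sum, whose mean is exactly \<open>V\<close>. The upper bound holds for each component. The lower bound
  follows from the mean of \<open>R\<close>: for \<open>s \<ge> 2\<close> by convexity, for \<open>s < 2\<close> since large values of \<open>R\<close> contribute
  little to it, by the bound on the mean of \<open>R\<^sup>2\<close>.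
\<close>

lemma khinchine_components:
  fixes M :: "'m set" and s :: real
  assumes M: "finite M" and s: "0 < s"
  obtains c C where "c > 0" "C > 0"
    "\<And>(S::'i set) w. finite S \<Longrightarrow>
      c * (\<Sum>i\<in>S. \<Sum>m\<in>M. (w i m)\<^sup>2) powr (s / 2) \<le>
      (\<Sum>A\<in>Pow S. (\<Sum>m\<in>M. (signed_sum S A (\<lambda>i. w i m))\<^sup>2) powr (s / 2)) / 2 ^ card S"
    "\<And>(S::'i set) w. finite S \<Longrightarrow>
      (\<Sum>A\<in>Pow S. (\<Sum>m\<in>M. (signed_sum S A (\<lambda>i. w i m))\<^sup>2) powr (s / 2)) / 2 ^ card S \<le>
      C * (\<Sum>i\<in>S. \<Sum>m\<in>M. (w i m)\<^sup>2) powr (s / 2)"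
proof -
  define R where "R S w A = (\<Sum>m\<in>M. (signed_sum S A (\<lambda>i. w i m))\<^sup>2)"
    for S :: "'i set" and w :: "'i \<Rightarrow> 'm \<Rightarrow> real" and A
  define V where "V S w = (\<Sum>i\<in>S. \<Sum>m\<in>M. (w i m)\<^sup>2)" for S :: "'i set" and w :: "'i \<Rightarrow> 'm \<Rightarrow> real"
  define E where "E S f = (\<Sum>A\<in>Pow S. f A) / 2 ^ card S" for S :: "'i set" and f :: "'i set \<Rightarrow> real"
  have R0: "R S w A \<ge> 0" for S w A by (auto simp: R_def intro: sum_nonneg)
  have V0: "V S w \<ge> 0" for S w by (auto simp: V_def intro!: sum_nonneg)
  have E_mono: "E S f \<le> E S g" if "\<And>A. f A \<le> g A" for S f g
    using that by (auto simp: E_def intro!: divide_right_mono sum_mono)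
  have E_add: "E S (\<lambda>A. f A + g A) = E S f + E S g" for S f g
    by (simp add: E_def sum.distrib add_divide_distrib)
  have E_mult: "E S (\<lambda>A. a * f A) = a * E S f" for S f a
    by (simp add: E_def sum_distrib_left)
  have E_const: "E S (\<lambda>A. a) = a" if "finite S" for S a
    using that by (simp add: E_def card_Pow)
  define K where "K t = real (card M) powr (t / 2) * (\<Sum>m\<in>M. 2 * t powr t * exp (1 / 2))" for t
  have K0: "K t \<ge> 0" for t by (auto simp: K_def intro!: mult_nonneg_nonneg sum_nonneg)
  have up: "E S (\<lambda>A. R S w A powr (t / 2)) \<le> K t * V S w powr (t / 2)"
    if S: "finite S" and t: "0 < t" for S w t
  proof -
    have "R S w A powr (t / 2) \<le>
        real (card M) powr (t / 2) * (\<Sum>m\<in>M. \<bar>signed_sum S A (\<lambda>i. w i m)\<bar> powr t)" for A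
      using sum_powr_powr_le[OF M, of "\<lambda>m. \<bar>signed_sum S A (\<lambda>i. w i m)\<bar>" 2 t t] t
      by (simp add: R_def sum_nonneg)
    then have "E S (\<lambda>A. R S w A powr (t / 2)) \<le>
        E S (\<lambda>A. real (card M) powr (t / 2) * (\<Sum>m\<in>M. \<bar>signed_sum S A (\<lambda>i. w i m)\<bar> powr t))"
      by (rule E_mono)
    also have "\<dots> = real (card M) powr (t / 2) *
        (\<Sum>m\<in>M. \<Sum>A\<in>Pow S. \<bar>signed_sum S A (\<lambda>i. w i m)\<bar> powr t) / 2 ^ card S"
      unfolding E_mult E_def by (subst sum.swap) simp
    also have "\<dots> \<le> real (card M) powr (t / 2) *
        (\<Sum>m\<in>M. 2 * t powr t * exp (1 / 2) * 2 ^ card S * V S w powr (t / 2)) / 2 ^ card S"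
    proof (intro divide_right_mono mult_left_mono sum_mono)
      fix m assume m: "m \<in> M"
      have "(\<Sum>A\<in>Pow S. \<bar>signed_sum S A (\<lambda>i. w i m)\<bar> powr t) \<le>
          2 * t powr t * exp (1 / 2) * 2 ^ card S * (\<Sum>i\<in>S. (w i m)\<^sup>2) powr (t / 2)"
        by (rule sum_signed_sum_powr_le[OF S t])
      also have "\<dots> \<le> 2 * t powr t * exp (1 / 2) * 2 ^ card S * V S w powr (t / 2)"
        unfolding V_def using t M m
        by (intro mult_left_mono powr_mono2 sum_mono sum_nonneg member_le_sum[of m M "\<lambda>m. (w _ m)\<^sup>2"]) auto
      finally show "(\<Sum>A\<in>Pow S. \<bar>signed_sum S A (\<lambda>i. w i m)\<bar> powr t) \<le>
          2 * t powr t * exp (1 / 2) * 2 ^ card S * V S w powr (t / 2)" .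
    qed auto
    also have "\<dots> = K t * V S w powr (t / 2)"
      by (simp add: K_def)
    finally show ?thesis .
  qed
  have second: "E S (R S w) = V S w" if S: "finite S" for S w
  proof -
    have "E S (R S w) = (\<Sum>m\<in>M. \<Sum>A\<in>Pow S. (signed_sum S A (\<lambda>i. w i m))\<^sup>2) / 2 ^ card S"
      unfolding E_def R_def by (subst sum.swap) simp
    also have "\<dots> = (\<Sum>m\<in>M. \<Sum>i\<in>S. (w i m)\<^sup>2)"
      by (simp add: sum_signed_sum_square[OF S] sum_distrib_left[symmetric])
    also have "\<dots> = V S w" unfolding V_def by (rule sum.swap)
    finally show ?thesis .
  qed
  define B where "B = K 4 + 1"
  have B: "B > 0" using K0[of 4] by (simp add: B_def)
  have fourth: "E S (\<lambda>A. (R S w A)\<^sup>2) \<le> B * (V S w)\<^sup>2" if "finite S" for S w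
  proof -
    have "E S (\<lambda>A. (R S w A)\<^sup>2) \<le> K 4 * (V S w)\<^sup>2"
      using up[OF that, of 4 w] R0 V0 by (simp add: powr_numeral)
    also have "\<dots> \<le> B * (V S w)\<^sup>2" by (intro mult_right_mono) (auto simp: B_def)
    finally show ?thesis .
  qed
  define c where "c = (if 2 \<le> s then (1/2) powr (s / 2) else 1 / 2 * (2 * B) powr (s / 2 - 1))"
  have c: "c > 0" using B by (simp add: c_def)
  have low: "c * V S w powr (s / 2) \<le> E S (\<lambda>A. R S w A powr (s / 2))" if S: "finite S" for S w
  proof (cases "V S w = 0")
    case True
    have "0 \<le> E S (\<lambda>A. R S w A powr (s / 2))" by (auto simp: E_def intro!: divide_nonneg_nonneg sum_nonneg)
    then show ?thesis by (simp add: True)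
  next
    case False
    then have V: "V S w > 0" using V0[of S w] by linarith
    let ?v = "V S w" and ?q = "s / 2"
    show ?thesis
    proof (cases "2 \<le> s")
      case True
      define l where "l = ?v / 2"
      have l: "l > 0" using V by (simp add: l_def)
      have "?v = E S (R S w)" using second[OF S] by simp
      also have "\<dots> \<le> E S (\<lambda>A. l + l powr (1 - ?q) * R S w A powr ?q)"
        using True l R0 by (intro E_mono le_add_powr_scaled) auto
      also have "\<dots> = l + l powr (1 - ?q) * E S (\<lambda>A. R S w A powr ?q)"
        by (simp add: E_add E_mult E_const[OF S])
      finally have "l \<le> l powr (1 - ?q) * E S (\<lambda>A. R S w A powr ?q)" by (simp add: l_def)
      then have "l powr (?q - 1) * l \<le> l powr (?q - 1) * (l powr (1 - ?q) * E S (\<lambda>A. R S w A powr ?q))"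
        by (intro mult_left_mono) auto
      then have "l powr ?q \<le> E S (\<lambda>A. R S w A powr ?q)"
        using l by (simp add: mult.assoc[symmetric] powr_add[symmetric]) (simp add: powr_diff)
      then show ?thesis using True V by (simp add: c_def l_def powr_divide)
    next
      case False
      \<comment> \<open>Above \<open>L\<close> the bound on the mean of \<open>R\<^sup>2\<close> accounts for at most half of \<open>V\<close>.\<close>
      define L where "L = 2 * B * ?v"
      have L: "L > 0" using V B by (simp add: L_def)
      have "y \<le> L powr (1 - ?q) * y powr ?q + (1 / L) * y\<^sup>2" if "y \<ge> 0" for y
      proof (cases "y \<le> L")
        case True
        have "y = y powr (1 - ?q) * y powr ?q"
          using that by (cases "y = 0") (simp_all add: powr_add[symmetric])
        also have "\<dots> \<le> L powr (1 - ?q) * y powr ?q"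
          using that True False by (intro mult_right_mono powr_mono2) auto
        finally show ?thesis using L by (simp add: add_increasing2)
      next
        case False
        then have "y * L \<le> y * y" using that by (intro mult_left_mono) auto
        then have "y \<le> (1 / L) * y\<^sup>2" using L by (simp add: field_simps power2_eq_square)
        then show ?thesis by (simp add: add_increasing)
      qed
      then have "E S (R S w) \<le> E S (\<lambda>A. L powr (1 - ?q) * R S w A powr ?q + (1 / L) * (R S w A)\<^sup>2)"
        using R0 by (intro E_mono) auto
      also have "\<dots> = L powr (1 - ?q) * E S (\<lambda>A. R S w A powr ?q) + (1 / L) * E S (\<lambda>A. (R S w A)\<^sup>2)"
        by (simp only: E_add E_mult)
      also have "(1 / L) * E S (\<lambda>A. (R S w A)\<^sup>2) \<le> (1 / L) * (B * ?v\<^sup>2)"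
        using L fourth[OF S] by (intro mult_left_mono) auto
      also have "(1 / L) * (B * ?v\<^sup>2) = ?v / 2"
        using B V by (simp add: L_def power2_eq_square)
      finally have "?v / 2 \<le> L powr (1 - ?q) * E S (\<lambda>A. R S w A powr ?q)"
        by (simp add: second[OF S])
      then have "L powr (?q - 1) * (?v / 2) \<le>
          L powr (?q - 1) * (L powr (1 - ?q) * E S (\<lambda>A. R S w A powr ?q))"
        by (intro mult_left_mono) auto
      also have "\<dots> = E S (\<lambda>A. R S w A powr ?q)"
        using L by (simp add: mult.assoc[symmetric] powr_add[symmetric])
      also have "L powr (?q - 1) * (?v / 2) = c * ?v powr ?q"
        using V B False by (simp add: L_def c_def powr_mult powr_diff)
      finally show ?thesis .
    qed
  qed
  show ?thesis
  proof (rule that[of c "K s + 1"])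
    show "c > 0" "K s + 1 > 0" using c K0[of s] by auto
    fix S :: "'i set" and w assume S: "finite S"
    show "c * (\<Sum>i\<in>S. \<Sum>m\<in>M. (w i m)\<^sup>2) powr (s / 2) \<le>
      (\<Sum>A\<in>Pow S. (\<Sum>m\<in>M. (signed_sum S A (\<lambda>i. w i m))\<^sup>2) powr (s / 2)) / 2 ^ card S"
      using low[OF S, of w] by (simp add: V_def R_def E_def)
    have "E S (\<lambda>A. R S w A powr (s / 2)) \<le> (K s + 1) * V S w powr (s / 2)"
      by (rule order.trans[OF up[OF S s] mult_right_mono]) auto
    then show "(\<Sum>A\<in>Pow S. (\<Sum>m\<in>M. (signed_sum S A (\<lambda>i. w i m))\<^sup>2) powr (s / 2)) / 2 ^ card S \<le>
      (K s + 1) * (\<Sum>i\<in>S. \<Sum>m\<in>M. (w i m)\<^sup>2) powr (s / 2)"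
      by (simp add: V_def R_def E_def)
  qed
qed

text \<open>
  The real components of all entries reduce this to the previous lemma. The inner exponent \<open>r\<close>
  costs only a factor depending on the length of the tuple.
\<close>

lemma khinchine_tuple:
  fixes J :: "'j set" and r s :: real
  assumes J: "finite J" and r: "0 < r" and s: "0 < s"
  obtains c C where "c > 0" "C > 0"
    "\<And>(S::'i set) (z :: 'i \<Rightarrow> 'j \<Rightarrow> 'k::euclidean_space). finite S \<Longrightarrow>
      c * (\<Sum>i\<in>S. \<Sum>n\<in>J. (norm (z i n))\<^sup>2) powr (s / 2) \<le>
      (\<Sum>A\<in>Pow S. (\<Sum>n\<in>J. norm (signed_sum S A (\<lambda>i. z i n)) powr r) powr (s / r)) / 2 ^ card S"
    "\<And>(S::'i set) (z :: 'i \<Rightarrow> 'j \<Rightarrow> 'k::euclidean_space). finite S \<Longrightarrow>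
      (\<Sum>A\<in>Pow S. (\<Sum>n\<in>J. norm (signed_sum S A (\<lambda>i. z i n)) powr r) powr (s / r)) / 2 ^ card S \<le>
      C * (\<Sum>i\<in>S. \<Sum>n\<in>J. (norm (z i n))\<^sup>2) powr (s / 2)"
proof -
  let ?M = "J \<times> (Basis :: 'k set)"
  obtain c C where cC: "c > 0" "C > 0"
    "\<And>(S::'i set) w. finite S \<Longrightarrow>
      c * (\<Sum>i\<in>S. \<Sum>m\<in>?M. (w i m)\<^sup>2) powr (s / 2) \<le>
      (\<Sum>A\<in>Pow S. (\<Sum>m\<in>?M. (signed_sum S A (\<lambda>i. w i m))\<^sup>2) powr (s / 2)) / 2 ^ card S"
    "\<And>(S::'i set) w. finite S \<Longrightarrow>
      (\<Sum>A\<in>Pow S. (\<Sum>m\<in>?M. (signed_sum S A (\<lambda>i. w i m))\<^sup>2) powr (s / 2)) / 2 ^ card S \<le>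
      C * (\<Sum>i\<in>S. \<Sum>m\<in>?M. (w i m)\<^sup>2) powr (s / 2)"
    using khinchine_components[of ?M s] J s by (auto simp: finite_cartesian_product)
  have n2: "(norm x)\<^sup>2 = (\<Sum>b\<in>Basis. (x \<bullet> b)\<^sup>2)" for x :: 'k
    unfolding power2_norm_eq_inner by (subst euclidean_inner) (simp add: power2_eq_square)
  have inner: "signed_sum S A v \<bullet> b = signed_sum S A (\<lambda>i. v i \<bullet> b)" for S A b and v :: "'i \<Rightarrow> 'k"
    unfolding signed_sum_def inner_sum_left by (intro sum.cong) auto
  have prod: "(\<Sum>n\<in>J. (norm (f n))\<^sup>2) = (\<Sum>m\<in>?M. (f (fst m) \<bullet> snd m)\<^sup>2)" for f :: "'j \<Rightarrow> 'k"
    unfolding n2 by (simp add: sum.cartesian_product split_def)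
  define w where "w z i m = z i (fst m) \<bullet> snd m" for z :: "'i \<Rightarrow> 'j \<Rightarrow> 'k" and i m
  have V: "(\<Sum>i\<in>S. \<Sum>n\<in>J. (norm (z i n))\<^sup>2) = (\<Sum>i\<in>S. \<Sum>m\<in>?M. (w z i m)\<^sup>2)" for S z
    unfolding prod w_def ..
  have X: "(\<Sum>n\<in>J. (norm (signed_sum S A (\<lambda>i. z i n)))\<^sup>2) =
      (\<Sum>m\<in>?M. (signed_sum S A (\<lambda>i. w z i m))\<^sup>2)" for S A z
    unfolding prod w_def inner ..
  define k where "k = real (card J) powr (s / r) + 1"
  define l where "l = real (card J) powr (s / 2) + 1"
  have kl: "k > 0" "l > 0" by (auto simp: k_def l_def add_nonneg_pos)
  have up: "(\<Sum>n\<in>J. norm (f n) powr r) powr (s / r) \<le> k * (\<Sum>n\<in>J. (norm (f n))\<^sup>2) powr (s / 2)"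
    for f :: "'j \<Rightarrow> 'k"
  proof -
    have "(\<Sum>n\<in>J. norm (f n) powr r) powr (s / r) \<le>
        real (card J) powr (s / r) * (\<Sum>n\<in>J. norm (f n) powr 2) powr (s / 2)"
      using J r s by (intro sum_powr_powr_le) auto
    also have "\<dots> \<le> k * (\<Sum>n\<in>J. norm (f n) powr 2) powr (s / 2)"
      by (intro mult_right_mono) (auto simp: k_def)
    finally show ?thesis by simp
  qed
  have low: "(\<Sum>n\<in>J. (norm (f n))\<^sup>2) powr (s / 2) \<le> l * (\<Sum>n\<in>J. norm (f n) powr r) powr (s / r)"
    for f :: "'j \<Rightarrow> 'k"
  proof -
    have "(\<Sum>n\<in>J. norm (f n) powr 2) powr (s / 2) \<le>
        real (card J) powr (s / 2) * (\<Sum>n\<in>J. norm (f n) powr r) powr (s / r)"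
      using J r s by (intro sum_powr_powr_le) auto
    also have "\<dots> \<le> l * (\<Sum>n\<in>J. norm (f n) powr r) powr (s / r)"
      by (intro mult_right_mono) (auto simp: l_def)
    finally show ?thesis by simp
  qed
  show ?thesis
  proof (rule that[of "c / l" "k * C"])
    show "c / l > 0" "k * C > 0" using cC kl by auto
    fix S :: "'i set" and z :: "'i \<Rightarrow> 'j \<Rightarrow> 'k" assume S: "finite S"
    have "c * (\<Sum>i\<in>S. \<Sum>n\<in>J. (norm (z i n))\<^sup>2) powr (s / 2) \<le>
        (\<Sum>A\<in>Pow S. (\<Sum>n\<in>J. (norm (signed_sum S A (\<lambda>i. z i n)))\<^sup>2) powr (s / 2)) / 2 ^ card S"
      unfolding V X by (rule cC(3)[OF S])
    also have "\<dots> \<le> (\<Sum>A\<in>Pow S. l * (\<Sum>n\<in>J. norm (signed_sum S A (\<lambda>i. z i n)) powr r) powr (s / r)) / 2 ^ card S"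
      by (intro divide_right_mono sum_mono low) auto
    also have "\<dots> = l * ((\<Sum>A\<in>Pow S. (\<Sum>n\<in>J. norm (signed_sum S A (\<lambda>i. z i n)) powr r) powr (s / r)) / 2 ^ card S)"
      by (simp add: sum_distrib_left)
    finally show "c / l * (\<Sum>i\<in>S. \<Sum>n\<in>J. (norm (z i n))\<^sup>2) powr (s / 2) \<le>
      (\<Sum>A\<in>Pow S. (\<Sum>n\<in>J. norm (signed_sum S A (\<lambda>i. z i n)) powr r) powr (s / r)) / 2 ^ card S"
      using kl by (simp add: field_simps)
    have "(\<Sum>A\<in>Pow S. (\<Sum>n\<in>J. norm (signed_sum S A (\<lambda>i. z i n)) powr r) powr (s / r)) / 2 ^ card S \<le>
        (\<Sum>A\<in>Pow S. k * (\<Sum>n\<in>J. (norm (signed_sum S A (\<lambda>i. z i n)))\<^sup>2) powr (s / 2)) / 2 ^ card S"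
      by (intro divide_right_mono sum_mono up) auto
    also have "\<dots> = k * ((\<Sum>A\<in>Pow S. (\<Sum>n\<in>J. (norm (signed_sum S A (\<lambda>i. z i n)))\<^sup>2) powr (s / 2)) / 2 ^ card S)"
      by (simp add: sum_distrib_left)
    also have "\<dots> \<le> k * (C * (\<Sum>i\<in>S. \<Sum>n\<in>J. (norm (z i n))\<^sup>2) powr (s / 2))"
      unfolding V X using kl by (intro mult_left_mono cC(4)[OF S]) auto
    finally show "(\<Sum>A\<in>Pow S. (\<Sum>n\<in>J. norm (signed_sum S A (\<lambda>i. z i n)) powr r) powr (s / r)) / 2 ^ card S \<le>
      k * C * (\<Sum>i\<in>S. \<Sum>n\<in>J. (norm (z i n))\<^sup>2) powr (s / 2)" by simp
  qed
qed

section \<open>Independent symmetric variables on the unit interval\<close>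

abbreviation unit_measure :: "real measure" where
  "unit_measure \<equiv> lebesgue_on {0..1}"

lemma prob_space_unit_measure: "prob_space unit_measure"
  by (rule prob_spaceI) (simp add: emeasure_restrict_space)

interpretation unit: prob_space unit_measure
  by (rule prob_space_unit_measure)

lemma borel_measurable_unit [measurable (raw)]:
  "f \<in> borel_measurable borel \<Longrightarrow> f \<in> borel_measurable unit_measure"
  by (intro measurable_restrict_space1 measurable_completion) simp

lemma measurable_unit_count_space:
  "f \<in> borel \<rightarrow>\<^sub>M count_space UNIV \<Longrightarrow> f \<in> unit_measure \<rightarrow>\<^sub>M count_space UNIV"
  by (intro measurable_restrict_space1 measurable_completion) simp

lemma nn_integral_unit:
  fixes f :: "real \<Rightarrow> ennreal"
  shows "(\<integral>\<^sup>+x. f x \<partial>unit_measure) = (\<integral>\<^sup>+x. f x * indicator {0..<1} x \<partial>lborel)"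
proof -
  have "(\<integral>\<^sup>+x. f x \<partial>unit_measure) = (\<integral>\<^sup>+x. f x * indicator {0..1} x \<partial>lborel)"
    by (subst nn_integral_restrict_space) (simp_all add: nn_integral_completion)
  also have "\<dots> = (\<integral>\<^sup>+x. f x * indicator {0..<1} x \<partial>lborel)"
    by (intro nn_integral_cong_AE eventually_mono[OF AE_lborel_singleton[of 1]])
      (auto simp: indicator_def)
  finally show ?thesis .
qed

lemma AE_unit_less_one: "AE x in unit_measure. 0 \<le> x \<and> x < 1"
proof -
  have "AE x in lebesgue. x \<noteq> (1::real)"
    using AE_completion[OF AE_lborel_singleton[of "1::real"]] by simp
  then have "AE x in lebesgue. x \<in> {0..1} \<longrightarrow> 0 \<le> x \<and> x < (1::real)"
    by eventually_elim auto
  then show ?thesis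
    by (subst AE_restrict_space_iff) auto
qed

text \<open>
  The two halves of the interval are rescaled to its full length; they are the two values of the first
  binary digit.
\<close>

lemma nn_integral_unit_double:
  fixes f :: "real \<Rightarrow> ennreal"
  assumes [measurable]: "f \<in> borel_measurable borel"
  shows "(\<integral>\<^sup>+x. f x \<partial>unit_measure) =
    ennreal (1/2) * (\<integral>\<^sup>+x. f (x / 2) \<partial>unit_measure) + ennreal (1/2) * (\<integral>\<^sup>+x. f ((x + 1) / 2) \<partial>unit_measure)"
proof -
  have "(\<integral>\<^sup>+x. f x \<partial>unit_measure) = (\<integral>\<^sup>+x. f x * indicator {0..<1/2} x + f x * indicator {1/2..<1} x \<partial>lborel)"
    unfolding nn_integral_unit by (intro nn_integral_cong) (auto simp: indicator_def)
  also have "\<dots> = (\<integral>\<^sup>+x. f x * indicator {0..<1/2} x \<partial>lborel) + (\<integral>\<^sup>+x. f x * indicator {1/2..<1} x \<partial>lborel)"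
    by (intro nn_integral_add) auto
  also have "(\<integral>\<^sup>+x. f x * indicator {0..<1/2} x \<partial>lborel) =
      ennreal \<bar>1/2\<bar> * (\<integral>\<^sup>+x. f (0 + 1/2 * x) * indicator {0..<1/2} (0 + 1/2 * x) \<partial>lborel)"
    by (rule nn_integral_real_affine) auto
  also have "\<dots> = ennreal (1/2) * (\<integral>\<^sup>+x. f (x / 2) \<partial>unit_measure)"
    unfolding nn_integral_unit by (simp, intro arg_cong2[where f = "(*)"] refl nn_integral_cong) (auto simp: indicator_def)
  also have "(\<integral>\<^sup>+x. f x * indicator {1/2..<1} x \<partial>lborel) =
      ennreal \<bar>1/2\<bar> * (\<integral>\<^sup>+x. f (1/2 + 1/2 * x) * indicator {1/2..<1} (1/2 + 1/2 * x) \<partial>lborel)"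
    by (rule nn_integral_real_affine) auto
  also have "\<dots> = ennreal (1/2) * (\<integral>\<^sup>+x. f ((x + 1) / 2) \<partial>unit_measure)"
    unfolding nn_integral_unit
    by (simp, intro arg_cong2[where f = "(*)"] refl nn_integral_cong) (auto simp: indicator_def add_divide_distrib add.commute)
  finally show ?thesis .
qed

definition binary_digit :: "nat \<Rightarrow> real \<Rightarrow> bool" where
  "binary_digit n x = odd \<lfloor>2 ^ Suc n * x\<rfloor>"

lemma measurable_binary_digit [measurable]: "binary_digit n \<in> borel \<rightarrow>\<^sub>M count_space UNIV"
  unfolding binary_digit_def by measurable

lemma binary_digit_half:
  assumes "0 \<le> x" "x < 1"
  shows "binary_digit 0 (x / 2) = False" "binary_digit (Suc n) (x / 2) = binary_digit n x"
proof -
  have "\<lfloor>x\<rfloor> = 0" using assms by (simp add: floor_eq_iff)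
  then show "binary_digit 0 (x / 2) = False" by (simp add: binary_digit_def)
  have "2 ^ Suc (Suc n) * (x / 2) = 2 ^ Suc n * x" by simp
  then show "binary_digit (Suc n) (x / 2) = binary_digit n x" unfolding binary_digit_def by (simp only:)
qed

lemma binary_digit_half_plus:
  assumes "0 \<le> x" "x < 1"
  shows "binary_digit 0 ((x + 1) / 2) = True" "binary_digit (Suc n) ((x + 1) / 2) = binary_digit n x"
proof -
  have "\<lfloor>x + 1\<rfloor> = 1" using assms by (simp add: floor_eq_iff)
  moreover have "2 ^ Suc 0 * ((x + 1) / 2) = x + 1" by simp
  ultimately show "binary_digit 0 ((x + 1) / 2) = True" unfolding binary_digit_def by (simp only:) simp
  have "2 ^ Suc (Suc n) * ((x + 1) / 2) = 2 ^ Suc n * x + real_of_int (2 ^ Suc n)"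
    by (simp add: algebra_simps)
  then have "\<lfloor>2 ^ Suc (Suc n) * ((x + 1) / 2)\<rfloor> = \<lfloor>2 ^ Suc n * x\<rfloor> + 2 ^ Suc n"
    by (simp only: floor_add_int[symmetric])
  then show "binary_digit (Suc n) ((x + 1) / 2) = binary_digit n x"
    unfolding binary_digit_def by (simp only: even_add) simp
qed

text \<open>
  Given the first digit of a uniformly distributed point, the remaining digits are those of another
  uniformly distributed point; hence induction on the number of digits.
\<close>

lemma nn_integral_prod_binary_digits_lessThan:
  fixes g :: "nat \<Rightarrow> bool \<Rightarrow> ennreal"
  shows "(\<integral>\<^sup>+x. (\<Prod>j<n. g j (binary_digit j x)) \<partial>unit_measure) =
    (\<Prod>j<n. ennreal (1/2) * g j False + ennreal (1/2) * g j True)"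
proof (induction n arbitrary: g)
  case 0
  then show ?case using unit.emeasure_space_1 by simp
next
  case (Suc n)
  define P where "P x = (\<Prod>j<n. g (Suc j) (binary_digit j x))" for x
  have [measurable]: "(\<lambda>x. g j (binary_digit j x)) \<in> borel_measurable borel" for j
    by (rule measurable_compose[OF measurable_binary_digit]) simp
  have [measurable]: "(\<lambda>x. g (Suc j) (binary_digit j x)) \<in> borel_measurable borel" for j
    by (rule measurable_compose[OF measurable_binary_digit]) simp
  have [measurable]: "P \<in> borel_measurable borel" unfolding P_def by measurable
  have lo: "(\<integral>\<^sup>+x. (\<Prod>j<Suc n. g j (binary_digit j (x / 2))) \<partial>unit_measure) =
      (\<integral>\<^sup>+x. g 0 False * P x \<partial>unit_measure)"
    by (rule nn_integral_cong_AE, rule eventually_mono[OF AE_unit_less_one])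
      (simp add: prod.lessThan_Suc_shift binary_digit_half P_def del: prod.lessThan_Suc)
  have hi: "(\<integral>\<^sup>+x. (\<Prod>j<Suc n. g j (binary_digit j ((x + 1) / 2))) \<partial>unit_measure) =
      (\<integral>\<^sup>+x. g 0 True * P x \<partial>unit_measure)"
    by (rule nn_integral_cong_AE, rule eventually_mono[OF AE_unit_less_one])
      (simp add: prod.lessThan_Suc_shift binary_digit_half_plus P_def del: prod.lessThan_Suc)
  have P: "(\<integral>\<^sup>+x. P x \<partial>unit_measure) = (\<Prod>j<n. ennreal (1/2) * g (Suc j) False + ennreal (1/2) * g (Suc j) True)"
    unfolding P_def by (rule Suc.IH)
  have "(\<integral>\<^sup>+x. (\<Prod>j<Suc n. g j (binary_digit j x)) \<partial>unit_measure) =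
      ennreal (1/2) * (\<integral>\<^sup>+x. g 0 False * P x \<partial>unit_measure) + ennreal (1/2) * (\<integral>\<^sup>+x. g 0 True * P x \<partial>unit_measure)"
    by (subst nn_integral_unit_double) (simp_all only: lo hi, measurable)
  also have "\<dots> = (ennreal (1/2) * g 0 False + ennreal (1/2) * g 0 True) * (\<integral>\<^sup>+x. P x \<partial>unit_measure)"
    by (simp add: nn_integral_cmult distrib_right mult.assoc)
  finally show ?case unfolding P by (simp add: prod.lessThan_Suc_shift del: prod.lessThan_Suc)
qed

lemma nn_integral_prod_binary_digits:
  fixes g :: "nat \<Rightarrow> bool \<Rightarrow> ennreal"
  assumes "inj e" "finite J"
  shows "(\<integral>\<^sup>+x. (\<Prod>j\<in>J. g j (binary_digit (e j) x)) \<partial>unit_measure) =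
    (\<Prod>j\<in>J. ennreal (1/2) * g j False + ennreal (1/2) * g j True)"
proof -
  obtain n where n: "e ` J \<subseteq> {..<n}"
    using finite_imageI[OF assms(2)] finite_nat_bounded by blast
  define g' where "g' i b = (if i \<in> e ` J then g (the_inv e i) b else 1)" for i b
  have half: "ennreal (1/2) + ennreal (1/2) = 1" by (subst ennreal_plus[symmetric]) simp_all
  have inv: "the_inv e (e j) = j" for j using assms(1) by (rule the_inv_f_f)
  have inj: "inj_on e J" using assms by (auto simp: inj_on_def)
  have a: "(\<Prod>i<n. g' i (binary_digit i x)) = (\<Prod>j\<in>J. g j (binary_digit (e j) x))" for x
  proof -
    have "(\<Prod>i<n. g' i (binary_digit i x)) = (\<Prod>i\<in>e ` J. g' i (binary_digit i x))"
      using n by (intro prod.mono_neutral_right) (auto simp: g'_def)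
    also have "\<dots> = (\<Prod>j\<in>J. g j (binary_digit (e j) x))"
      using inj by (simp add: prod.reindex g'_def inv)
    finally show ?thesis .
  qed
  have "(\<Prod>i<n. ennreal (1/2) * g' i False + ennreal (1/2) * g' i True) =
      (\<Prod>i\<in>e ` J. ennreal (1/2) * g' i False + ennreal (1/2) * g' i True)"
    using n half by (intro prod.mono_neutral_right) (auto simp: g'_def)
  also have "\<dots> = (\<Prod>j\<in>J. ennreal (1/2) * g j False + ennreal (1/2) * g j True)"
    using inj by (simp add: prod.reindex g'_def inv)
  finally show ?thesis
    using nn_integral_prod_binary_digits_lessThan[where g = g' and n = n] by (simp add: a)
qed

text \<open>
  The injection \<open>e\<close> may select one row of the digits arranged in a double array; such a row serves below
  as the sequence of digits of a new variable.
\<close>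

lemma indep_binary_digits:
  fixes e :: "nat \<Rightarrow> nat"
  assumes "inj e"
  shows "unit.indep_vars (\<lambda>_. count_space UNIV) (\<lambda>j. binary_digit (e j)) UNIV"
  unfolding unit.indep_vars_def2 unit.indep_sets_def
proof (intro conjI ballI allI impI subsetI)
  fix j
  show m: "unit.random_variable (count_space UNIV) (binary_digit (e j))"
    by (rule measurable_unit_count_space) measurable
  fix A assume "A \<in> {binary_digit (e j) -` A \<inter> space unit_measure |A. A \<in> sets (count_space UNIV)}"
  then show "A \<in> unit.events" using measurable_sets[OF m] by auto
next
  fix J A
  assume J: "J \<noteq> {}" "finite J"
    and A: "A \<in> Pi J (\<lambda>j. {binary_digit (e j) -` A \<inter> space unit_measure |A. A \<in> sets (count_space UNIV)})"
  have "\<exists>E. A j = binary_digit (e j) -` E \<inter> space unit_measure" if "j \<in> J" for j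
    using Pi_mem[OF A that] by blast
  then obtain E where E: "\<And>j. j \<in> J \<Longrightarrow> A j = binary_digit (e j) -` E j \<inter> space unit_measure"
    by metis
  have m: "binary_digit (e j) \<in> unit_measure \<rightarrow>\<^sub>M count_space UNIV" for j
    by (rule measurable_unit_count_space) measurable
  have ev: "A j \<in> unit.events" if "j \<in> J" for j
    using measurable_sets[OF m] that by (auto simp: E)
  let ?w = "\<lambda>j. ennreal (1/2) * indicator (E j) False + ennreal (1/2) * indicator (E j) True"
  have em: "emeasure unit_measure (\<Inter>j\<in>K. A j) = (\<Prod>j\<in>K. ?w j)" if K: "K \<subseteq> J" "K \<noteq> {}" for K
  proof -
    have fin: "finite K" using K J finite_subset by blast
    have meas: "(\<Inter>j\<in>K. A j) \<in> unit.events" using ev K fin by (intro sets.finite_INT) auto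
    have "emeasure unit_measure (\<Inter>j\<in>K. A j) = (\<integral>\<^sup>+x. indicator (\<Inter>j\<in>K. A j) x \<partial>unit_measure)"
      using meas by simp
    also have "\<dots> = (\<integral>\<^sup>+x. (\<Prod>j\<in>K. indicator (E j) (binary_digit (e j) x)) \<partial>unit_measure)"
    proof (rule nn_integral_cong)
      fix x assume x: "x \<in> space unit_measure"
      show "indicator (\<Inter>j\<in>K. A j) x = (\<Prod>j\<in>K. indicator (E j) (binary_digit (e j) x) :: ennreal)"
      proof (cases "x \<in> (\<Inter>j\<in>K. A j)")
        case True
        then have "\<forall>j\<in>K. binary_digit (e j) x \<in> E j" using E K by auto
        then show ?thesis using True by simp
      next
        case False
        then obtain j where j: "j \<in> K" "x \<notin> A j" by auto
        then have "binary_digit (e j) x \<notin> E j" using E[of j] K x by blast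
        with j(1) have "\<exists>j\<in>K. binary_digit (e j) x \<notin> E j" by blast
        then show ?thesis using False fin by (auto simp: prod_zero_iff indicator_def)
      qed
    qed
    also have "\<dots> = (\<Prod>j\<in>K. ?w j)"
      by (rule nn_integral_prod_binary_digits[OF assms fin])
    finally show ?thesis .
  qed
  have "emeasure unit_measure (\<Inter>j\<in>J. A j) = (\<Prod>j\<in>J. emeasure unit_measure (A j))"
    unfolding em[OF order.refl J(1)] using em[of "{_}"] by (intro prod.cong) auto
  also have "\<dots> = ennreal (\<Prod>j\<in>J. unit.prob (A j))"
    by (simp add: unit.emeasure_eq_measure prod_ennreal)
  finally show "unit.prob (\<Inter>j\<in>J. A j) = (\<Prod>j\<in>J. unit.prob (A j))"
    by (simp add: unit.emeasure_eq_measure prod_nonneg)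
qed

text \<open>
  The partial sums are the dyadic approximations from below.
\<close>

lemma binary_expansion:
  assumes "0 \<le> x" "x < 1"
  shows "(\<lambda>k. if binary_digit k x then (1/2) ^ Suc k else 0) sums x"
proof -
  have partial: "(\<Sum>k<n. if binary_digit k x then (1/2) ^ Suc k else 0) = \<lfloor>2 ^ n * x\<rfloor> / 2 ^ n" for n
  proof (induction n)
    case 0
    have "\<lfloor>x\<rfloor> = 0" using assms by (simp add: floor_eq_iff)
    then show ?case by simp
  next
    case (Suc n)
    define z where "z = \<lfloor>2 ^ Suc n * x\<rfloor>"
    have "2 ^ n * x = (2 ^ Suc n * x) / real_of_int 2" by simp
    then have div: "\<lfloor>2 ^ n * x\<rfloor> = z div 2"
      unfolding z_def using floor_divide_real_eq_div[of 2 "2 ^ Suc n * x"] by (simp only:)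
    have "z = 2 * (z div 2) + (if odd z then 1 else 0)" by presburger
    then have "real_of_int z = real_of_int (2 * (z div 2) + (if odd z then 1 else 0))"
      by (rule arg_cong)
    also have "\<dots> = 2 * real_of_int (z div 2) + (if odd z then 1 else 0)" by simp
    finally have z: "real_of_int z / 2 ^ Suc n = real_of_int (z div 2) / 2 ^ n + (if odd z then (1/2) ^ Suc n else 0)"
      by (cases "odd z") (simp_all add: add_divide_distrib power_divide)
    have "(\<Sum>k<Suc n. if binary_digit k x then (1/2) ^ Suc k else 0) =
        real_of_int (z div 2) / 2 ^ n + (if odd z then (1/2) ^ Suc n else 0)"
      unfolding sum.lessThan_Suc Suc.IH div unfolding binary_digit_def z_def[symmetric] ..
    then show ?case unfolding z_def[symmetric] z .
  qed
  have "(\<lambda>n. \<lfloor>2 ^ n * x\<rfloor> / 2 ^ n) \<longlonglongrightarrow> x"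
  proof (rule tendsto_sandwich)
    show "\<forall>\<^sub>F n in sequentially. x - (1/2) ^ n \<le> \<lfloor>2 ^ n * x\<rfloor> / 2 ^ n"
    proof (intro always_eventually allI)
      fix n
      have "2 ^ n * x - 1 \<le> \<lfloor>2 ^ n * x\<rfloor>" by linarith
      then have "(2 ^ n * x - 1) / 2 ^ n \<le> \<lfloor>2 ^ n * x\<rfloor> / 2 ^ n" by (rule divide_right_mono) simp
      then show "x - (1/2) ^ n \<le> \<lfloor>2 ^ n * x\<rfloor> / 2 ^ n" by (simp add: diff_divide_distrib power_divide)
    qed
    show "\<forall>\<^sub>F n in sequentially. \<lfloor>2 ^ n * x\<rfloor> / 2 ^ n \<le> x"
    proof (intro always_eventually allI)
      fix n
      have "\<lfloor>2 ^ n * x\<rfloor> / 2 ^ n \<le> (2 ^ n * x) / 2 ^ n" by (intro divide_right_mono) auto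
      then show "\<lfloor>2 ^ n * x\<rfloor> / 2 ^ n \<le> x" by simp
    qed
    have "(\<lambda>n. x - (1/2) ^ n) \<longlonglongrightarrow> x - 0"
      by (intro tendsto_intros LIMSEQ_power_zero) simp
    then show "(\<lambda>n. x - (1/2) ^ n) \<longlonglongrightarrow> x" by simp
  qed simp
  then show ?thesis unfolding sums_def partial .
qed

definition binary_value :: "(nat \<Rightarrow> bool) \<Rightarrow> real" where
  "binary_value \<omega> = (\<Sum>k. if \<omega> k then (1/2) ^ Suc k else 0)"

lemma measurable_binary_value [measurable]:
  "binary_value \<in> borel_measurable (PiM UNIV (\<lambda>_. count_space UNIV))"
  unfolding binary_value_def by measurable

text \<open>
  The pairing function arranges the digits of a point in a double array; each row is read as the
  binary expansion of a new point.
\<close>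

definition uniform_seq :: "nat \<Rightarrow> real \<Rightarrow> real" where
  "uniform_seq i x = binary_value (\<lambda>k. binary_digit (prod_encode (i, k)) x)"

lemma measurable_uniform_seq [measurable]: "uniform_seq i \<in> borel_measurable borel"
proof -
  have "(\<lambda>x k. binary_digit (prod_encode (i, k)) x) \<in> borel \<rightarrow>\<^sub>M PiM UNIV (\<lambda>_. count_space UNIV)"
    by (rule measurable_PiM_single') (auto intro: measurable_binary_digit)
  from measurable_compose[OF this measurable_binary_value] show ?thesis
    by (simp add: uniform_seq_def[abs_def])
qed

text \<open>
  Both sequences consist of independent fair digits, so both laws are the same product measure.
\<close>

lemma distr_binary_digits:
  fixes e :: "nat \<Rightarrow> nat"
  assumes "inj e"
  shows "distr unit_measure (PiM UNIV (\<lambda>_. count_space UNIV)) (\<lambda>x k. binary_digit (e k) x) =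
    distr unit_measure (PiM UNIV (\<lambda>_. count_space UNIV)) (\<lambda>x k. binary_digit k x)"
proof -
  have m: "binary_digit j \<in> unit_measure \<rightarrow>\<^sub>M count_space UNIV" for j
    by (rule measurable_unit_count_space) measurable
  have single: "distr unit_measure (count_space UNIV) (binary_digit j) =
      distr unit_measure (count_space UNIV) (binary_digit i)" for i j
  proof (rule measure_eqI)
    fix A :: "bool set"
    assume "A \<in> sets (distr unit_measure (count_space UNIV) (binary_digit j))"
    have "emeasure (distr unit_measure (count_space UNIV) (binary_digit j)) A =
        ennreal (1/2) * indicator A False + ennreal (1/2) * indicator A True" for j
    proof -
      have "emeasure (distr unit_measure (count_space UNIV) (binary_digit j)) A =
          (\<integral>\<^sup>+x. indicator A x \<partial>distr unit_measure (count_space UNIV) (binary_digit j))"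
        by simp
      also have "\<dots> = (\<integral>\<^sup>+x. indicator A (binary_digit j x) \<partial>unit_measure)"
        by (rule nn_integral_distr[OF m]) simp
      also have "\<dots> = ennreal (1/2) * indicator A False + ennreal (1/2) * indicator A True"
        using nn_integral_prod_binary_digits[of id "{j}" "\<lambda>_. indicator A"] by simp
      finally show ?thesis .
    qed
    then show "emeasure (distr unit_measure (count_space UNIV) (binary_digit j)) A =
        emeasure (distr unit_measure (count_space UNIV) (binary_digit i)) A" by simp
  qed simp
  have joint: "distr unit_measure (PiM UNIV (\<lambda>_. count_space UNIV)) (\<lambda>x k. binary_digit (e k) x) =
      PiM UNIV (\<lambda>_. distr unit_measure (count_space UNIV) (binary_digit 0))" if "inj e" for e :: "nat \<Rightarrow> nat"
  proof -
    have "distr unit_measure (PiM UNIV (\<lambda>_. count_space UNIV)) (\<lambda>x. \<lambda>k\<in>UNIV. binary_digit (e k) x) =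
      PiM UNIV (\<lambda>k. distr unit_measure (count_space UNIV) (binary_digit (e k)))"
      using indep_binary_digits[OF that] m
      by (subst unit.indep_vars_iff_distr_eq_PiM[symmetric]) auto
    also have "\<dots> = PiM UNIV (\<lambda>_. distr unit_measure (count_space UNIV) (binary_digit 0))"
      using single by (intro PiM_cong) auto
    finally show ?thesis unfolding restrict_UNIV .
  qed
  show ?thesis using joint[OF assms] joint[of id] by simp
qed

lemma nn_integral_uniform_seq:
  fixes f :: "real \<Rightarrow> ennreal"
  assumes [measurable]: "f \<in> borel_measurable borel"
  shows "(\<integral>\<^sup>+x. f (uniform_seq i x) \<partial>unit_measure) = (\<integral>\<^sup>+x. f x \<partial>unit_measure)"
proof -
  let ?P = "PiM UNIV (\<lambda>_. count_space UNIV) :: (nat \<Rightarrow> bool) measure"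
  have m: "(\<lambda>x k. binary_digit (e k) x) \<in> unit_measure \<rightarrow>\<^sub>M ?P" for e :: "nat \<Rightarrow> nat"
    by (rule measurable_PiM_single') (auto intro!: measurable_unit_count_space)
  have fm: "(\<lambda>\<omega>. f (binary_value \<omega>)) \<in> borel_measurable ?P" by measurable
  have "(\<integral>\<^sup>+x. f (uniform_seq i x) \<partial>unit_measure) =
      (\<integral>\<^sup>+\<omega>. f (binary_value \<omega>) \<partial>distr unit_measure ?P (\<lambda>x k. binary_digit (prod_encode (i, k)) x))"
    unfolding uniform_seq_def by (rule nn_integral_distr[symmetric, OF m]) (use fm in simp)
  also have "distr unit_measure ?P (\<lambda>x k. binary_digit (prod_encode (i, k)) x) =
      distr unit_measure ?P (\<lambda>x k. binary_digit k x)"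
    by (rule distr_binary_digits) (auto simp: inj_def)
  also have "(\<integral>\<^sup>+\<omega>. f (binary_value \<omega>) \<partial>distr unit_measure ?P (\<lambda>x k. binary_digit k x)) =
      (\<integral>\<^sup>+x. f (binary_value (\<lambda>k. binary_digit k x)) \<partial>unit_measure)"
    by (rule nn_integral_distr[OF m]) (use fm in simp)
  also have "\<dots> = (\<integral>\<^sup>+x. f x \<partial>unit_measure)"
    by (rule nn_integral_cong_AE, rule eventually_mono[OF AE_unit_less_one])
      (simp add: binary_value_def sums_unique[OF binary_expansion, symmetric])
  finally show ?thesis .
qed

lemma indep_uniform_seq: "unit.indep_vars (\<lambda>_. borel) uniform_seq UNIV"
proof -
  define K where "K i = range (\<lambda>k. prod_encode (i, k))" for i
  have "unit.indep_vars (\<lambda>i. PiM (K i) (\<lambda>_. count_space UNIV))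
      (\<lambda>i \<omega>. restrict (\<lambda>j. binary_digit j \<omega>) (K i)) UNIV"
  proof (rule unit.indep_vars_restrict)
    show "unit.indep_vars (\<lambda>_. count_space UNIV) (\<lambda>j. binary_digit j) UNIV"
      using indep_binary_digits[of id] by simp
    show "disjoint_family_on K UNIV" by (auto simp: disjoint_family_on_def K_def)
  qed auto
  then have "unit.indep_vars (\<lambda>_. borel)
      (\<lambda>i \<omega>. binary_value (\<lambda>k. (restrict (\<lambda>j. binary_digit j \<omega>) (K i)) (prod_encode (i, k)))) UNIV"
  proof (rule unit.indep_vars_compose2)
    fix i
    have "(\<lambda>\<omega> k. \<omega> (prod_encode (i, k))) \<in> PiM (K i) (\<lambda>_. count_space UNIV) \<rightarrow>\<^sub>M
        PiM UNIV (\<lambda>_. count_space UNIV :: bool measure)"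
      by (rule measurable_PiM_single') (auto intro!: measurable_component_singleton simp: K_def)
    from measurable_compose[OF this measurable_binary_value]
    show "(\<lambda>\<omega>. binary_value (\<lambda>k. \<omega> (prod_encode (i, k)))) \<in>
        borel_measurable (PiM (K i) (\<lambda>_. count_space UNIV))" .
  qed
  moreover have "binary_value (\<lambda>k. (restrict (\<lambda>j. binary_digit j \<omega>) (K i)) (prod_encode (i, k))) =
      uniform_seq i \<omega>" for i \<omega>
    by (simp add: uniform_seq_def K_def)
  ultimately show ?thesis by simp
qed

text \<open>
  The first digit of a uniform variable decides the sign, and its remaining digits form an independent
  uniform variable to which \<open>w\<close> is applied. For nonnegative \<open>w\<close> this is the absolute value.
\<close>

definition symmetric_seq :: "(real \<Rightarrow> real) \<Rightarrow> nat \<Rightarrow> real \<Rightarrow> real" where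
  "symmetric_seq w i x = (let u = uniform_seq i x in if u < 1/2 then w (2 * u) else - w (2 * u - 1))"

lemma measurable_symmetric_seq [measurable]:
  assumes [measurable]: "w \<in> borel_measurable borel"
  shows "symmetric_seq w i \<in> borel_measurable borel"
  unfolding symmetric_seq_def Let_def by measurable

lemma nn_integral_symmetric_seq:
  fixes f :: "real \<Rightarrow> ennreal"
  assumes [measurable]: "w \<in> borel_measurable borel" "f \<in> borel_measurable borel"
  shows "(\<integral>\<^sup>+x. f (symmetric_seq w i x) \<partial>unit_measure) =
    ennreal (1/2) * (\<integral>\<^sup>+x. f (w x) \<partial>unit_measure) + ennreal (1/2) * (\<integral>\<^sup>+x. f (- w x) \<partial>unit_measure)"
proof -
  define h where "h u = (if u < 1/2 then w (2 * u) else - w (2 * u - 1))" for u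
  have [measurable]: "h \<in> borel_measurable borel" unfolding h_def by measurable
  have "(\<integral>\<^sup>+x. f (symmetric_seq w i x) \<partial>unit_measure) = (\<integral>\<^sup>+x. f (h (uniform_seq i x)) \<partial>unit_measure)"
    by (simp add: symmetric_seq_def h_def Let_def)
  also have "\<dots> = (\<integral>\<^sup>+x. f (h x) \<partial>unit_measure)"
    by (rule nn_integral_uniform_seq) measurable
  also have "\<dots> = ennreal (1/2) * (\<integral>\<^sup>+x. f (h (x / 2)) \<partial>unit_measure) +
      ennreal (1/2) * (\<integral>\<^sup>+x. f (h ((x + 1) / 2)) \<partial>unit_measure)"
    by (rule nn_integral_unit_double) measurable
  also have "(\<integral>\<^sup>+x. f (h (x / 2)) \<partial>unit_measure) = (\<integral>\<^sup>+x. f (w x) \<partial>unit_measure)"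
    by (rule nn_integral_cong_AE, rule eventually_mono[OF AE_unit_less_one]) (simp add: h_def)
  also have "(\<integral>\<^sup>+x. f (h ((x + 1) / 2)) \<partial>unit_measure) = (\<integral>\<^sup>+x. f (- w x) \<partial>unit_measure)"
  proof (rule nn_integral_cong_AE, rule eventually_mono[OF AE_unit_less_one])
    fix x :: real assume x: "0 \<le> x \<and> x < 1"
    have "2 * ((x + 1) / 2) - 1 = x" "\<not> (x + 1) / 2 < 1/2" using x by (auto simp: field_simps)
    then show "f (h ((x + 1) / 2)) = f (- w x)" unfolding h_def by (simp only: if_False)
  qed
  finally show ?thesis .
qed

lemma indep_symmetric_seq:
  assumes [measurable]: "w \<in> borel_measurable borel"
  shows "unit.indep_vars (\<lambda>_. borel) (symmetric_seq w) UNIV"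
proof -
  define h where "h u = (if u < 1/2 then w (2 * u) else - w (2 * u - 1))" for u
  have [measurable]: "h \<in> borel_measurable borel" unfolding h_def by measurable
  have "unit.indep_vars (\<lambda>_. borel) (\<lambda>i x. h (uniform_seq i x)) UNIV"
    by (rule unit.indep_vars_compose2[OF indep_uniform_seq]) measurable
  then show ?thesis by (simp add: symmetric_seq_def[abs_def] h_def[abs_def] Let_def)
qed

text \<open>
  Changing signs preserves the independence and the law of each variable, and these determine the
  joint law.
\<close>

lemma symmetric_seq_sign_invariant:
  fixes f :: "(nat \<Rightarrow> real) \<Rightarrow> ennreal"
  assumes w [measurable]: "w \<in> borel_measurable borel"
    and f: "f \<in> borel_measurable (PiM UNIV (\<lambda>_. borel))"
  shows "(\<integral>\<^sup>+x. f (\<lambda>i. if i \<in> A then symmetric_seq w i x else - symmetric_seq w i x) \<partial>unit_measure) =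
    (\<integral>\<^sup>+x. f (\<lambda>i. symmetric_seq w i x) \<partial>unit_measure)"
proof -
  let ?P = "PiM UNIV (\<lambda>_. borel) :: (nat \<Rightarrow> real) measure"
  define \<theta> where "\<theta> A i y = (if i \<in> A then y else - y)" for A :: "nat set" and i and y :: real
  have [measurable]: "\<theta> A i \<in> borel_measurable borel" for A i unfolding \<theta>_def by measurable
  define Z where "Z A i x = \<theta> A i (symmetric_seq w i x)" for A i x
  have [measurable]: "Z A i \<in> borel_measurable borel" for A i unfolding Z_def by measurable
  have single: "distr unit_measure borel (Z A i) = distr unit_measure borel (Z UNIV i)" for A i
  proof (rule measure_eqI)
    fix B assume "B \<in> sets (distr unit_measure borel (Z A i))"
    then have [measurable]: "B \<in> sets borel" by simp
    have "emeasure (distr unit_measure borel (Z A i)) B =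
        ennreal (1/2) * (\<integral>\<^sup>+x. indicator B (w x) \<partial>unit_measure) +
        ennreal (1/2) * (\<integral>\<^sup>+x. indicator B (- w x) \<partial>unit_measure)" for A
    proof -
      have "emeasure (distr unit_measure borel (Z A i)) B = (\<integral>\<^sup>+x. indicator B x \<partial>distr unit_measure borel (Z A i))"
        by simp
      also have "\<dots> = (\<integral>\<^sup>+x. indicator B (\<theta> A i (symmetric_seq w i x)) \<partial>unit_measure)"
        unfolding Z_def by (subst nn_integral_distr) auto
      also have "\<dots> = ennreal (1/2) * (\<integral>\<^sup>+x. indicator B (\<theta> A i (w x)) \<partial>unit_measure) +
          ennreal (1/2) * (\<integral>\<^sup>+x. indicator B (\<theta> A i (- w x)) \<partial>unit_measure)"
        by (rule nn_integral_symmetric_seq) measurable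
      finally show ?thesis by (cases "i \<in> A") (simp_all add: \<theta>_def add.commute)
    qed
    then show "emeasure (distr unit_measure borel (Z A i)) B = emeasure (distr unit_measure borel (Z UNIV i)) B"
      by simp
  qed simp
  have joint: "distr unit_measure ?P (\<lambda>x i. Z A i x) = PiM UNIV (\<lambda>i. distr unit_measure borel (Z UNIV i))" for A
  proof -
    have "unit.indep_vars (\<lambda>_. borel) (Z A) UNIV"
      unfolding Z_def by (rule unit.indep_vars_compose2[OF indep_symmetric_seq[OF w]]) measurable
    then have "distr unit_measure ?P (\<lambda>x. \<lambda>i\<in>UNIV. Z A i x) = PiM UNIV (\<lambda>i. distr unit_measure borel (Z A i))"
      by (subst (asm) unit.indep_vars_iff_distr_eq_PiM) auto
    also have "\<dots> = PiM UNIV (\<lambda>i. distr unit_measure borel (Z UNIV i))"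
      using single by (intro PiM_cong) auto
    finally show ?thesis unfolding restrict_UNIV .
  qed
  have int: "(\<integral>\<^sup>+x. f (\<lambda>i. Z A i x) \<partial>unit_measure) = (\<integral>\<^sup>+\<omega>. f \<omega> \<partial>distr unit_measure ?P (\<lambda>x i. Z A i x))" for A
  proof (rule nn_integral_distr[symmetric])
    show "(\<lambda>x i. Z A i x) \<in> unit_measure \<rightarrow>\<^sub>M ?P"
      by (rule measurable_PiM_single') auto
  qed (use f in simp)
  show ?thesis using int[of A] int[of UNIV] by (simp add: joint) (simp add: Z_def \<theta>_def)
qed

section \<open>Quasi-normed spaces and isomorphic embeddings\<close>

lemma add_powr_le_double:
  fixes u v q :: real
  assumes "0 \<le> u" "0 \<le> v" "0 < q"
  shows "(u + v) powr q \<le> 2 powr q * (u powr q + v powr q)"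
proof -
  have "(u + v) powr q \<le> (2 * max u v) powr q" using assms by (intro powr_mono2) auto
  also have "\<dots> = 2 powr q * max u v powr q" using assms by (simp add: powr_mult)
  also have "max u v powr q \<le> u powr q + v powr q" by (simp add: max_def)
  finally show ?thesis by simp
qed

locale quasi_normed =
  fixes X :: "('k::real_normed_field, 'a::ab_group_add) qn_space" and K :: real
  assumes K_pos: "0 < K"
    and zero_closed [simp]: "0 \<in> carrier X"
    and add_closed [simp]: "x \<in> carrier X \<Longrightarrow> y \<in> carrier X \<Longrightarrow> x + y \<in> carrier X"
    and scale_closed [simp]: "x \<in> carrier X \<Longrightarrow> scale X c x \<in> carrier X"
    and scale_add: "x \<in> carrier X \<Longrightarrow> y \<in> carrier X \<Longrightarrow> scale X c (x + y) = scale X c x + scale X c y"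
    and add_scale: "x \<in> carrier X \<Longrightarrow> scale X (c + d) x = scale X c x + scale X d x"
    and scale_scale: "x \<in> carrier X \<Longrightarrow> scale X c (scale X d x) = scale X (c * d) x"
    and scale_one: "x \<in> carrier X \<Longrightarrow> scale X 1 x = x"
    and qnorm_nonneg [simp]: "x \<in> carrier X \<Longrightarrow> 0 \<le> qnorm X x"
    and qnorm_scale: "x \<in> carrier X \<Longrightarrow> qnorm X (scale X c x) = norm c * qnorm X x"
    and qnorm_add: "x \<in> carrier X \<Longrightarrow> y \<in> carrier X \<Longrightarrow> qnorm X (x + y) \<le> K * (qnorm X x + qnorm X y)"
    and qnorm_eq_0: "x \<in> carrier X \<Longrightarrow> qnorm X x = 0 \<Longrightarrow> x = 0"
begin

lemma scale_zero_left: "x \<in> carrier X \<Longrightarrow> scale X 0 x = 0"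
  using add_scale[of x 0 0] by simp

lemma scale_zero_right: "scale X c 0 = 0"
  using scale_add[of 0 0 c] by simp

lemma scale_minus_one: "x \<in> carrier X \<Longrightarrow> scale X (- 1) x = - x"
  using add_scale[of x "- 1" 1] by (simp add: scale_zero_left scale_one eq_neg_iff_add_eq_0)

lemma uminus_closed [simp]: "x \<in> carrier X \<Longrightarrow> - x \<in> carrier X"
  by (metis scale_closed scale_minus_one)

lemma minus_closed [simp]: "x \<in> carrier X \<Longrightarrow> y \<in> carrier X \<Longrightarrow> x - y \<in> carrier X"
  using add_closed[of x "- y"] by simp

lemma sum_closed [simp]: "(\<And>i. i \<in> I \<Longrightarrow> f i \<in> carrier X) \<Longrightarrow> (\<Sum>i\<in>I. f i) \<in> carrier X"
  by (induction I rule: infinite_finite_induct) auto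

lemma qnorm_uminus: "x \<in> carrier X \<Longrightarrow> qnorm X (- x) = qnorm X x"
  using qnorm_scale[of x "- 1"] by (simp add: scale_minus_one)

lemma qnorm_minus_commute: "x \<in> carrier X \<Longrightarrow> y \<in> carrier X \<Longrightarrow> qnorm X (x - y) = qnorm X (y - x)"
  using qnorm_uminus[of "x - y"] by simp

lemma qnorm_zero [simp]: "qnorm X 0 = 0"
  using qnorm_scale[of 0 0] by (simp add: scale_zero_left)

lemma qnorm_triangle:
  "x \<in> carrier X \<Longrightarrow> y \<in> carrier X \<Longrightarrow> z \<in> carrier X \<Longrightarrow>
    qnorm X (x - z) \<le> K * (qnorm X (x - y) + qnorm X (y - z))"
  using qnorm_add[of "x - y" "y - z"] by simp

lemma scale_sum:
  "(\<And>i. i \<in> I \<Longrightarrow> f i \<in> carrier X) \<Longrightarrow> scale X c (\<Sum>i\<in>I. f i) = (\<Sum>i\<in>I. scale X c (f i))"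
  by (induction I rule: infinite_finite_induct) (auto simp: scale_zero_right scale_add)

text \<open>
  Balls of a quasi-norm need not be open, but the interior in the sense of the neighbourhood base is: if
  the ball of radius \<open>d\<close> around \<open>y\<close> lies in \<open>A\<close>, then each point of the ball of radius \<open>d/(2K)\<close> is an interior
  point as well.
\<close>

lemma openin_interior:
  assumes P: "A \<subseteq> carrier X"
  defines "U \<equiv> {y \<in> carrier X. \<exists>d>0. \<forall>z\<in>carrier X. qnorm X (z - y) < d \<longrightarrow> z \<in> A}"
  shows "openin (qn_topology X) U"
  unfolding openin_qn_topology
proof (intro conjI ballI)
  show "U \<subseteq> carrier X" by (auto simp: U_def)
  fix y assume "y \<in> U"
  then obtain d where y: "y \<in> carrier X" and d: "d > 0" "\<forall>z\<in>carrier X. qnorm X (z - y) < d \<longrightarrow> z \<in> A"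
    by (auto simp: U_def)
  define e where "e = d / (2 * K)"
  have e: "e > 0" using d K_pos by (simp add: e_def)
  have "z \<in> U" if z: "z \<in> carrier X" "qnorm X (z - y) < e" for z
  proof -
    have "w \<in> A" if w: "w \<in> carrier X" "qnorm X (w - z) < e" for w
    proof -
      have "qnorm X (w - y) \<le> K * (qnorm X (w - z) + qnorm X (z - y))"
        using w z y by (intro qnorm_triangle)
      also have "\<dots> < K * (e + e)" using w z K_pos by (intro mult_strict_left_mono) auto
      also have "\<dots> = d" using K_pos by (simp add: e_def)
      finally show ?thesis using d w by blast
    qed
    then show ?thesis using z e by (auto simp: U_def)
  qed
  then show "\<exists>e>0. \<forall>z\<in>carrier X. qnorm X (z - y) < e \<longrightarrow> z \<in> U" using e by blast
qed

lemma zero_neighbourhood: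
  assumes "0 < d"
  obtains U where "openin (qn_topology X) U" "0 \<in> U" "\<And>x. x \<in> U \<Longrightarrow> x \<in> carrier X \<and> qnorm X x < d"
proof -
  define A where "A = {x \<in> carrier X. qnorm X x < d}"
  show ?thesis
    by (rule that[OF openin_interior[of A]]) (use assms in \<open>auto simp: A_def\<close>)
qed

definition convergent_to :: "(nat \<Rightarrow> 'a) \<Rightarrow> 'a \<Rightarrow> bool" where
  "convergent_to f l \<longleftrightarrow> l \<in> carrier X \<and> (\<lambda>n. qnorm X (f n - l)) \<longlonglongrightarrow> 0"

definition Cauchy_seq :: "(nat \<Rightarrow> 'a) \<Rightarrow> bool" where
  "Cauchy_seq f \<longleftrightarrow> (\<forall>n. f n \<in> carrier X) \<and> (\<forall>e>0. \<exists>N. \<forall>m\<ge>N. \<forall>n\<ge>N. qnorm X (f m - f n) < e)"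

lemma convergent_to_unique:
  assumes "\<And>n. f n \<in> carrier X" "convergent_to f l" "convergent_to f l'"
  shows "l = l'"
proof -
  have l: "l \<in> carrier X" "l' \<in> carrier X" using assms by (auto simp: convergent_to_def)
  have "(\<lambda>n. K * (qnorm X (f n - l) + qnorm X (f n - l'))) \<longlonglongrightarrow> K * (0 + 0)"
    using assms unfolding convergent_to_def by (intro tendsto_intros) auto
  moreover have "qnorm X (l - l') \<le> K * (qnorm X (f n - l) + qnorm X (f n - l'))" for n
    using qnorm_triangle[of l "f n" l'] l assms(1) by (simp add: qnorm_minus_commute)
  ultimately have "qnorm X (l - l') \<le> K * (0 + 0)"
    by (intro LIMSEQ_le_const) auto
  then have "l - l' = 0" using l by (intro qnorm_eq_0 antisym) auto
  then show ?thesis by simp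
qed

lemma convergent_to_add:
  assumes "\<And>n. f n \<in> carrier X" "\<And>n. g n \<in> carrier X" "convergent_to f l" "convergent_to g m"
  shows "convergent_to (\<lambda>n. f n + g n) (l + m)"
proof -
  have l: "l \<in> carrier X" "m \<in> carrier X" using assms by (auto simp: convergent_to_def)
  have "(\<lambda>n. K * (qnorm X (f n - l) + qnorm X (g n - m))) \<longlonglongrightarrow> K * (0 + 0)"
    using assms unfolding convergent_to_def by (intro tendsto_intros) auto
  then have lim: "(\<lambda>n. K * (qnorm X (f n - l) + qnorm X (g n - m))) \<longlonglongrightarrow> 0" by simp
  have "qnorm X (f n + g n - (l + m)) \<le> K * (qnorm X (f n - l) + qnorm X (g n - m))" for n
    using qnorm_add[of "f n - l" "g n - m"] l assms(1,2) by (simp add: algebra_simps)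
  then have "(\<lambda>n. qnorm X (f n + g n - (l + m))) \<longlonglongrightarrow> 0"
    using l assms(1,2) by (intro tendsto_sandwich[OF _ _ tendsto_const lim]) auto
  then show ?thesis using l by (simp add: convergent_to_def)
qed

lemma scale_diff: "x \<in> carrier X \<Longrightarrow> y \<in> carrier X \<Longrightarrow> scale X c (x - y) = scale X c x - scale X c y"
  using scale_add[of "x - y" y c] by simp

lemma convergent_to_scale:
  assumes "\<And>n. f n \<in> carrier X" "convergent_to f l"
  shows "convergent_to (\<lambda>n. scale X c (f n)) (scale X c l)"
proof -
  have l: "l \<in> carrier X" using assms by (auto simp: convergent_to_def)
  have "(\<lambda>n. norm c * qnorm X (f n - l)) \<longlonglongrightarrow> norm c * 0"
    using assms unfolding convergent_to_def by (intro tendsto_intros) auto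
  then show ?thesis using l assms(1) by (simp add: convergent_to_def scale_diff[symmetric] qnorm_scale)
qed

lemma convergent_to_qnorm_le:
  assumes f: "\<And>n. f n \<in> carrier X" and l: "convergent_to f l"
    and B: "\<And>n. n0 \<le> n \<Longrightarrow> qnorm X (f n) \<le> B"
  shows "qnorm X l \<le> K * B"
proof -
  have lc: "l \<in> carrier X" using l by (auto simp: convergent_to_def)
  have "(\<lambda>n. K * (qnorm X (f n - l) + B)) \<longlonglongrightarrow> K * (0 + B)"
    using l unfolding convergent_to_def by (intro tendsto_intros) auto
  moreover have "qnorm X l \<le> K * (qnorm X (f n - l) + B)" if "n0 \<le> n" for n
  proof -
    have "qnorm X l \<le> K * (qnorm X (l - f n) + qnorm X (f n))"
      using qnorm_add[of "l - f n" "f n"] lc f by simp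
    also have "\<dots> \<le> K * (qnorm X (f n - l) + B)"
      using B[OF that] K_pos lc f by (intro mult_left_mono add_mono) (auto simp: qnorm_minus_commute)
    finally show ?thesis .
  qed
  ultimately show ?thesis by (intro LIMSEQ_le_const) auto
qed

end

locale complete_quasi_normed = quasi_normed +
  assumes complete: "Cauchy_seq f \<Longrightarrow> \<exists>l. convergent_to f l"

context
  fixes X :: "('k::real_normed_field, 'a::ab_group_add) qn_space" and KX :: real
    and Y :: "('k, 'b::ab_group_add) qn_space" and KY :: real
  assumes X: "quasi_normed X KX" and Y: "quasi_normed Y KY"
begin

interpretation X: quasi_normed X KX by (rule X)
interpretation Y: quasi_normed Y KY by (rule Y)

lemma linear_operator_zero:
  assumes "linear_operator X Y T"
  shows "T 0 = 0"
proof -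
  have "T (0 + 0) = T 0 + T 0" using assms X.zero_closed unfolding linear_operator_def by blast
  then show ?thesis by simp
qed

lemma linear_operator_diff:
  assumes "linear_operator X Y T" "x \<in> carrier X" "y \<in> carrier X"
  shows "T (x - y) = T x - T y"
proof -
  have "T (x - y + y) = T (x - y) + T y"
    using assms X.minus_closed unfolding linear_operator_def by blast
  then show ?thesis by simp
qed

text \<open>
  A neighbourhood of zero that is mapped into the unit ball gives the upper bound by homogeneity. The
  lower bound is the same argument for the inverse, which is continuous on the range.
\<close>

lemma isomorphically_embeds_imp_bounds:
  assumes "isomorphically_embeds X Y"
  obtains T c C where "linear_operator X Y T" "0 < c" "0 < C"
    "\<And>x. x \<in> carrier X \<Longrightarrow> c * qnorm X x \<le> qnorm Y (T x)"
    "\<And>x. x \<in> carrier X \<Longrightarrow> qnorm Y (T x) \<le> C * qnorm X x"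
proof -
  obtain T where T: "linear_operator X Y T" and emb: "embedding_map (qn_topology X) (qn_topology Y) T"
    using assms unfolding isomorphically_embeds_def by blast
  have Tc: "T x \<in> carrier Y" if "x \<in> carrier X" for x
    using T that unfolding linear_operator_def by blast
  have Ts: "T (scale X c x) = scale Y c (T x)" if "x \<in> carrier X" for c x
    using T that unfolding linear_operator_def by blast
  have T0: "T 0 = 0" by (rule linear_operator_zero[OF T])
  have inj: "inj_on T (carrier X)" using emb unfolding embedding_map_def by (auto dest: homeomorphic_imp_injective_map)
  have cont: "continuous_map (qn_topology X) (qn_topology Y) T"
    using homeomorphic_imp_continuous_map[OF emb[unfolded embedding_map_def]]
    by (simp add: continuous_map_in_subtopology)
  have openm: "open_map (qn_topology X) (subtopology (qn_topology Y) (T ` carrier X)) T"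
    using emb unfolding embedding_map_def by (simp add: homeomorphic_imp_open_map)
  obtain V where V: "openin (qn_topology Y) V" "0 \<in> V" "\<And>y. y \<in> V \<Longrightarrow> y \<in> carrier Y \<and> qnorm Y y < 1"
    using Y.zero_neighbourhood[of 1] by auto
  have "openin (qn_topology X) {x \<in> carrier X. T x \<in> V}"
    using openin_continuous_map_preimage[OF cont V(1)] by simp
  moreover have "0 \<in> {x \<in> carrier X. T x \<in> V}" using V T0 by simp
  ultimately obtain e where e: "e > 0" "\<forall>x\<in>carrier X. qnorm X (x - 0) < e \<longrightarrow> x \<in> {x \<in> carrier X. T x \<in> V}"
    unfolding openin_qn_topology by blast
  have upper: "qnorm Y (T x) \<le> 2 / e * qnorm X x" if x: "x \<in> carrier X" for x
  proof (cases "qnorm X x = 0")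
    case True
    then have "x = 0" using x by (rule X.qnorm_eq_0[rotated])
    then show ?thesis by (simp add: T0)
  next
    case False
    then have pos: "qnorm X x > 0" using X.qnorm_nonneg[OF x] by linarith
    define a where "a = e / (2 * qnorm X x)"
    have a: "a > 0" using pos e by (simp add: a_def)
    have "qnorm X (scale X (of_real a) x) = e / 2"
      using a pos x by (simp add: X.qnorm_scale) (simp add: a_def)
    then have "T (scale X (of_real a) x) \<in> V" using e x by simp
    then have "qnorm Y (T (scale X (of_real a) x)) < 1" using V by blast
    then have "a * qnorm Y (T x) < 1" using a x by (simp add: Ts Tc Y.qnorm_scale)
    then show ?thesis using pos e by (simp add: a_def field_simps)
  qed
  obtain U where U: "openin (qn_topology X) U" "0 \<in> U" "\<And>x. x \<in> U \<Longrightarrow> x \<in> carrier X \<and> qnorm X x < 1"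
    using X.zero_neighbourhood[of 1] by auto
  have "openin (subtopology (qn_topology Y) (T ` carrier X)) (T ` U)"
    using openm U(1) unfolding open_map_def by blast
  then obtain W where W: "openin (qn_topology Y) W" "T ` U = W \<inter> T ` carrier X"
    unfolding openin_subtopology by blast
  have "0 \<in> W" using W U(2) T0 by (metis IntD1 image_eqI)
  then obtain d where d: "d > 0" "\<forall>y\<in>carrier Y. qnorm Y (y - 0) < d \<longrightarrow> y \<in> W"
    using W unfolding openin_qn_topology by blast
  have lower: "d / 2 * qnorm X x \<le> qnorm Y (T x)" if x: "x \<in> carrier X" for x
  proof (cases "qnorm Y (T x) = 0")
    case True
    then have "T x = T 0" using Tc[OF x] T0 Y.qnorm_eq_0 by simp
    then have "x = 0" using inj x by (meson X.zero_closed inj_onD)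
    then show ?thesis by (simp add: T0)
  next
    case False
    then have pos: "qnorm Y (T x) > 0" using Y.qnorm_nonneg[OF Tc[OF x]] by linarith
    define a where "a = d / (2 * qnorm Y (T x))"
    have a: "a > 0" using pos d by (simp add: a_def)
    let ?x = "scale X (of_real a) x"
    have "qnorm Y (T ?x) = d / 2"
      using a pos x by (simp add: Ts Tc Y.qnorm_scale) (simp add: a_def)
    then have "T ?x \<in> W" using d Tc x by simp
    then have "T ?x \<in> T ` U" using W x by simp
    then obtain u where u: "u \<in> U" "T ?x = T u" by blast
    have "?x = u" using inj_onD[OF inj u(2)] x U(3)[OF u(1)] by simp
    then have "qnorm X ?x < 1" using u U(3) by blast
    then have "a * qnorm X x < 1" using a x by (simp add: X.qnorm_scale)
    then show ?thesis using pos d by (simp add: a_def field_simps)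
  qed
  show ?thesis
    by (rule that[OF T, of "d / 2" "2 / e"]) (use d e upper lower in auto)
qed

text \<open>
  The bounds make \<open>T\<close> a homeomorphism onto its range. The range is closed because preimages of a
  convergent sequence form a Cauchy sequence, which converges in \<open>X\<close>.
\<close>

lemma bounds_imp_isomorphically_embeds:
  assumes complete: "complete_quasi_normed X KX" and T: "linear_operator X Y T" and c: "0 < c"
    and lower: "\<And>x. x \<in> carrier X \<Longrightarrow> c * qnorm X x \<le> qnorm Y (T x)"
    and upper: "\<And>x. x \<in> carrier X \<Longrightarrow> qnorm Y (T x) \<le> C * qnorm X x"
  shows "isomorphically_embeds X Y"
proof -
  interpret cX: complete_quasi_normed X KX by (rule complete)
  have Tc: "T x \<in> carrier Y" if "x \<in> carrier X" for x
    using T that unfolding linear_operator_def by blast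
  note Td = linear_operator_diff[OF T]
  define D where "D = max C 1"
  have D: "D > 0" by (simp add: D_def)
  have upper': "qnorm Y (T x) \<le> D * qnorm X x" if "x \<in> carrier X" for x
    using upper[OF that] mult_right_mono[of C D "qnorm X x"] that by (simp add: D_def)
  have inj: "inj_on T (carrier X)"
  proof (rule inj_onI)
    fix x y assume xy: "x \<in> carrier X" "y \<in> carrier X" "T x = T y"
    have "c * qnorm X (x - y) \<le> 0" using lower[of "x - y"] xy by (simp add: Td)
    then have "qnorm X (x - y) \<le> 0" using c by (simp add: mult_le_0_iff)
    then have "qnorm X (x - y) = 0" using xy by (intro antisym) auto
    then show "x = y" using X.qnorm_eq_0[of "x - y"] xy by simp
  qed
  have cont: "continuous_map (qn_topology X) (qn_topology Y) T"
    unfolding continuous_map_def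
  proof (intro conjI allI impI)
    show "T \<in> topspace (qn_topology X) \<rightarrow> topspace (qn_topology Y)" using Tc by simp
    fix V assume V: "openin (qn_topology Y) V"
    show "openin (qn_topology X) {x \<in> topspace (qn_topology X). T x \<in> V}"
      unfolding openin_qn_topology
    proof (intro conjI ballI)
      fix x assume "x \<in> {x \<in> topspace (qn_topology X). T x \<in> V}"
      then have x: "x \<in> carrier X" "T x \<in> V" by auto
      then obtain e where e: "e > 0" "\<forall>y\<in>carrier Y. qnorm Y (y - T x) < e \<longrightarrow> y \<in> V"
        using V unfolding openin_qn_topology by blast
      have "T y \<in> V" if y: "y \<in> carrier X" "qnorm X (y - x) < e / D" for y
      proof -
        have "qnorm Y (T y - T x) \<le> D * qnorm X (y - x)" using upper'[of "y - x"] x y by (simp add: Td)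
        also have "\<dots> < e" using y D by (simp add: field_simps)
        finally show ?thesis using e Tc y by blast
      qed
      then show "\<exists>e>0. \<forall>y\<in>carrier X. qnorm X (y - x) < e \<longrightarrow> y \<in> {x \<in> topspace (qn_topology X). T x \<in> V}"
        using e D by (intro exI[of _ "e / D"]) auto
    qed auto
  qed
  have openm: "open_map (qn_topology X) (subtopology (qn_topology Y) (T ` carrier X)) T"
    unfolding open_map_def
  proof (intro allI impI)
    fix U assume U: "openin (qn_topology X) U"
    have UX: "U \<subseteq> carrier X" using U unfolding openin_qn_topology by blast
    define A where "A = {y \<in> carrier Y. y \<in> T ` carrier X \<longrightarrow> y \<in> T ` U}"
    \<comment> \<open>The points of \<open>Y\<close> near which the range of \<open>T\<close> stays inside \<open>T ` U\<close>.\<close>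
    define V where "V = {y \<in> carrier Y. \<exists>d>0. \<forall>z\<in>carrier Y. qnorm Y (z - y) < d \<longrightarrow> z \<in> A}"
    have V: "openin (qn_topology Y) V" unfolding V_def by (rule Y.openin_interior) (auto simp: A_def)
    have "T ` U = V \<inter> T ` carrier X"
    proof (intro equalityI subsetI)
      fix y assume "y \<in> T ` U"
      then obtain x where x: "x \<in> U" "y = T x" by blast
      then have xX: "x \<in> carrier X" using UX by blast
      obtain e where e: "e > 0" "\<forall>z\<in>carrier X. qnorm X (z - x) < e \<longrightarrow> z \<in> U"
        using U x unfolding openin_qn_topology by blast
      have "z \<in> A" if z: "z \<in> carrier Y" "qnorm Y (z - y) < c * e" for z
      proof -
        have "z \<in> T ` U" if zT: "z \<in> T ` carrier X"
        proof -
          obtain w where w: "w \<in> carrier X" "z = T w" using zT by blast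
          have "c * qnorm X (w - x) < c * e" using lower[of "w - x"] w x xX z by (simp add: Td)
          then have "w \<in> U" using e w c by simp
          then show ?thesis using w by blast
        qed
        then show ?thesis using z by (simp add: A_def)
      qed
      then have "y \<in> V" unfolding V_def using x xX Tc e c by (auto intro!: exI[of _ "c * e"])
      then show "y \<in> V \<inter> T ` carrier X" using x xX by blast
    next
      fix y assume y: "y \<in> V \<inter> T ` carrier X"
      then obtain d where "d > 0" "\<forall>z\<in>carrier Y. qnorm Y (z - y) < d \<longrightarrow> z \<in> A" "y \<in> carrier Y"
        unfolding V_def by blast
      then have "y \<in> A" by simp
      then show "y \<in> T ` U" using y by (simp add: A_def)
    qed
    then show "openin (subtopology (qn_topology Y) (T ` carrier X)) (T ` U)"
      using V unfolding openin_subtopology by blast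
  qed
  have emb: "embedding_map (qn_topology X) (qn_topology Y) T"
    unfolding embedding_map_def
  proof (rule bijective_open_imp_homeomorphic_map)
    show "continuous_map (qn_topology X) (subtopology (qn_topology Y) (T ` topspace (qn_topology X))) T"
      using cont by (simp add: continuous_map_in_subtopology)
    show "T ` topspace (qn_topology X) = topspace (subtopology (qn_topology Y) (T ` topspace (qn_topology X)))"
      using Tc by auto
  qed (use openm inj in auto)
  have closed: "closedin (qn_topology Y) (T ` carrier X)"
    unfolding closedin_def topspace_qn_topology openin_qn_topology
  proof (intro conjI ballI)
    show "T ` carrier X \<subseteq> carrier Y" using Tc by blast
    fix y assume y: "y \<in> carrier Y - T ` carrier X"
    show "\<exists>e>0. \<forall>z\<in>carrier Y. qnorm Y (z - y) < e \<longrightarrow> z \<in> carrier Y - T ` carrier X"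
    proof (rule ccontr)
      assume neg: "\<not> ?thesis"
      have "\<exists>x\<in>carrier X. qnorm Y (T x - y) < 1 / real (Suc n)" for n
      proof -
        have "1 / real (Suc n) > 0" by simp
        then obtain z where z: "z \<in> carrier Y" "qnorm Y (z - y) < 1 / real (Suc n)"
          "z \<notin> carrier Y - T ` carrier X" using neg by blast
        then have "z \<in> T ` carrier X" by simp
        then obtain x where "x \<in> carrier X" "z = T x" by (rule imageE) auto
        then show ?thesis using z(2) by blast
      qed
      then obtain f where f: "\<And>n. f n \<in> carrier X" "\<And>n. qnorm Y (T (f n) - y) < 1 / real (Suc n)"
        by metis
      have lim: "(\<lambda>n. qnorm Y (T (f n) - y)) \<longlonglongrightarrow> 0"
        by (rule tendsto_sandwich[OF _ _ tendsto_const LIMSEQ_inverse_real_of_nat])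
          (use f Tc y in \<open>auto intro!: always_eventually less_imp_le simp: divide_inverse\<close>)
      have "X.Cauchy_seq f"
        unfolding X.Cauchy_seq_def
      proof (intro conjI allI impI)
        fix e :: real assume e: "e > 0"
        define e' where "e' = c * e / (2 * KY)"
        have e': "e' > 0" using e c Y.K_pos by (simp add: e'_def)
        obtain N where N: "\<And>n. n \<ge> N \<Longrightarrow> qnorm Y (T (f n) - y) < e'"
          using order_tendstoD(2)[OF lim e'] unfolding eventually_sequentially by blast
        have "qnorm X (f m - f n) < e" if "m \<ge> N" "n \<ge> N" for m n
        proof -
          have "c * qnorm X (f m - f n) \<le> qnorm Y (T (f m) - T (f n))"
            using lower[of "f m - f n"] f by (simp add: Td)
          also have "\<dots> \<le> KY * (qnorm Y (T (f m) - y) + qnorm Y (y - T (f n)))"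
            using f Tc y by (intro Y.qnorm_triangle) auto
          also have "\<dots> < KY * (e' + e')"
            using N[OF that(1)] N[OF that(2)] Y.K_pos f Tc y
            by (intro mult_strict_left_mono add_strict_mono) (auto simp: Y.qnorm_minus_commute)
          also have "\<dots> = c * e" using Y.K_pos by (simp add: e'_def)
          finally show ?thesis using c by simp
        qed
        then show "\<exists>N. \<forall>m\<ge>N. \<forall>n\<ge>N. qnorm X (f m - f n) < e" by blast
      qed (rule f)
      then obtain x where x: "X.convergent_to f x" using cX.complete by blast
      then have xX: "x \<in> carrier X" by (simp add: X.convergent_to_def)
      have "(\<lambda>n. D * qnorm X (f n - x)) \<longlonglongrightarrow> D * 0"
        using x unfolding X.convergent_to_def by (intro tendsto_intros) auto
      then have lim': "(\<lambda>n. D * qnorm X (f n - x)) \<longlonglongrightarrow> 0" by simp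
      have "(\<lambda>n. qnorm Y (T (f n) - T x)) \<longlonglongrightarrow> 0"
        by (rule tendsto_sandwich[OF _ _ tendsto_const lim'])
          (use f Tc xX upper' in \<open>auto intro!: always_eventually simp: Td[symmetric]\<close>)
      then have "Y.convergent_to (\<lambda>n. T (f n)) (T x)" using Tc xX by (simp add: Y.convergent_to_def)
      moreover have "Y.convergent_to (\<lambda>n. T (f n)) y" using lim y by (simp add: Y.convergent_to_def)
      ultimately have "y = T x" using Y.convergent_to_unique f Tc by metis
      then show False using y xX by blast
    qed
  qed auto
  show ?thesis unfolding isomorphically_embeds_def using T emb closed by blast
qed

end

lemma carrier_lp: "x \<in> carrier (lp_space p) \<longleftrightarrow> summable (\<lambda>n. norm (x n) powr p)"
  by (simp add: lp_space_def)

lemma qnorm_lp: "qnorm (lp_space p) x = (\<Sum>n. norm (x n) powr p) powr (1 / p)"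
  by (simp add: lp_space_def)

lemma scale_lp: "scale (lp_space p) c x = (\<lambda>n. c * x n)"
  by (simp add: lp_space_def)

lemma norm_add_powr_le:
  fixes x y :: "'v::real_normed_vector"
  assumes "0 < p"
  shows "norm (x + y) powr p \<le> 2 powr p * (norm x powr p + norm y powr p)"
proof -
  have "norm (x + y) powr p \<le> (norm x + norm y) powr p"
    using assms by (intro powr_mono2 norm_triangle_ineq) auto
  also have "\<dots> \<le> 2 powr p * (norm x powr p + norm y powr p)"
    using assms by (intro add_powr_le_double) auto
  finally show ?thesis .
qed

lemma quasi_normed_lp:
  assumes p: "0 < p"
  shows "quasi_normed (lp_space p :: ('k::real_normed_field, nat \<Rightarrow> 'k) qn_space) (2 * 2 powr (1 / p))"
proof
  fix x y :: "nat \<Rightarrow> 'k" and c d :: 'k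
  show "0 < 2 * 2 powr (1 / p)" by simp
  show "0 \<in> carrier (lp_space p :: ('k, nat \<Rightarrow> 'k) qn_space)" using p by (simp add: carrier_lp)
  {
    assume x: "x \<in> carrier (lp_space p)"
    show "scale (lp_space p) c x \<in> carrier (lp_space p)"
      using x by (simp add: carrier_lp scale_lp norm_mult powr_mult summable_mult)
    show "0 \<le> qnorm (lp_space p) x" by (simp add: qnorm_lp)
    show "qnorm (lp_space p) (scale (lp_space p) c x) = norm c * qnorm (lp_space p) x"
      using x p by (simp add: carrier_lp qnorm_lp scale_lp norm_mult powr_mult suminf_mult suminf_nonneg powr_powr)
    show "x = 0" if "qnorm (lp_space p) x = 0"
    proof -
      have "(\<Sum>n. norm (x n) powr p) = 0" using that by (simp add: qnorm_lp)
      then have "\<forall>n. norm (x n) powr p = 0"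
        using x by (subst (asm) suminf_eq_zero_iff) (auto simp: carrier_lp)
      then show ?thesis by (auto simp: fun_eq_iff)
    qed
    assume y: "y \<in> carrier (lp_space p)"
    have sx: "summable (\<lambda>n. norm (x n) powr p)" and sy: "summable (\<lambda>n. norm (y n) powr p)"
      using x y by (simp_all add: carrier_lp)
    have sxy: "summable (\<lambda>n. 2 powr p * (norm (x n) powr p + norm (y n) powr p))"
      using sx sy by (intro summable_mult summable_add)
    have s: "summable (\<lambda>n. norm (x n + y n) powr p)"
      by (rule summable_comparison_test[OF _ sxy]) (auto intro!: norm_add_powr_le p)
    then show "x + y \<in> carrier (lp_space p)" by (simp add: carrier_lp)
    have "(\<Sum>n. norm (x n + y n) powr p) \<le> (\<Sum>n. 2 powr p * (norm (x n) powr p + norm (y n) powr p))"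
      by (intro suminf_le norm_add_powr_le p s sxy)
    also have "\<dots> = 2 powr p * ((\<Sum>n. norm (x n) powr p) + (\<Sum>n. norm (y n) powr p))"
      using sx sy by (simp add: suminf_mult suminf_add summable_add)
    finally have "(\<Sum>n. norm (x n + y n) powr p) powr (1 / p) \<le>
        (2 powr p * ((\<Sum>n. norm (x n) powr p) + (\<Sum>n. norm (y n) powr p))) powr (1 / p)"
      using p s by (intro powr_mono2) (auto intro: suminf_nonneg)
    also have "\<dots> = 2 * ((\<Sum>n. norm (x n) powr p) + (\<Sum>n. norm (y n) powr p)) powr (1 / p)"
      using p sx sy by (simp add: powr_mult powr_powr suminf_nonneg)
    also have "\<dots> \<le> 2 * (2 powr (1 / p) *
        ((\<Sum>n. norm (x n) powr p) powr (1 / p) + (\<Sum>n. norm (y n) powr p) powr (1 / p)))"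
      using p sx sy by (intro mult_left_mono add_powr_le_double) (auto intro: suminf_nonneg)
    finally show "qnorm (lp_space p) (x + y) \<le>
        2 * 2 powr (1 / p) * (qnorm (lp_space p) x + qnorm (lp_space p) y)"
      by (simp add: qnorm_lp)
  }
qed (auto simp: scale_lp algebra_simps fun_eq_iff)

text \<open>
  The limit is formed coordinate by coordinate. That it is a limit in norm is checked on finite partial
  sums, for which the Cauchy estimate passes to the limit.
\<close>

lemma complete_quasi_normed_lp:
  assumes p: "0 < p"
  shows "complete_quasi_normed (lp_space p :: ('k::{real_normed_field,banach}, nat \<Rightarrow> 'k) qn_space)
    (2 * 2 powr (1 / p))"
proof -
  let ?L = "lp_space p :: ('k, nat \<Rightarrow> 'k) qn_space"
  interpret quasi_normed ?L "2 * 2 powr (1 / p)" by (rule quasi_normed_lp[OF p])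
  show ?thesis
  proof
    fix f :: "nat \<Rightarrow> nat \<Rightarrow> 'k" assume f: "Cauchy_seq f"
    have fc: "f n \<in> carrier ?L" for n using f by (simp add: Cauchy_seq_def)
    have N: "\<exists>N. \<forall>m\<ge>N. \<forall>n\<ge>N. \<forall>M. (\<Sum>k<M. norm (f m k - f n k) powr p) \<le> e powr p" if "e > 0" for e
    proof -
      have "\<exists>N. \<forall>m\<ge>N. \<forall>n\<ge>N. qnorm ?L (f m - f n) < e"
        using f that unfolding Cauchy_seq_def by blast
      then obtain N where N: "\<And>m n. m \<ge> N \<Longrightarrow> n \<ge> N \<Longrightarrow> qnorm ?L (f m - f n) < e"
        by blast
      have "(\<Sum>k<M. norm (f m k - f n k) powr p) \<le> e powr p" if "m \<ge> N" "n \<ge> N" for m n M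
      proof -
        have s: "summable (\<lambda>k. norm (f m k - f n k) powr p)"
          using minus_closed[OF fc fc, of m n] by (simp add: carrier_lp)
        have "(\<Sum>k<M. norm (f m k - f n k) powr p) \<le> (\<Sum>k. norm (f m k - f n k) powr p)"
          by (rule sum_le_suminf[OF s]) auto
        also have "\<dots> = qnorm ?L (f m - f n) powr p"
          using p s by (simp add: qnorm_lp powr_powr suminf_nonneg)
        also have "\<dots> \<le> e powr p"
          using N[OF that] p minus_closed[OF fc fc] by (intro powr_mono2) auto
        finally show ?thesis .
      qed
      then show ?thesis by blast
    qed
    have "Cauchy (\<lambda>n. f n k)" for k
    proof (rule metric_CauchyI)
      fix e :: real assume e: "e > 0"
      obtain N where N: "\<And>m n M. m \<ge> N \<Longrightarrow> n \<ge> N \<Longrightarrow> (\<Sum>k<M. norm (f m k - f n k) powr p) \<le> (e / 2) powr p"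
        using N[of "e / 2"] e by auto
      have "dist (f m k) (f n k) < e" if "m \<ge> N" "n \<ge> N" for m n
      proof -
        have "norm (f m k - f n k) powr p \<le> (\<Sum>k<Suc k. norm (f m k - f n k) powr p)"
          by (rule member_le_sum) auto
        also have "\<dots> \<le> (e / 2) powr p" by (rule N[OF that])
        finally have "norm (f m k - f n k) \<le> e / 2"
          using p e powr_less_mono2[of p "e / 2" "norm (f m k - f n k)"] by linarith
        then show ?thesis using e by (simp add: dist_norm)
      qed
      then show "\<exists>N. \<forall>m\<ge>N. \<forall>n\<ge>N. dist (f m k) (f n k) < e" by blast
    qed
    then have "\<forall>k. \<exists>l. (\<lambda>n. f n k) \<longlonglongrightarrow> l" using Cauchy_convergent convergent_def by blast
    then obtain g where g: "\<And>k. (\<lambda>n. f n k) \<longlonglongrightarrow> g k" by metis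
    have tail: "\<exists>N. \<forall>m\<ge>N. f m - g \<in> carrier ?L \<and> qnorm ?L (f m - g) \<le> e" if e: "e > 0" for e
    proof -
      obtain N where N: "\<And>m n M. m \<ge> N \<Longrightarrow> n \<ge> N \<Longrightarrow> (\<Sum>k<M. norm (f m k - f n k) powr p) \<le> e powr p"
        using N[OF e] by auto
      have "f m - g \<in> carrier ?L \<and> qnorm ?L (f m - g) \<le> e" if m: "m \<ge> N" for m
      proof -
        have part: "(\<Sum>k<M. norm (f m k - g k) powr p) \<le> e powr p" for M
        proof (rule LIMSEQ_le_const2)
          show "(\<lambda>n. \<Sum>k<M. norm (f m k - f n k) powr p) \<longlonglongrightarrow> (\<Sum>k<M. norm (f m k - g k) powr p)"
            using p by (intro tendsto_sum tendsto_powr' tendsto_norm tendsto_diff tendsto_const g) auto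
          show "\<exists>N. \<forall>n\<ge>N. (\<Sum>k<M. norm (f m k - f n k) powr p) \<le> e powr p" using N[OF m] by blast
        qed
        have s: "summable (\<lambda>k. norm (f m k - g k) powr p)"
          by (rule summableI_nonneg_bounded[OF _ part]) auto
        have "(\<Sum>k. norm (f m k - g k) powr p) \<le> e powr p"
          by (rule suminf_le_const[OF s part])
        then have "(\<Sum>k. norm (f m k - g k) powr p) powr (1 / p) \<le> (e powr p) powr (1 / p)"
          using p s by (intro powr_mono2) (auto intro: suminf_nonneg)
        then show ?thesis using p e s by (simp add: carrier_lp qnorm_lp powr_powr)
      qed
      then show ?thesis by blast
    qed
    obtain N where "f N - g \<in> carrier ?L" using tail[of 1] by auto
    then have "f N - (f N - g) \<in> carrier ?L" using fc minus_closed by blast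
    then have gc: "g \<in> carrier ?L" by simp
    have "(\<lambda>n. qnorm ?L (f n - g)) \<longlonglongrightarrow> 0"
    proof (rule LIMSEQ_I)
      fix e :: real assume e: "e > 0"
      obtain N where N: "\<And>m. m \<ge> N \<Longrightarrow> qnorm ?L (f m - g) \<le> e / 2" using tail[of "e / 2"] e by auto
      have "norm (qnorm ?L (f n - g) - 0) < e" if "n \<ge> N" for n
        using N[OF that] e qnorm_nonneg[OF minus_closed[OF fc gc], of n] by simp
      then show "\<exists>N. \<forall>n\<ge>N. norm (qnorm ?L (f n - g) - 0) < e" by blast
    qed
    then show "\<exists>l. convergent_to f l" using gc by (auto simp: convergent_to_def)
  qed
qed

lemma qnorm_c0_bdd:
  assumes "x \<longlonglongrightarrow> (0 :: 'k::real_normed_field)"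
  shows "bdd_above (range (\<lambda>n. norm (x n)))"
proof -
  have "Bseq x" by (rule convergent_imp_Bseq[OF convergentI[OF assms]])
  then obtain B where "\<And>n. norm (x n) \<le> B" unfolding Bseq_def by blast
  then show ?thesis by (intro bdd_aboveI[of _ B]) auto
qed

lemma quasi_normed_c0: "quasi_normed (c0_space :: ('k::real_normed_field, nat \<Rightarrow> 'k) qn_space) 1"
proof
  fix x y :: "nat \<Rightarrow> 'k" and c d :: 'k
  show "0 \<in> carrier (c0_space :: ('k, nat \<Rightarrow> 'k) qn_space)" by (simp add: c0_space_def zero_fun_def)
  {
    assume "x \<in> carrier c0_space"
    then have x: "x \<longlonglongrightarrow> 0" by (simp add: c0_space_def)
    note bx = qnorm_c0_bdd[OF x]
    have ux: "norm (x n) \<le> (SUP n. norm (x n))" for n by (rule cSUP_upper[OF _ bx]) simp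
    show "scale c0_space c x \<in> carrier c0_space"
      using tendsto_mult_right_zero[OF x, of c] by (simp add: c0_space_def)
    show "0 \<le> qnorm c0_space x" using order.trans[OF norm_ge_zero ux[of 0]] by (simp add: c0_space_def)
    show "qnorm c0_space (scale c0_space c x) = norm c * qnorm c0_space x"
    proof -
      have lim: "(\<lambda>n. c * x n) \<longlonglongrightarrow> 0" by (rule tendsto_mult_right_zero[OF x])
      have 1: "(SUP n. norm (c * x n)) \<le> norm c * (SUP n. norm (x n))"
        by (rule cSUP_least) (auto simp: norm_mult intro!: mult_left_mono ux)
      have 2: "norm c * (SUP n. norm (x n)) \<le> (SUP n. norm (c * x n))"
      proof (cases "c = 0")
        case False
        have "(SUP n. norm (x n)) \<le> (SUP n. norm (c * x n)) / norm c"
        proof (rule cSUP_least)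
          fix n
          have "norm (c * x n) \<le> (SUP n. norm (c * x n))"
            by (rule cSUP_upper[OF _ qnorm_c0_bdd[OF lim]]) simp
          then show "norm (x n) \<le> (SUP n. norm (c * x n)) / norm c"
            using False by (simp add: norm_mult field_simps)
        qed simp
        then show ?thesis using False by (simp add: field_simps)
      qed simp
      show ?thesis using 1 2 by (simp add: c0_space_def)
    qed
    show "x = 0" if "qnorm c0_space x = 0"
    proof
      fix n
      have "norm (x n) \<le> 0" using ux[of n] that by (simp add: c0_space_def)
      then show "x n = 0 n" by simp
    qed
    assume "y \<in> carrier c0_space"
    then have y: "y \<longlonglongrightarrow> 0" by (simp add: c0_space_def)
    have uy: "norm (y n) \<le> (SUP n. norm (y n))" for n by (rule cSUP_upper[OF _ qnorm_c0_bdd[OF y]]) simp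
    show "x + y \<in> carrier c0_space" using tendsto_add_zero[OF x y] by (simp add: c0_space_def plus_fun_def)
    have "(SUP n. norm (x n + y n)) \<le> (SUP n. norm (x n)) + (SUP n. norm (y n))"
      by (rule cSUP_least) (auto intro: order.trans[OF norm_triangle_ineq add_mono[OF ux uy]])
    then show "qnorm c0_space (x + y) \<le> 1 * (qnorm c0_space x + qnorm c0_space y)"
      by (simp add: c0_space_def)
  }
qed (auto simp: c0_space_def algebra_simps fun_eq_iff)

text \<open>
  The operator maps \<open>a\<close> to the sum of the series \<open>\<Sum> a\<^sub>i y\<^sub>i\<close>, which converges by the upper bound for its
  tails. Quasi-norms need not be continuous, so the bounds for \<open>T\<close> lose a factor \<open>K\<close> in the limit.
\<close>

lemma lp_embeds_if_basis_bounds: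
  fixes Y :: "('k::{real_normed_field,banach}, 'b::ab_group_add) qn_space" and y :: "nat \<Rightarrow> 'b"
  assumes p: "0 < p" and Y: "complete_quasi_normed Y KY" and c: "0 < c"
    and y: "\<And>i. y i \<in> carrier Y"
    and lower: "\<And>a n. c * (\<Sum>i<n. norm (a i) powr p) powr (1 / p) \<le> qnorm Y (\<Sum>i<n. scale Y (a i) (y i))"
    and upper: "\<And>a n. qnorm Y (\<Sum>i<n. scale Y (a i) (y i)) \<le> C * (\<Sum>i<n. norm (a i) powr p) powr (1 / p)"
  shows "isomorphically_embeds (lp_space p) Y"
proof -
  let ?L = "lp_space p :: ('k, nat \<Rightarrow> 'k) qn_space"
  interpret Y: complete_quasi_normed Y KY by (rule Y)
  interpret L: complete_quasi_normed ?L "2 * 2 powr (1 / p)" by (rule complete_quasi_normed_lp[OF p])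
  define S where "S a n = (\<Sum>i<n. scale Y (a i) (y i))" for a n
  have Sc: "S a n \<in> carrier Y" for a n unfolding S_def using y by simp
  have C: "C > 0"
  proof -
    have "c * 1 \<le> C * 1" using order.trans[OF lower[where a = "\<lambda>_. 1" and n = 1] upper] by simp
    then show ?thesis using c by simp
  qed
  have diff: "S a m - S a n = S (\<lambda>i. if i < n then 0 else a i) m" if "n \<le> m" for a n m
  proof -
    have "S a m = (\<Sum>i\<in>{..<n} \<union> {n..<m}. scale Y (a i) (y i))"
      unfolding S_def using that by (intro sum.cong) auto
    also have "\<dots> = S a n + (\<Sum>i\<in>{n..<m}. scale Y (a i) (y i))"
      unfolding S_def by (rule sum.union_disjoint) auto
    finally have "S a m - S a n = (\<Sum>i\<in>{n..<m}. scale Y (a i) (y i))" by simp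
    also have "\<dots> = S (\<lambda>i. if i < n then 0 else a i) m"
      unfolding S_def using that y
      by (intro sum.mono_neutral_cong_left) (auto simp: Y.scale_zero_left)
    finally show ?thesis .
  qed
  have "\<exists>l. Y.convergent_to (S a) l" if a: "a \<in> carrier ?L" for a
  proof (rule Y.complete, unfold Y.Cauchy_seq_def, intro conjI allI impI)
    fix e :: real assume e: "e > 0"
    define e' where "e' = (e / (2 * C)) powr p"
    have e': "e' > 0" using e C by (simp add: e'_def)
    have s: "summable (\<lambda>n. norm (a n) powr p)" using a by (simp add: carrier_lp)
    obtain N where N: "\<And>m n. m \<ge> N \<Longrightarrow> norm (sum (\<lambda>n. norm (a n) powr p) {m..<n}) < e'"
      using s e' unfolding summable_Cauchy by blast
    have le: "qnorm Y (S a m - S a n) < e" if "N \<le> n" "n \<le> m" for m n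
    proof -
      have "(\<Sum>i<m. norm (if i < n then 0 else a i) powr p) = (\<Sum>i\<in>{n..<m}. norm (a i) powr p)"
        using that by (intro sum.mono_neutral_cong_right) auto
      also have "\<dots> \<le> e'" using N[OF that(1), of m] by simp
      finally have "(\<Sum>i<m. norm (if i < n then 0 else a i) powr p) powr (1 / p) \<le> e' powr (1 / p)"
        using p by (intro powr_mono2) (auto intro: sum_nonneg)
      also have "\<dots> = e / (2 * C)" using p e C by (simp add: e'_def powr_powr)
      finally have "C * (\<Sum>i<m. norm (if i < n then 0 else a i) powr p) powr (1 / p) \<le> C * (e / (2 * C))"
        using C by (intro mult_left_mono) auto
      moreover have "qnorm Y (S a m - S a n) \<le> C * (\<Sum>i<m. norm (if i < n then 0 else a i) powr p) powr (1 / p)"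
        by (subst diff[OF that(2)], unfold S_def, rule upper)
      moreover have "C * (e / (2 * C)) < e" using e C by simp
      ultimately show ?thesis by linarith
    qed
    have "qnorm Y (S a m - S a n) < e" if "N \<le> n" "N \<le> m" for m n
      using le[of n m] le[of m n] that by (cases "n \<le> m") (auto simp: Y.qnorm_minus_commute Sc)
    then show "\<exists>N. \<forall>m\<ge>N. \<forall>n\<ge>N. qnorm Y (S a m - S a n) < e" by blast
  qed (rule Sc)
  then obtain T where T: "\<And>a. a \<in> carrier ?L \<Longrightarrow> Y.convergent_to (S a) (T a)" by metis
  have Tc: "T a \<in> carrier Y" if "a \<in> carrier ?L" for a using T[OF that] by (simp add: Y.convergent_to_def)
  have lin: "linear_operator ?L Y T"
    unfolding linear_operator_def
  proof (intro conjI ballI allI)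
    show "T ` carrier ?L \<subseteq> carrier Y" using Tc by blast
    fix a assume a: "a \<in> carrier ?L"
    show "T (a + b) = T a + T b" if b: "b \<in> carrier ?L" for b
    proof (rule Y.convergent_to_unique[of "S (a + b)"])
      have "S (a + b) = (\<lambda>n. S a n + S b n)"
        using y by (auto simp: fun_eq_iff S_def Y.add_scale sum.distrib)
      then show "Y.convergent_to (S (a + b)) (T a + T b)"
        using Y.convergent_to_add[OF Sc Sc T[OF a] T[OF b]] by simp
    qed (use T a b Sc L.add_closed in auto)
    show "T (scale ?L d a) = scale Y d (T a)" for d
    proof (rule Y.convergent_to_unique[of "S (scale ?L d a)"])
      have "S (scale ?L d a) = (\<lambda>n. scale Y d (S a n))"
        using y by (auto simp: fun_eq_iff S_def scale_lp Y.scale_sum Y.scale_scale)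
      then show "Y.convergent_to (S (scale ?L d a)) (scale Y d (T a))"
        using Y.convergent_to_scale[OF Sc T[OF a]] by simp
    qed (use T a Sc L.scale_closed in auto)
  qed
  have qn: "(\<lambda>n. (\<Sum>i<n. norm (a i) powr p) powr (1 / p)) \<longlonglongrightarrow> qnorm ?L a" if "a \<in> carrier ?L" for a
    unfolding qnorm_lp using that p
    by (intro tendsto_powr' summable_LIMSEQ tendsto_const) (auto simp: carrier_lp intro!: always_eventually sum_nonneg)
  have up: "qnorm Y (T a) \<le> KY * C * qnorm ?L a" if a: "a \<in> carrier ?L" for a
  proof -
    have "qnorm Y (S a n) \<le> C * qnorm ?L a" for n
    proof -
      have "qnorm Y (S a n) \<le> C * (\<Sum>i<n. norm (a i) powr p) powr (1 / p)"
        unfolding S_def by (rule upper)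
      also have "\<dots> \<le> C * qnorm ?L a"
        unfolding qnorm_lp using a p C
        by (intro mult_left_mono powr_mono2 sum_le_suminf) (auto simp: carrier_lp intro!: sum_nonneg)
      finally show ?thesis .
    qed
    then show ?thesis using Y.convergent_to_qnorm_le[OF Sc T[OF a], of 0] by (simp add: mult.assoc)
  qed
  have low: "c / KY * qnorm ?L a \<le> qnorm Y (T a)" if a: "a \<in> carrier ?L" for a
  proof -
    have "(\<lambda>n. KY * (qnorm Y (T a) + qnorm Y (S a n - T a))) \<longlonglongrightarrow> KY * (qnorm Y (T a) + 0)"
      using T[OF a] unfolding Y.convergent_to_def by (intro tendsto_intros) auto
    moreover have "(\<lambda>n. c * (\<Sum>i<n. norm (a i) powr p) powr (1 / p)) \<longlonglongrightarrow> c * qnorm ?L a"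
      by (intro tendsto_intros qn a)
    moreover have "c * (\<Sum>i<n. norm (a i) powr p) powr (1 / p) \<le> KY * (qnorm Y (T a) + qnorm Y (S a n - T a))" for n
    proof -
      have "qnorm Y (S a n) \<le> KY * (qnorm Y (T a) + qnorm Y (S a n - T a))"
        using Y.qnorm_add[of "T a" "S a n - T a"] Tc[OF a] Sc by simp
      then show ?thesis using lower[where a = a and n = n] unfolding S_def by linarith
    qed
    ultimately have "c * qnorm ?L a \<le> KY * (qnorm Y (T a) + 0)"
      by (intro LIMSEQ_le) auto
    then show ?thesis using Y.K_pos by (simp add: field_simps)
  qed
  show ?thesis
    by (rule bounds_imp_isomorphically_embeds[OF L.quasi_normed_axioms Y.quasi_normed_axioms
          L.complete_quasi_normed_axioms lin _ low up]) (use c Y.K_pos in auto)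
qed

section \<open>The space of mixed norm is a complete quasi-normed space\<close>

lemma ennpowr_ennreal: "0 \<le> t \<Longrightarrow> ennpowr (ennreal t) a = ennreal (t powr a)"
  by (simp add: ennpowr_def)

lemma ennpowr_top [simp]: "ennpowr top a = top"
  by (simp add: ennpowr_def)

lemma ennpowr_0 [simp]: "ennpowr 0 a = 0"
  by (simp add: ennpowr_def)

lemma ennpowr_less_mono:
  assumes "0 < a" "u < v"
  shows "ennpowr u a < ennpowr v a"
proof (cases v)
  case top
  then have "u \<noteq> top" using assms by auto
  then show ?thesis using top by (simp add: ennpowr_def)
next
  case (real y)
  have "u < ennreal y" using real assms by simp
  then obtain x where x: "u = ennreal x" "0 \<le> x" "x < y"
    by (cases u) (auto simp: ennreal_less_iff)
  then show ?thesis using real assms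
    by (simp add: ennpowr_ennreal ennreal_less_iff powr_less_mono2)
qed

lemma ennpowr_mono:
  assumes "0 < a" "u \<le> v"
  shows "ennpowr u a \<le> ennpowr v a"
  using ennpowr_less_mono[OF assms(1), of u v] assms(2) by (auto simp: order_le_less)

lemma ennpowr_less_iff: "0 < a \<Longrightarrow> ennpowr u a < ennpowr v a \<longleftrightarrow> u < v"
  using ennpowr_less_mono[of a u v] ennpowr_mono[of a v u] by (meson not_le)

lemma ennpowr_ennpowr: "0 < a \<Longrightarrow> 0 < b \<Longrightarrow> ennpowr (ennpowr t a) b = ennpowr t (a * b)"
  by (cases t) (auto simp: ennpowr_ennreal powr_powr)

lemma ennpowr_one [simp]: "ennpowr t 1 = t"
  by (cases t) (auto simp: ennpowr_ennreal)

lemma ennpowr_eq_0: "0 < a \<Longrightarrow> ennpowr t a = 0 \<longleftrightarrow> t = 0"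
  by (cases t) (auto simp: ennpowr_ennreal)

lemma ennpowr_less_top: "ennpowr t a < top \<longleftrightarrow> t < top"
  by (cases t) (auto simp: ennpowr_ennreal)

lemma ennpowr_mult: "0 \<le> c \<Longrightarrow> 0 < a \<Longrightarrow> ennpowr (ennreal c * t) a = ennreal (c powr a) * ennpowr t a"
  by (cases t; cases "c = 0")
    (auto simp: ennpowr_ennreal ennreal_mult[symmetric] powr_mult ennreal_mult_top)

lemma ennpowr_add_le:
  assumes "0 < a"
  shows "ennpowr (u + v) a \<le> ennreal (2 powr a) * (ennpowr u a + ennpowr v a)"
proof (cases "u = top \<or> v = top")
  case True
  then show ?thesis by (auto simp: ennreal_mult_top)
next
  case False
  then obtain x y where "u = ennreal x" "v = ennreal y" "0 \<le> x" "0 \<le> y" by (metis ennreal_cases)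
  then show ?thesis using assms add_powr_le_double[of x y a]
    by (simp add: ennpowr_ennreal ennreal_plus[symmetric] ennreal_mult[symmetric] del: ennreal_plus)
qed

lemma borel_measurable_ennpowr [measurable (raw)]:
  assumes [measurable]: "f \<in> borel_measurable M"
  shows "(\<lambda>x. ennpowr (f x) a) \<in> borel_measurable M"
  unfolding ennpowr_def by measurable

text \<open>
  The power is an increasing bijection of \<open>[0, \<infinity>]\<close>, so every value below \<open>L\<^sup>a\<close> is the power of a value
  below \<open>L\<close>.
\<close>

lemma ennpowr_liminf_le:
  fixes f :: "nat \<Rightarrow> ennreal"
  assumes a: "0 < a" and L: "L \<le> liminf f"
  shows "ennpowr L a \<le> liminf (\<lambda>k. ennpowr (f k) a)"
  unfolding le_Liminf_iff
proof (intro allI impI)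
  fix y assume y: "y < ennpowr L a"
  have yy: "ennpowr (ennpowr y (1 / a)) a = y" using a by (simp add: ennpowr_ennpowr)
  then have "ennpowr y (1 / a) < L" using y ennpowr_less_iff[OF a, of "ennpowr y (1 / a)" L] by simp
  then have "\<forall>\<^sub>F k in sequentially. ennpowr y (1 / a) < f k"
    using L unfolding le_Liminf_iff by blast
  then show "\<forall>\<^sub>F k in sequentially. y < ennpowr (f k) a"
    by eventually_elim (use ennpowr_less_mono[OF a] yy in metis)
qed

definition inner_sum :: "real \<Rightarrow> (real \<times> nat \<Rightarrow> 'k::real_normed_vector) \<Rightarrow> real \<Rightarrow> ennreal" where
  "inner_sum r f x = (\<Sum>n. ennreal (norm (f (x, n)) powr r))"

text \<open>
  The \<open>s\<close>-th power of the quasi-norm. Unlike the quasi-norm it is an integral, so the convergence theorems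
  of integration apply to it directly.
\<close>

definition mixed_modular :: "real \<Rightarrow> real \<Rightarrow> (real \<times> nat \<Rightarrow> 'k::real_normed_vector) \<Rightarrow> ennreal" where
  "mixed_modular s r f = (\<integral>\<^sup>+x. ennpowr (inner_sum r f x) (s / r) \<partial>unit_measure)"

lemma measurable_section [measurable (raw)]:
  assumes "f \<in> borel_measurable mixed_measure"
  shows "(\<lambda>x. f (x, n)) \<in> borel_measurable unit_measure"
  using assms unfolding mixed_measure_def
  by (rule measurable_compose[rotated]) (intro measurable_Pair2', simp)

lemma borel_measurable_inner_sum [measurable (raw)]:
  assumes [measurable]: "f \<in> borel_measurable mixed_measure"
  shows "inner_sum r f \<in> borel_measurable unit_measure"
  unfolding inner_sum_def by measurable

lemma term_le_inner_sum: "ennreal (norm (f (x, n)) powr r) \<le> inner_sum r f x"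
proof -
  have "(\<Sum>n\<in>{n}. ennreal (norm (f (x, n)) powr r)) \<le> inner_sum r f x"
    unfolding inner_sum_def by (rule sum_le_suminf) auto
  then show ?thesis by simp
qed

lemma inner_sum_mono:
  assumes "\<And>n. norm (f (x, n)) \<le> norm (g (x, n))" "0 < r"
  shows "inner_sum r f x \<le> inner_sum r g x"
  unfolding inner_sum_def using assms by (intro suminf_le ennreal_leI powr_mono2) auto

lemma mixed_modular_mono:
  assumes "\<And>x n. norm (f (x, n)) \<le> norm (g (x, n))" "0 < r" "0 < s"
  shows "mixed_modular s r f \<le> mixed_modular s r g"
  unfolding mixed_modular_def using assms by (intro nn_integral_mono ennpowr_mono inner_sum_mono) auto

lemma inner_sum_scale:
  fixes f :: "real \<times> nat \<Rightarrow> 'k::real_normed_field"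
  assumes "0 < r"
  shows "inner_sum r (\<lambda>z. c * f z) x = ennreal (norm c powr r) * inner_sum r f x"
  using assms by (simp add: inner_sum_def norm_mult powr_mult ennreal_mult)

lemma mixed_modular_scale:
  fixes f :: "real \<times> nat \<Rightarrow> 'k::real_normed_field"
  assumes [measurable]: "f \<in> borel_measurable mixed_measure" and rs: "0 < r" "0 < s"
  shows "mixed_modular s r (\<lambda>z. c * f z) = ennreal (norm c powr s) * mixed_modular s r f"
  using rs by (simp add: mixed_modular_def inner_sum_scale ennpowr_mult powr_powr nn_integral_cmult)

lemma mixed_modular_uminus: "mixed_modular s r (\<lambda>z. - f z) = mixed_modular s r f"
  by (simp add: mixed_modular_def inner_sum_def)

lemma mixed_modular_add_le:
  fixes f g :: "real \<times> nat \<Rightarrow> 'k::{real_normed_vector, second_countable_topology}"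
  assumes [measurable]: "f \<in> borel_measurable mixed_measure" "g \<in> borel_measurable mixed_measure"
    and rs: "0 < r" "0 < s"
  shows "mixed_modular s r (\<lambda>z. f z + g z) \<le>
    ennreal (2 powr (s + s / r)) * (mixed_modular s r f + mixed_modular s r g)"
proof -
  have "ennpowr (inner_sum r (\<lambda>z. f z + g z) x) (s / r) \<le>
      ennreal (2 powr (s + s / r)) * (ennpowr (inner_sum r f x) (s / r) + ennpowr (inner_sum r g x) (s / r))" for x
  proof -
    have "inner_sum r (\<lambda>z. f z + g z) x \<le>
        (\<Sum>n. ennreal (2 powr r) * (ennreal (norm (f (x, n)) powr r) + ennreal (norm (g (x, n)) powr r)))"
      unfolding inner_sum_def
    proof (intro suminf_le)
      fix n
      show "ennreal (norm (f (x, n) + g (x, n)) powr r) \<le>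
          ennreal (2 powr r) * (ennreal (norm (f (x, n)) powr r) + ennreal (norm (g (x, n)) powr r))"
        using norm_add_powr_le[OF rs(1), of "f (x, n)" "g (x, n)"]
        by (simp add: ennreal_plus[symmetric] ennreal_mult[symmetric] del: ennreal_plus)
    qed auto
    also have "\<dots> = ennreal (2 powr r) * (inner_sum r f x + inner_sum r g x)"
      by (simp add: inner_sum_def suminf_add[symmetric])
    finally have "ennpowr (inner_sum r (\<lambda>z. f z + g z) x) (s / r) \<le>
        ennpowr (ennreal (2 powr r) * (inner_sum r f x + inner_sum r g x)) (s / r)"
      using rs by (intro ennpowr_mono) auto
    also have "\<dots> = ennreal (2 powr s) * ennpowr (inner_sum r f x + inner_sum r g x) (s / r)"
      using rs by (simp add: ennpowr_mult powr_powr)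
    also have "\<dots> \<le> ennreal (2 powr s) * (ennreal (2 powr (s / r)) *
        (ennpowr (inner_sum r f x) (s / r) + ennpowr (inner_sum r g x) (s / r)))"
      using rs by (intro mult_left_mono ennpowr_add_le) auto
    finally show ?thesis by (simp add: powr_add ennreal_mult mult.assoc)
  qed
  then have "mixed_modular s r (\<lambda>z. f z + g z) \<le>
      (\<integral>\<^sup>+x. ennreal (2 powr (s + s / r)) *
        (ennpowr (inner_sum r f x) (s / r) + ennpowr (inner_sum r g x) (s / r)) \<partial>unit_measure)"
    unfolding mixed_modular_def by (intro nn_integral_mono)
  also have "\<dots> = ennreal (2 powr (s + s / r)) * (mixed_modular s r f + mixed_modular s r g)"
    unfolding mixed_modular_def by (simp add: nn_integral_cmult nn_integral_add)
  finally show ?thesis .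
qed

lemma AE_mixedI:
  assumes "{z \<in> space mixed_measure. P z} \<in> sets mixed_measure" "AE x in unit_measure. \<forall>n. P (x, n)"
  shows "AE z in mixed_measure. P z"
proof -
  interpret N: sigma_finite_measure "count_space (UNIV :: nat set)"
    by (rule sigma_finite_measure_count_space)
  interpret P: pair_sigma_finite unit_measure "count_space (UNIV :: nat set)" ..
  show ?thesis
    using assms unfolding mixed_measure_def
    by (intro P.AE_pair_measure) (simp_all add: AE_count_space)
qed

lemma mixed_modular_eq_0:
  fixes f :: "real \<times> nat \<Rightarrow> 'k::{real_normed_field, second_countable_topology}"
  assumes f [measurable]: "f \<in> borel_measurable mixed_measure" and rs: "0 < r" "0 < s"
    and 0: "mixed_modular s r f = 0"
  shows "AE z in mixed_measure. f z = 0"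
proof (rule AE_mixedI)
  show "{z \<in> space mixed_measure. f z = 0} \<in> sets mixed_measure" by measurable
  have "AE x in unit_measure. ennpowr (inner_sum r f x) (s / r) = 0"
    using 0 unfolding mixed_modular_def by (subst (asm) nn_integral_0_iff_AE) auto
  then show "AE x in unit_measure. \<forall>n. f (x, n) = 0"
  proof eventually_elim
    case (elim x)
    then have "inner_sum r f x = 0" using rs by (simp add: ennpowr_eq_0)
    then have "ennreal (norm (f (x, n)) powr r) \<le> 0" for n
      using term_le_inner_sum[of f x n r] by simp
    then show ?case by (simp add: ennreal_eq_0_iff)
  qed
qed

lemma ae_eq_refl: "f \<in> borel_measurable mixed_measure \<Longrightarrow> ae_eq f f"
  by (simp add: ae_eq_def)

lemma mixed_L0_cases:
  fixes F :: "'k::{real_normed_field, second_countable_topology} mixed_L0"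
  obtains f where "f \<in> borel_measurable mixed_measure" "F = abs_mixed_L0 f"
proof -
  have "\<exists>f. f \<in> borel_measurable mixed_measure \<and> F = abs_mixed_L0 f"
    by (induct F rule: mixed_L0.abs_induct) (auto simp: ae_eq_def)
  then show ?thesis using that by blast
qed

lemma abs_mixed_L0_eq_iff:
  assumes "f \<in> borel_measurable mixed_measure" "g \<in> borel_measurable mixed_measure"
  shows "abs_mixed_L0 f = abs_mixed_L0 g \<longleftrightarrow> (AE z in mixed_measure. f z = g z)"
  using Quotient3_rel[OF Quotient3_mixed_L0, of f g] assms by (auto simp: ae_eq_def)

lemma mixed_enorm_abs:
  assumes "f \<in> borel_measurable mixed_measure"
  shows "mixed_enorm s r (abs_mixed_L0 f) = ennpowr (mixed_modular s r f) (1 / s)"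
  using mixed_enorm.abs_eq[OF ae_eq_refl[OF assms]] by (simp add: mixed_modular_def inner_sum_def)

lemma carrier_Ls_lr:
  assumes "f \<in> borel_measurable mixed_measure"
  shows "abs_mixed_L0 f \<in> carrier (Ls_lr s r) \<longleftrightarrow> mixed_modular s r f < top"
  by (simp add: Ls_lr_def mixed_enorm_abs[OF assms] ennpowr_less_top)

lemma qnorm_Ls_lr:
  assumes "f \<in> borel_measurable mixed_measure"
  shows "qnorm (Ls_lr s r) (abs_mixed_L0 f) = enn2real (mixed_modular s r f) powr (1 / s)"
  by (cases "mixed_modular s r f") (simp_all add: Ls_lr_def mixed_enorm_abs[OF assms] ennpowr_ennreal)

lemma scale_Ls_lr:
  assumes "f \<in> borel_measurable mixed_measure"
  shows "scale (Ls_lr s r) c (abs_mixed_L0 f) = abs_mixed_L0 (\<lambda>z. c * f z)"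
  by (simp add: Ls_lr_def scale_mixed_L0.abs_eq[OF ae_eq_refl[OF assms]])

lemma plus_mixed_L0_abs:
  assumes "f \<in> borel_measurable mixed_measure" "g \<in> borel_measurable mixed_measure"
  shows "abs_mixed_L0 f + abs_mixed_L0 g = abs_mixed_L0 (\<lambda>z. f z + g z)"
  by (rule plus_mixed_L0.abs_eq) (use assms in \<open>auto intro: ae_eq_refl\<close>)

lemma minus_mixed_L0_abs:
  assumes "f \<in> borel_measurable mixed_measure" "g \<in> borel_measurable mixed_measure"
  shows "abs_mixed_L0 f - abs_mixed_L0 g = abs_mixed_L0 (\<lambda>z. f z - g z)"
  by (rule minus_mixed_L0.abs_eq) (use assms in \<open>auto intro: ae_eq_refl\<close>)

lemma sum_mixed_L0_abs:
  assumes "\<And>i. i \<in> I \<Longrightarrow> f i \<in> borel_measurable mixed_measure"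
  shows "(\<Sum>i\<in>I. abs_mixed_L0 (f i)) = abs_mixed_L0 (\<lambda>z. \<Sum>i\<in>I. f i z)"
  using assms
proof (induction I rule: infinite_finite_induct)
  case (insert i I)
  then show ?case by (simp add: plus_mixed_L0_abs)
qed (simp_all add: zero_mixed_L0_def)

lemma enn2real_powr_le:
  assumes "0 < a" "u \<le> v" "v < top"
  shows "enn2real u powr a \<le> enn2real v powr a"
  using assms by (intro powr_mono2 enn2real_mono) auto

lemma quasi_normed_Ls_lr:
  assumes rs: "0 < r" "0 < s"
  shows "quasi_normed (Ls_lr s r :: ('k::{real_normed_field, second_countable_topology}, 'k mixed_L0) qn_space)
    (2 powr ((s + s / r) / s) * 2 powr (1 / s))"
proof
  let ?L = "Ls_lr s r :: ('k, 'k mixed_L0) qn_space"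
  let ?q = "2 powr (s + s / r)"
  show "0 < 2 powr ((s + s / r) / s) * 2 powr (1 / s)" by simp
  have zero: "(0 :: 'k mixed_L0) = abs_mixed_L0 (\<lambda>_. 0)" by (simp add: zero_mixed_L0_def)
  show "0 \<in> carrier ?L" unfolding zero using rs
    by (subst carrier_Ls_lr) (simp_all add: mixed_modular_def inner_sum_def)
  fix x y :: "'k mixed_L0" and c d :: 'k
  obtain f where f [measurable]: "f \<in> borel_measurable mixed_measure" and xf: "x = abs_mixed_L0 f" by (rule mixed_L0_cases)
  obtain g where g [measurable]: "g \<in> borel_measurable mixed_measure" and yg: "y = abs_mixed_L0 g" by (rule mixed_L0_cases)
  have add_le: "mixed_modular s r (\<lambda>z. f z + g z) \<le> ennreal ?q * (mixed_modular s r f + mixed_modular s r g)"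
    using rs by (intro mixed_modular_add_le) auto
  show "scale ?L c (x + y) = scale ?L c x + scale ?L c y"
    by (simp add: xf yg plus_mixed_L0_abs scale_Ls_lr distrib_left)
  show "scale ?L (c + d) x = scale ?L c x + scale ?L d x"
    by (simp add: xf plus_mixed_L0_abs scale_Ls_lr distrib_right)
  show "scale ?L c (scale ?L d x) = scale ?L (c * d) x"
    by (simp add: xf scale_Ls_lr mult.assoc)
  show "scale ?L 1 x = x" by (simp add: xf scale_Ls_lr)
  show "0 \<le> qnorm ?L x" by (simp add: xf qnorm_Ls_lr)
  {
    assume x: "x \<in> carrier ?L"
    then have fin: "mixed_modular s r f < top" by (simp add: xf carrier_Ls_lr)
    show "scale ?L c x \<in> carrier ?L"
      using fin rs by (simp add: xf scale_Ls_lr carrier_Ls_lr mixed_modular_scale ennreal_mult_less_top)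
    show "qnorm ?L (scale ?L c x) = norm c * qnorm ?L x"
      using rs by (simp add: xf scale_Ls_lr qnorm_Ls_lr mixed_modular_scale enn2real_mult powr_mult powr_powr)
    show "x = 0" if "qnorm ?L x = 0"
    proof -
      have "enn2real (mixed_modular s r f) = 0" using that by (simp add: xf qnorm_Ls_lr)
      then have "mixed_modular s r f = 0" using fin by (auto simp: enn2real_eq_0_iff)
      then have "AE z in mixed_measure. f z = 0" using f rs by (intro mixed_modular_eq_0)
      then show ?thesis unfolding xf zero by (subst abs_mixed_L0_eq_iff) auto
    qed
    assume "y \<in> carrier ?L"
    then have fin': "mixed_modular s r g < top" by (simp add: yg carrier_Ls_lr)
    have rhs: "ennreal ?q * (mixed_modular s r f + mixed_modular s r g) < top"
      using fin fin' by (simp add: ennreal_mult_less_top)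
    show "x + y \<in> carrier ?L"
      using add_le rhs by (simp add: xf yg plus_mixed_L0_abs carrier_Ls_lr)
    have "qnorm ?L (x + y) = enn2real (mixed_modular s r (\<lambda>z. f z + g z)) powr (1 / s)"
      by (simp add: xf yg plus_mixed_L0_abs qnorm_Ls_lr)
    also have "\<dots> \<le> enn2real (ennreal ?q * (mixed_modular s r f + mixed_modular s r g)) powr (1 / s)"
      using rs add_le rhs by (intro enn2real_powr_le) auto
    also have "\<dots> = 2 powr ((s + s / r) / s) *
        (enn2real (mixed_modular s r f) + enn2real (mixed_modular s r g)) powr (1 / s)"
      using fin fin' by (simp add: enn2real_mult enn2real_plus powr_mult powr_powr)
    also have "\<dots> \<le> 2 powr ((s + s / r) / s) *
        (2 powr (1 / s) * (enn2real (mixed_modular s r f) powr (1 / s) + enn2real (mixed_modular s r g) powr (1 / s)))"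
      using rs by (intro mult_left_mono add_powr_le_double) auto
    finally show "qnorm ?L (x + y) \<le>
        2 powr ((s + s / r) / s) * 2 powr (1 / s) * (qnorm ?L x + qnorm ?L y)"
      by (simp add: xf yg qnorm_Ls_lr)
  }
qed

lemma convergent_if_geometric_steps:
  fixes g :: "nat \<Rightarrow> 'k::banach"
  assumes "0 \<le> \<rho>" "\<rho> < 1" "\<And>k. norm (g (Suc k) - g k) \<le> B * \<rho> ^ k"
  shows "convergent g"
proof -
  have "summable (\<lambda>k. B * \<rho> ^ k)" using assms by (intro summable_mult summable_geometric) auto
  then have "summable (\<lambda>k. g (Suc k) - g k)"
    by (rule summable_comparison_test[rotated]) (use assms in auto)
  then have "convergent (\<lambda>n. \<Sum>k<n. g (Suc k) - g k)"
    by (simp add: summable_iff_convergent)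
  then have "convergent (\<lambda>n. g n - g 0)" by (simp add: sum_lessThan_telescope)
  then show ?thesis by (simp add: convergent_diff_const_right_iff)
qed

lemma inner_sum_fatou:
  fixes f :: "nat \<Rightarrow> real \<times> nat \<Rightarrow> 'k::real_normed_vector"
  assumes "0 < r" and "\<And>n. (\<lambda>k. f k (x, n)) \<longlonglongrightarrow> h (x, n)"
  shows "inner_sum r h x \<le> liminf (\<lambda>k. inner_sum r (f k) x)"
proof -
  have lim: "(\<lambda>k. ennreal (norm (f k (x, n)) powr r)) \<longlonglongrightarrow> ennreal (norm (h (x, n)) powr r)" for n
    using assms by (intro tendsto_ennrealI tendsto_powr' tendsto_norm tendsto_const) auto
  have "inner_sum r h x = (\<integral>\<^sup>+n. liminf (\<lambda>k. ennreal (norm (f k (x, n)) powr r)) \<partial>count_space UNIV)"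
    unfolding inner_sum_def nn_integral_count_space_nat
    by (intro arg_cong[where f = suminf] ext lim_imp_Liminf[symmetric] lim) simp
  also have "\<dots> \<le> liminf (\<lambda>k. \<integral>\<^sup>+n. ennreal (norm (f k (x, n)) powr r) \<partial>count_space UNIV)"
    by (rule nn_integral_liminf) simp
  finally show ?thesis by (simp add: inner_sum_def nn_integral_count_space_nat)
qed

text \<open>
  Fatou's lemma is applied twice, to the sum over the coordinates and to the integral.
\<close>

lemma mixed_modular_fatou:
  fixes f :: "nat \<Rightarrow> real \<times> nat \<Rightarrow> 'k::real_normed_vector"
  assumes rs: "0 < r" "0 < s" and [measurable]: "\<And>k. f k \<in> borel_measurable mixed_measure"
    and lim: "AE x in unit_measure. \<forall>n. (\<lambda>k. f k (x, n)) \<longlonglongrightarrow> h (x, n)"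
    and le: "\<And>k. m \<le> k \<Longrightarrow> mixed_modular s r (f k) \<le> B"
  shows "mixed_modular s r h \<le> B"
proof -
  have "mixed_modular s r h \<le> (\<integral>\<^sup>+x. liminf (\<lambda>k. ennpowr (inner_sum r (f k) x) (s / r)) \<partial>unit_measure)"
    unfolding mixed_modular_def using lim
    by (intro nn_integral_mono_AE, eventually_elim)
      (use rs in \<open>auto intro!: ennpowr_liminf_le inner_sum_fatou\<close>)
  also have "\<dots> \<le> liminf (\<lambda>k. mixed_modular s r (f k))"
    unfolding mixed_modular_def by (rule nn_integral_liminf) measurable
  also have "\<dots> \<le> limsup (\<lambda>k. mixed_modular s r (f k))" by (rule Liminf_le_Limsup) simp
  also have "\<dots> \<le> B"
    by (rule Limsup_bounded) (use le in \<open>auto simp: eventually_sequentially\<close>)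
  finally show ?thesis .
qed

text \<open>
  The series of the steps, weighted by \<open>2\<^sup>k\<close>, has finite integral, so at almost every point the steps
  decay geometrically in each coordinate.
\<close>

lemma mixed_modular_AE_convergent:
  fixes g :: "nat \<Rightarrow> real \<times> nat \<Rightarrow> 'k::{real_normed_field, second_countable_topology, banach}"
  assumes rs: "0 < r" "0 < s" and [measurable]: "\<And>k. g k \<in> borel_measurable mixed_measure"
    and le: "\<And>k. mixed_modular s r (\<lambda>z. g (Suc k) z - g k z) \<le> ennreal ((1/4) ^ k)"
  shows "AE x in unit_measure. \<forall>n. convergent (\<lambda>k. g k (x, n))"
proof -
  define D where "D k x = ennpowr (inner_sum r (\<lambda>z. g (Suc k) z - g k z) x) (s / r)" for k x
  have [measurable]: "D k \<in> borel_measurable unit_measure" for k unfolding D_def by measurable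
  have "(\<integral>\<^sup>+x. (\<Sum>k. ennreal (2 ^ k) * D k x) \<partial>unit_measure) =
      (\<Sum>k. ennreal (2 ^ k) * mixed_modular s r (\<lambda>z. g (Suc k) z - g k z))"
    unfolding mixed_modular_def D_def[symmetric] by (simp add: nn_integral_suminf nn_integral_cmult)
  also have "\<dots> \<le> (\<Sum>k. ennreal ((1/2) ^ k))"
  proof (intro suminf_le)
    fix k
    have "ennreal (2 ^ k) * mixed_modular s r (\<lambda>z. g (Suc k) z - g k z) \<le> ennreal (2 ^ k) * ennreal ((1/4) ^ k)"
      by (intro mult_left_mono le) auto
    also have "\<dots> = ennreal (2 ^ k * (1/4) ^ k)" by (simp add: ennreal_mult)
    also have "2 ^ k * (1/4) ^ k = (1/2 :: real) ^ k" by (simp add: power_mult_distrib[symmetric])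
    finally show "ennreal (2 ^ k) * mixed_modular s r (\<lambda>z. g (Suc k) z - g k z) \<le> ennreal ((1/2) ^ k)" .
  qed auto
  also have "\<dots> = ennreal (\<Sum>k. (1/2) ^ k)" by (intro suminf_ennreal2 summable_geometric) auto
  also have "\<dots> < top" by simp
  finally have "AE x in unit_measure. (\<Sum>k. ennreal (2 ^ k) * D k x) \<noteq> top"
    by (intro nn_integral_PInf_AE[unfolded infinity_ennreal_def]) auto
  then show ?thesis
  proof eventually_elim
    case (elim x)
    then obtain B where B: "0 \<le> B" "(\<Sum>k. ennreal (2 ^ k) * D k x) = ennreal B"
      by (metis ennreal_cases)
    have Dk: "ennreal (2 ^ k) * D k x \<le> ennreal B" for k
      unfolding B(2)[symmetric] using sum_le_suminf[of "\<lambda>k. ennreal (2 ^ k) * D k x" "{k}"] by simp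
    have "convergent (\<lambda>k. g k (x, n))" for n
    proof (rule convergent_if_geometric_steps)
      fix k
      let ?d = "norm (g (Suc k) (x, n) - g k (x, n))"
      have "ennreal (?d powr r) \<le> inner_sum r (\<lambda>z. g (Suc k) z - g k z) x"
        using term_le_inner_sum[of "\<lambda>z. g (Suc k) z - g k z" x n r] .
      then have "ennpowr (ennreal (?d powr r)) (s / r) \<le> D k x"
        unfolding D_def using rs by (intro ennpowr_mono) auto
      then have "ennreal (?d powr s) \<le> D k x" using rs by (simp add: ennpowr_ennreal powr_powr)
      then have "ennreal (2 ^ k) * ennreal (?d powr s) \<le> ennreal (2 ^ k) * D k x"
        by (intro mult_left_mono) auto
      also have "\<dots> \<le> ennreal B" by (rule Dk)
      finally have "2 ^ k * ?d powr s \<le> B" using B by (simp add: ennreal_mult[symmetric])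
      then have "?d powr s \<le> B * (1/2) ^ k" by (simp add: power_divide field_simps)
      then have "(?d powr s) powr (1 / s) \<le> (B * (1/2) ^ k) powr (1 / s)"
        using rs by (intro powr_mono2) auto
      also have "\<dots> = B powr (1 / s) * ((1/2) powr (1 / s)) ^ k"
        using B rs by (simp add: powr_mult powr_realpow[symmetric] powr_powr mult.commute)
      finally show "?d \<le> B powr (1 / s) * ((1/2) powr (1 / s)) ^ k" using rs by (simp add: powr_powr)
    next
      have "(1/2 :: real) powr (1 / s) < 1 powr (1 / s)" using rs by (intro powr_less_mono2) auto
      then show "(1/2 :: real) powr (1 / s) < 1" by simp
    qed simp
    then show ?case by blast
  qed
qed

text \<open>
  The limit is the limit almost everywhere of a rapidly converging subsequence; the convergence in
  quasi-norm follows from Fatou's lemma.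
\<close>

lemma complete_quasi_normed_Ls_lr:
  assumes rs: "0 < r" "0 < s"
  shows "complete_quasi_normed
    (Ls_lr s r :: ('k::{real_normed_field, second_countable_topology, banach}, 'k mixed_L0) qn_space)
    (2 powr ((s + s / r) / s) * 2 powr (1 / s))"
proof -
  let ?L = "Ls_lr s r :: ('k, 'k mixed_L0) qn_space"
  interpret quasi_normed ?L "2 powr ((s + s / r) / s) * 2 powr (1 / s)"
    by (rule quasi_normed_Ls_lr[OF rs])
  show ?thesis
  proof
    fix F :: "nat \<Rightarrow> 'k mixed_L0" assume F: "Cauchy_seq F"
    have "\<forall>n. \<exists>f. f \<in> borel_measurable mixed_measure \<and> F n = abs_mixed_L0 f"
      using mixed_L0_cases by metis
    then obtain f where f [measurable]: "\<And>n. f n \<in> borel_measurable mixed_measure"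
      and Ff: "\<And>n. F n = abs_mixed_L0 (f n)" by metis
    have Fc: "F n \<in> carrier ?L" for n using F by (simp add: Cauchy_seq_def)
    have fin: "mixed_modular s r (f n) < top" for n using Fc[of n] by (simp add: Ff carrier_Ls_lr f)
    have cau: "\<exists>N. \<forall>m\<ge>N. \<forall>n\<ge>N. mixed_modular s r (\<lambda>z. f m z - f n z) \<le> ennreal e" if e: "e > 0" for e
    proof -
      have "e powr (1 / s) > 0" using e by simp
      then obtain N where N: "\<forall>m\<ge>N. \<forall>n\<ge>N. qnorm ?L (F m - F n) < e powr (1 / s)"
        using F unfolding Cauchy_seq_def by blast
      have "mixed_modular s r (\<lambda>z. f m z - f n z) \<le> ennreal e" if mn: "m \<ge> N" "n \<ge> N" for m n
      proof -
        have "F m - F n \<in> carrier ?L" using Fc by simp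
        then have fin: "mixed_modular s r (\<lambda>z. f m z - f n z) < top"
          by (simp add: Ff minus_mixed_L0_abs f carrier_Ls_lr)
        then obtain t where t: "0 \<le> t" "mixed_modular s r (\<lambda>z. f m z - f n z) = ennreal t"
          by (metis ennreal_cases less_irrefl)
        have "t powr (1 / s) < e powr (1 / s)"
          using N[rule_format, OF mn] t by (simp add: Ff minus_mixed_L0_abs f qnorm_Ls_lr)
        then have "t \<le> e" using rs t e powr_mono2[of "1 / s" e t] by (meson less_imp_le not_le zero_less_divide_1_iff)
        then show ?thesis by (simp add: t ennreal_leI)
      qed
      then show ?thesis by blast
    qed
    have "\<exists>\<sigma>. \<forall>k. (\<forall>m\<ge>\<sigma> k. \<forall>n\<ge>\<sigma> k. mixed_modular s r (\<lambda>z. f m z - f n z) \<le> ennreal ((1/4) ^ k)) \<and> \<sigma> k < \<sigma> (Suc k)"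
    proof (rule dependent_nat_choice)
      show "\<exists>N. \<forall>m\<ge>N. \<forall>n\<ge>N. mixed_modular s r (\<lambda>z. f m z - f n z) \<le> ennreal ((1/4) ^ 0)"
        by (rule cau) simp
      fix N0 k
      obtain N where "\<forall>m\<ge>N. \<forall>n\<ge>N. mixed_modular s r (\<lambda>z. f m z - f n z) \<le> ennreal ((1/4) ^ Suc k)"
        using cau[of "(1/4) ^ Suc k"] by auto
      then show "\<exists>N. (\<forall>m\<ge>N. \<forall>n\<ge>N. mixed_modular s r (\<lambda>z. f m z - f n z) \<le> ennreal ((1/4) ^ Suc k)) \<and> N0 < N"
        by (intro exI[of _ "max N (Suc N0)"]) auto
    qed
    then obtain \<sigma> where \<sigma>: "\<And>k m n. m \<ge> \<sigma> k \<Longrightarrow> n \<ge> \<sigma> k \<Longrightarrow>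
        mixed_modular s r (\<lambda>z. f m z - f n z) \<le> ennreal ((1/4) ^ k)" and mono: "\<And>k. \<sigma> k < \<sigma> (Suc k)" by blast
    have smono: "strict_mono \<sigma>" using mono by (simp add: strict_mono_Suc_iff)
    define h where "h z = lim (\<lambda>k. f (\<sigma> k) z)" for z
    have h [measurable]: "h \<in> borel_measurable mixed_measure" unfolding h_def by measurable
    have "AE x in unit_measure. \<forall>n. convergent (\<lambda>k. f (\<sigma> k) (x, n))"
      using mono less_imp_le by (intro mixed_modular_AE_convergent[OF rs] f \<sigma>) auto
    then have lim: "AE x in unit_measure. \<forall>n. (\<lambda>k. f (\<sigma> k) (x, n)) \<longlonglongrightarrow> h (x, n)"
      by eventually_elim (simp add: h_def convergent_LIMSEQ_iff)
    have tail: "\<exists>N. \<forall>m\<ge>N. mixed_modular s r (\<lambda>z. f m z - h z) \<le> ennreal e" if e: "e > 0" for e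
    proof -
      obtain N where N: "\<And>m n. m \<ge> N \<Longrightarrow> n \<ge> N \<Longrightarrow> mixed_modular s r (\<lambda>z. f m z - f n z) \<le> ennreal e"
        using cau[OF e] by blast
      have "mixed_modular s r (\<lambda>z. f m z - h z) \<le> ennreal e" if m: "m \<ge> N" for m
      proof (rule mixed_modular_fatou[OF rs, where f = "\<lambda>k z. f m z - f (\<sigma> k) z" and m = N])
        show "AE x in unit_measure. \<forall>n. (\<lambda>k. f m (x, n) - f (\<sigma> k) (x, n)) \<longlonglongrightarrow> f m (x, n) - h (x, n)"
          using lim by eventually_elim (auto intro!: tendsto_intros)
        fix k assume "N \<le> k"
        then have "N \<le> \<sigma> k" using strict_mono_imp_increasing[OF smono, of k] by simp
        then show "mixed_modular s r (\<lambda>z. f m z - f (\<sigma> k) z) \<le> ennreal e" by (rule N[OF m])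
      qed measurable
      then show ?thesis by blast
    qed
    have diff: "F m - abs_mixed_L0 h = abs_mixed_L0 (\<lambda>z. f m z - h z)" for m
      by (simp add: Ff minus_mixed_L0_abs f h)
    obtain N where "mixed_modular s r (\<lambda>z. f N z - h z) \<le> ennreal 1" using tail[of 1] by auto
    then have "F N - abs_mixed_L0 h \<in> carrier ?L"
      unfolding diff by (subst carrier_Ls_lr) (auto simp: less_top[symmetric] top_unique)
    then have "F N - (F N - abs_mixed_L0 h) \<in> carrier ?L" using Fc minus_closed by blast
    then have hc: "abs_mixed_L0 h \<in> carrier ?L" by simp
    have "(\<lambda>n. qnorm ?L (F n - abs_mixed_L0 h)) \<longlonglongrightarrow> 0"
    proof (rule LIMSEQ_I)
      fix e :: real assume e: "e > 0"
      obtain N where N: "\<And>m. m \<ge> N \<Longrightarrow> mixed_modular s r (\<lambda>z. f m z - h z) \<le> ennreal ((e / 2) powr s)"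
        using tail[of "(e / 2) powr s"] e by auto
      have "norm (qnorm ?L (F n - abs_mixed_L0 h) - 0) < e" if n: "n \<ge> N" for n
      proof -
        have "qnorm ?L (F n - abs_mixed_L0 h) = enn2real (mixed_modular s r (\<lambda>z. f n z - h z)) powr (1 / s)"
          unfolding diff by (subst qnorm_Ls_lr) auto
        also have "\<dots> \<le> enn2real (ennreal ((e / 2) powr s)) powr (1 / s)"
          using rs N[OF n] by (intro enn2real_powr_le) auto
        also have "\<dots> = e / 2" using rs e by (simp add: powr_powr)
        finally show ?thesis using e qnorm_nonneg[OF minus_closed[OF Fc hc], of n] by simp
      qed
      then show "\<exists>N. \<forall>n\<ge>N. norm (qnorm ?L (F n - abs_mixed_L0 h) - 0) < e" by blast
    qed
    then show "\<exists>l. convergent_to F l" using hc unfolding convergent_to_def by blast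
  qed
qed

section \<open>Restriction to blocks of coordinates\<close>

lemma positive_sums_growth_unit:
  fixes h :: "nat \<Rightarrow> real \<Rightarrow> real"
  assumes q: "0 < q" and c: "0 < c" and C: "0 \<le> C"
    and meas [measurable]: "\<And>i. h i \<in> borel_measurable unit_measure"
    and nonneg: "\<And>i x. 0 \<le> h i x"
    and lower: "\<And>S. finite S \<Longrightarrow> S \<noteq> {} \<Longrightarrow>
        ennreal (c * real (card S) powr \<beta>) \<le> (\<integral>\<^sup>+x. ennreal ((\<Sum>i\<in>S. h i x) powr q) \<partial>unit_measure)"
    and upper: "\<And>S. finite S \<Longrightarrow> S \<noteq> {} \<Longrightarrow>
        (\<integral>\<^sup>+x. ennreal ((\<Sum>i\<in>S. h i x) powr q) \<partial>unit_measure) \<le> ennreal (C * real (card S) powr \<beta>)"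
  shows "if q \<le> 1 then q \<le> \<beta> \<and> \<beta> \<le> 1 else \<beta> = 1 \<or> \<beta> = q"
proof -
  have int: "integrable unit_measure (\<lambda>x. (\<Sum>i\<in>S. h i x) powr q)" if "finite S" for S
  proof (cases "S = {}")
    case False
    have "(\<integral>\<^sup>+x. ennreal ((\<Sum>i\<in>S. h i x) powr q) \<partial>unit_measure) < top"
      using upper[OF that False] by (simp add: order_le_less_trans)
    then show ?thesis by (intro integrableI_nonneg) auto
  qed simp
  have eq: "(\<integral>\<^sup>+x. ennreal ((\<Sum>i\<in>S. h i x) powr q) \<partial>unit_measure) =
      ennreal (\<integral>x. (\<Sum>i\<in>S. h i x) powr q \<partial>unit_measure)" if "finite S" for S
    by (rule nn_integral_eq_integral[OF int[OF that]]) auto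
  show ?thesis
  proof (rule unit.positive_sums_growth[OF q c meas nonneg int])
    fix S :: "nat set" assume S: "finite S" "S \<noteq> {}"
    show "c * real (card S) powr \<beta> \<le> (\<integral>x. (\<Sum>i\<in>S. h i x) powr q \<partial>unit_measure)"
      using lower[OF S] unfolding eq[OF S(1)] by (simp add: ennreal_le_iff)
    show "(\<integral>x. (\<Sum>i\<in>S. h i x) powr q \<partial>unit_measure) \<le> C * real (card S) powr \<beta>"
      using upper[OF S] C unfolding eq[OF S(1)] by (simp add: ennreal_le_iff)
  qed
qed

definition restrict_coords :: "nat set \<Rightarrow> (real \<times> nat \<Rightarrow> 'k::zero) \<Rightarrow> real \<times> nat \<Rightarrow> 'k" where
  "restrict_coords J f z = (if snd z \<in> J then f z else 0)"

lemma measurable_restrict_coords [measurable]: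
  fixes f :: "real \<times> nat \<Rightarrow> 'k::real_normed_vector"
  assumes [measurable]: "f \<in> borel_measurable mixed_measure"
  shows "restrict_coords J f \<in> borel_measurable mixed_measure"
proof -
  have "snd \<in> mixed_measure \<rightarrow>\<^sub>M count_space UNIV" unfolding mixed_measure_def by measurable
  then have [measurable]: "Measurable.pred mixed_measure (\<lambda>z. snd z \<in> J)"
    by (rule measurable_compose) simp
  show ?thesis unfolding restrict_coords_def[abs_def] by measurable
qed

lemma mixed_modular_restrict_le:
  "0 < r \<Longrightarrow> 0 < s \<Longrightarrow> mixed_modular s r (restrict_coords J f) \<le> mixed_modular s r f"
  by (rule mixed_modular_mono) (auto simp: restrict_coords_def)

lemma mixed_modular_cong_AE:
  assumes "AE x in unit_measure. \<forall>n. f (x, n) = g (x, n)"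
  shows "mixed_modular s r f = mixed_modular s r g"
  unfolding mixed_modular_def
  by (rule nn_integral_cong_AE, rule eventually_mono[OF assms]) (simp add: inner_sum_def)

lemma abs_mixed_L0_eq_sections:
  assumes "f \<in> borel_measurable mixed_measure" "g \<in> borel_measurable mixed_measure"
    "abs_mixed_L0 f = abs_mixed_L0 g"
  shows "AE x in unit_measure. \<forall>n. f (x, n) = g (x, n)"
  using assms abs_mixed_L0_eq_iff[OF assms(1,2)] by (intro ae_eq_sections) (simp add: ae_eq_def)

lemma mixed_modular_restrict_cong:
  assumes "f \<in> borel_measurable mixed_measure" "g \<in> borel_measurable mixed_measure"
    "abs_mixed_L0 f = abs_mixed_L0 g"
  shows "mixed_modular s r (restrict_coords J f) = mixed_modular s r (restrict_coords J g)"
    "mixed_modular s r f = mixed_modular s r g"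
  using abs_mixed_L0_eq_sections[OF assms]
  by (auto intro!: mixed_modular_cong_AE elim!: eventually_mono simp: restrict_coords_def)

lemma inner_sum_restrict_finite:
  assumes "finite J" "0 < r"
  shows "inner_sum r (restrict_coords J f) x = ennreal (\<Sum>n\<in>J. norm (f (x, n)) powr r)"
proof -
  have "inner_sum r (restrict_coords J f) x = (\<Sum>n\<in>J. ennreal (norm (restrict_coords J f (x, n)) powr r))"
    unfolding inner_sum_def using assms by (intro suminf_finite) (auto simp: restrict_coords_def)
  also have "\<dots> = (\<Sum>n\<in>J. ennreal (norm (f (x, n)) powr r))"
    by (intro sum.cong) (auto simp: restrict_coords_def)
  finally show ?thesis by (simp add: sum_ennreal)
qed

text \<open>
  Dominated convergence: at almost every point the inner sum is a convergent series, and its tails tend to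
  zero.
\<close>

lemma mixed_modular_tail:
  fixes f :: "real \<times> nat \<Rightarrow> 'k::real_normed_vector"
  assumes f [measurable]: "f \<in> borel_measurable mixed_measure" and rs: "0 < r" "0 < s"
    and fin: "mixed_modular s r f < top"
  shows "(\<lambda>N. mixed_modular s r (restrict_coords {N..} f)) \<longlonglongrightarrow> 0"
proof -
  have "AE x in unit_measure. ennpowr (inner_sum r f x) (s / r) \<noteq> top"
    using fin unfolding mixed_modular_def
    by (intro nn_integral_PInf_AE[unfolded infinity_ennreal_def]) auto
  then have lim: "AE x in unit_measure.
      (\<lambda>N. ennpowr (inner_sum r (restrict_coords {N..} f) x) (s / r)) \<longlonglongrightarrow> 0"
  proof eventually_elim
    case (elim x)
    define a where "a n = norm (f (x, n)) powr r" for n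
    have a_nonneg: "0 \<le> a n" for n by (simp add: a_def)
    have "inner_sum r f x \<noteq> top" using elim by auto
    then have sa: "summable a"
      unfolding inner_sum_def a_def by (intro summable_suminf_not_top) auto
    have tail: "inner_sum r (restrict_coords {N..} f) x = ennreal (\<Sum>n. a (n + N))" for N
    proof -
      have sN: "summable (\<lambda>n. a (n + N))" using sa by (simp add: summable_iff_shift)
      define b where "b n = norm (restrict_coords {N..} f (x, n)) powr r" for n
      have b: "b = (\<lambda>n. if n < N then 0 else a n)"
        using rs by (auto simp: b_def a_def restrict_coords_def fun_eq_iff)
      have bs: "(\<lambda>n. b (n + N)) sums (\<Sum>n. a (n + N))" using sN by (simp add: b summable_sums)
      then have "b sums (\<Sum>n. a (n + N))"
        by (subst (asm) sums_iff_shift) (simp add: b)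
      then have "(\<Sum>n. ennreal (b n)) = ennreal (\<Sum>n. a (n + N))"
        by (rule suminf_ennreal_eq[rotated]) (simp add: b_def)
      then show ?thesis by (simp add: inner_sum_def b_def)
    qed
    have "(\<lambda>N. \<Sum>n. a (n + N)) \<longlonglongrightarrow> 0"
    proof -
      have "(\<lambda>N. (\<Sum>n. a n) - (\<Sum>n<N. a n)) \<longlonglongrightarrow> (\<Sum>n. a n) - (\<Sum>n. a n)"
        by (intro tendsto_intros summable_LIMSEQ sa)
      then show ?thesis by (simp add: suminf_minus_initial_segment[OF sa])
    qed
    then have "(\<lambda>N. ennreal ((\<Sum>n. a (n + N)) powr (s / r))) \<longlonglongrightarrow> ennreal (0 powr (s / r))"
      using rs sa by (intro tendsto_ennrealI tendsto_powr' tendsto_const)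
        (auto intro!: always_eventually suminf_nonneg simp: summable_iff_shift a_nonneg)
    moreover have "0 \<le> (\<Sum>n. a (n + N))" for N
      using sa by (intro suminf_nonneg) (auto simp: summable_iff_shift a_nonneg)
    ultimately show ?case by (simp add: tail ennpowr_ennreal)
  qed
  have "(\<lambda>N. mixed_modular s r (restrict_coords {N..} f)) \<longlonglongrightarrow> (\<integral>\<^sup>+x. 0 \<partial>unit_measure)"
    unfolding mixed_modular_def
  proof (rule nn_integral_dominated_convergence[where w = "\<lambda>x. ennpowr (inner_sum r f x) (s / r)"])
    show "AE x in unit_measure. ennpowr (inner_sum r (restrict_coords {N..} f) x) (s / r) \<le>
        ennpowr (inner_sum r f x) (s / r)" for N
      using rs by (intro always_eventually allI ennpowr_mono inner_sum_mono) (auto simp: restrict_coords_def)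
    show "(\<integral>\<^sup>+x. ennpowr (inner_sum r f x) (s / r) \<partial>unit_measure) < \<infinity>"
      using fin unfolding mixed_modular_def by simp
  qed (use lim in auto)
  then show ?thesis by simp
qed

text \<open>
  The first summand is split off repeatedly, so the later summands carry higher powers of the constant of
  the triangle inequality. This is harmless for errors that may be prescribed in advance.
\<close>

lemma mixed_modular_sum_le:
  fixes d :: "nat \<Rightarrow> real \<times> nat \<Rightarrow> 'k::{real_normed_vector, second_countable_topology}"
  assumes rs: "0 < r" "0 < s" and [measurable]: "\<And>k. d k \<in> borel_measurable mixed_measure"
  shows "mixed_modular s r (\<lambda>z. \<Sum>k\<in>{m..<m + n}. d k z) \<le>
    (\<Sum>k\<in>{m..<m + n}. ennreal (2 powr (s + s / r)) ^ (k - m + 1) * mixed_modular s r (d k))"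
proof (induction n arbitrary: m)
  case 0
  then show ?case by (simp add: mixed_modular_def inner_sum_def)
next
  case (Suc n)
  let ?q = "ennreal (2 powr (s + s / r))"
  have split: "(\<Sum>k\<in>{m..<m + Suc n}. f k) = f m + (\<Sum>k\<in>{Suc m..<Suc m + n}. f k)"
    for f :: "nat \<Rightarrow> 'b::comm_monoid_add"
  proof -
    have "{m..<m + Suc n} = insert m {Suc m..<Suc m + n}" by auto
    then show ?thesis by simp
  qed
  have "mixed_modular s r (\<lambda>z. \<Sum>k\<in>{m..<m + Suc n}. d k z) \<le>
      ?q * (mixed_modular s r (d m) + mixed_modular s r (\<lambda>z. \<Sum>k\<in>{Suc m..<Suc m + n}. d k z))"
    unfolding split using rs by (intro mixed_modular_add_le) auto
  also have "\<dots> \<le> ?q * (mixed_modular s r (d m) +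
      (\<Sum>k\<in>{Suc m..<Suc m + n}. ?q ^ (k - Suc m + 1) * mixed_modular s r (d k)))"
    by (intro mult_left_mono add_left_mono Suc.IH) auto
  also have "\<dots> = ?q ^ (m - m + 1) * mixed_modular s r (d m) +
      (\<Sum>k\<in>{Suc m..<Suc m + n}. ?q ^ (k - m + 1) * mixed_modular s r (d k))"
  proof -
    have "?q * (?q ^ (k - Suc m + 1) * w) = ?q ^ (k - m + 1) * w" if "Suc m \<le> k" for k w
    proof -
      have "k - m + 1 = Suc (k - Suc m + 1)" using that by simp
      then show ?thesis by (simp only: power_Suc mult.assoc)
    qed
    then have "?q * (\<Sum>k\<in>{Suc m..<Suc m + n}. ?q ^ (k - Suc m + 1) * mixed_modular s r (d k)) =
        (\<Sum>k\<in>{Suc m..<Suc m + n}. ?q ^ (k - m + 1) * mixed_modular s r (d k))"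
      unfolding sum_distrib_left by (intro sum.cong) auto
    then show ?thesis by (simp only: distrib_left) simp
  qed
  also have "\<dots> = (\<Sum>k\<in>{m..<m + Suc n}. ?q ^ (k - m + 1) * mixed_modular s r (d k))"
    by (rule split[symmetric])
  finally show ?case .
qed

text \<open>
  The bounds hold for all signs, hence for the mean over the signs. For the mean, Khinchine's inequality at
  each point \<open>x\<close> turns the modular into the integral of a power of a sum of nonnegative functions.
\<close>

lemma finite_coordinates_growth:
  fixes f :: "nat \<Rightarrow> real \<times> nat \<Rightarrow> 'k::{real_normed_field, euclidean_space}"
  assumes rs: "0 < r" "0 < s" and c: "0 < c" and C: "0 \<le> C"
    and f [measurable]: "\<And>i. f i \<in> borel_measurable mixed_measure"
    and lower: "\<And>S A. finite S \<Longrightarrow> S \<noteq> {} \<Longrightarrow> ennreal (c * real (card S) powr \<beta>) \<le>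
        mixed_modular s r (restrict_coords {..<N} (\<lambda>z. signed_sum S A (\<lambda>i. f i z)))"
    and upper: "\<And>S A. finite S \<Longrightarrow> S \<noteq> {} \<Longrightarrow>
        mixed_modular s r (restrict_coords {..<N} (\<lambda>z. signed_sum S A (\<lambda>i. f i z))) \<le>
        ennreal (C * real (card S) powr \<beta>)"
  shows "if s \<le> 2 then s / 2 \<le> \<beta> \<and> \<beta> \<le> 1 else \<beta> = 1 \<or> \<beta> = s / 2"
proof -
  obtain a b where ab: "a > 0" "b > 0"
    and kh_low: "\<And>(S::nat set) (z :: nat \<Rightarrow> nat \<Rightarrow> 'k). finite S \<Longrightarrow>
      a * (\<Sum>i\<in>S. \<Sum>n\<in>{..<N}. (norm (z i n))\<^sup>2) powr (s / 2) \<le>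
      (\<Sum>A\<in>Pow S. (\<Sum>n\<in>{..<N}. norm (signed_sum S A (\<lambda>i. z i n)) powr r) powr (s / r)) / 2 ^ card S"
    and kh_up: "\<And>(S::nat set) (z :: nat \<Rightarrow> nat \<Rightarrow> 'k). finite S \<Longrightarrow>
      (\<Sum>A\<in>Pow S. (\<Sum>n\<in>{..<N}. norm (signed_sum S A (\<lambda>i. z i n)) powr r) powr (s / r)) / 2 ^ card S \<le>
      b * (\<Sum>i\<in>S. \<Sum>n\<in>{..<N}. (norm (z i n))\<^sup>2) powr (s / 2)"
    using khinchine_tuple[of "{..<N}" r s] rs by blast
  define h where "h i x = (\<Sum>n<N. (norm (f i (x, n)))\<^sup>2)" for i x
  have hm [measurable]: "h i \<in> borel_measurable unit_measure" for i unfolding h_def by measurable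
  define G where "G S A x = (\<Sum>n<N. norm (signed_sum S A (\<lambda>i. f i (x, n))) powr r) powr (s / r)" for S A x
  have Gm [measurable]: "G S A \<in> borel_measurable unit_measure" for S A
    unfolding G_def signed_sum_def if_distrib[symmetric] by measurable
  have G: "mixed_modular s r (restrict_coords {..<N} (\<lambda>z. signed_sum S A (\<lambda>i. f i z))) =
      (\<integral>\<^sup>+x. ennreal (G S A x) \<partial>unit_measure)" for S A
    using rs by (simp add: mixed_modular_def inner_sum_restrict_finite ennpowr_ennreal sum_nonneg G_def)
  define V where "V S = (\<integral>\<^sup>+x. ennreal ((\<Sum>i\<in>S. h i x) powr (s / 2)) \<partial>unit_measure)" for S
  define E where "E S = (\<integral>\<^sup>+x. ennreal ((\<Sum>A\<in>Pow S. G S A x) / 2 ^ card S) \<partial>unit_measure)" for S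
  have E: "E S = ennreal (1 / 2 ^ card S) * (\<Sum>A\<in>Pow S. \<integral>\<^sup>+x. ennreal (G S A x) \<partial>unit_measure)" for S
  proof -
    have "E S = (\<integral>\<^sup>+x. ennreal (1 / 2 ^ card S) * (\<Sum>A\<in>Pow S. ennreal (G S A x)) \<partial>unit_measure)"
      unfolding E_def
    proof (rule nn_integral_cong)
      fix x
      have "ennreal ((\<Sum>A\<in>Pow S. G S A x) / 2 ^ card S) = ennreal (1 / 2 ^ card S * (\<Sum>A\<in>Pow S. G S A x))" by simp
      also have "\<dots> = ennreal (1 / 2 ^ card S) * ennreal (\<Sum>A\<in>Pow S. G S A x)"
        by (rule ennreal_mult) (auto simp: G_def intro!: sum_nonneg)
      also have "ennreal (\<Sum>A\<in>Pow S. G S A x) = (\<Sum>A\<in>Pow S. ennreal (G S A x))"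
        by (rule sum_ennreal[symmetric]) (simp add: G_def)
      finally show "ennreal ((\<Sum>A\<in>Pow S. G S A x) / 2 ^ card S) =
          ennreal (1 / 2 ^ card S) * (\<Sum>A\<in>Pow S. ennreal (G S A x))" .
    qed
    then show ?thesis by (simp add: nn_integral_cmult nn_integral_sum)
  qed
  have avg: "ennreal (1 / 2 ^ card S) * (\<Sum>A\<in>Pow S. t) = t" if "finite S" for S :: "nat set" and t :: ennreal
  proof -
    have "ennreal (1 / 2 ^ card S) * (\<Sum>A\<in>Pow S. t) = (ennreal (1 / 2 ^ card S) * ennreal (2 ^ card S)) * t"
      using that by (simp add: card_Pow mult.assoc ennreal_power[symmetric])
    also have "ennreal (1 / 2 ^ card S) * ennreal (2 ^ card S) = 1"
      by (subst ennreal_mult[symmetric]) auto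
    finally show ?thesis by simp
  qed
  have E_low: "ennreal (c * real (card S) powr \<beta>) \<le> E S" if S: "finite S" "S \<noteq> {}" for S
  proof -
    have "ennreal (c * real (card S) powr \<beta>) = ennreal (1 / 2 ^ card S) * (\<Sum>A\<in>Pow S. ennreal (c * real (card S) powr \<beta>))"
      by (rule avg[OF S(1), symmetric])
    also have "\<dots> \<le> E S" unfolding E using lower[OF S] by (intro mult_left_mono sum_mono) (auto simp: G)
    finally show ?thesis .
  qed
  have E_up: "E S \<le> ennreal (C * real (card S) powr \<beta>)" if S: "finite S" "S \<noteq> {}" for S
  proof -
    have "E S \<le> ennreal (1 / 2 ^ card S) * (\<Sum>A\<in>Pow S. ennreal (C * real (card S) powr \<beta>))"
      unfolding E using upper[OF S] by (intro mult_left_mono sum_mono) (auto simp: G)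
    also have "\<dots> = ennreal (C * real (card S) powr \<beta>)" by (rule avg[OF S(1)])
    finally show ?thesis .
  qed
  have EV: "ennreal a * V S \<le> E S" "E S \<le> ennreal b * V S" if S: "finite S" for S
  proof -
    have "ennreal a * V S = (\<integral>\<^sup>+x. ennreal (a * (\<Sum>i\<in>S. h i x) powr (s / 2)) \<partial>unit_measure)"
      unfolding V_def using ab by (simp add: ennreal_mult nn_integral_cmult)
    also have "\<dots> \<le> E S"
      unfolding E_def h_def G_def using kh_low[OF S, of "\<lambda>i n. f i (_, n)"] by (intro nn_integral_mono ennreal_leI) auto
    finally show "ennreal a * V S \<le> E S" .
    have "E S \<le> (\<integral>\<^sup>+x. ennreal (b * (\<Sum>i\<in>S. h i x) powr (s / 2)) \<partial>unit_measure)"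
      unfolding E_def h_def G_def using kh_up[OF S, of "\<lambda>i n. f i (_, n)"] by (intro nn_integral_mono ennreal_leI) auto
    also have "\<dots> = ennreal b * V S"
      unfolding V_def using ab by (simp add: ennreal_mult nn_integral_cmult)
    finally show "E S \<le> ennreal b * V S" .
  qed
  have inv: "ennreal (1 / t) * (ennreal t * v) = v" if "t > 0" for t v
    using that by (simp add: mult.assoc[symmetric] ennreal_mult[symmetric])
  have "if s / 2 \<le> 1 then s / 2 \<le> \<beta> \<and> \<beta> \<le> 1 else \<beta> = 1 \<or> \<beta> = s / 2"
  proof (rule positive_sums_growth_unit[where h = h and c = "c / b" and C = "C / a"])
    fix S :: "nat set" assume S: "finite S" "S \<noteq> {}"
    have "ennreal (c / b * real (card S) powr \<beta>) = ennreal (1 / b) * ennreal (c * real (card S) powr \<beta>)"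
      using ab c by (subst ennreal_mult[symmetric]) auto
    also have "\<dots> \<le> ennreal (1 / b) * (ennreal b * V S)"
      using order.trans[OF E_low[OF S] EV(2)[OF S(1)]] by (intro mult_left_mono) auto
    also have "\<dots> = V S" by (rule inv[OF ab(2)])
    finally show "ennreal (c / b * real (card S) powr \<beta>) \<le>
        (\<integral>\<^sup>+x. ennreal ((\<Sum>i\<in>S. h i x) powr (s / 2)) \<partial>unit_measure)" by (simp add: V_def)
    have "V S = ennreal (1 / a) * (ennreal a * V S)" using ab by (simp add: inv)
    also have "\<dots> \<le> ennreal (1 / a) * ennreal (C * real (card S) powr \<beta>)"
      using order.trans[OF EV(1)[OF S(1)] E_up[OF S]] by (intro mult_left_mono) auto
    also have "\<dots> = ennreal (C / a * real (card S) powr \<beta>)"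
      using ab C by (subst ennreal_mult[symmetric]) auto
    finally show "(\<integral>\<^sup>+x. ennreal ((\<Sum>i\<in>S. h i x) powr (s / 2)) \<partial>unit_measure) \<le>
        ennreal (C / a * real (card S) powr \<beta>)" by (simp add: V_def)
  qed (use rs ab c C in \<open>auto simp: h_def intro!: sum_nonneg\<close>)
  then show ?thesis by simp
qed

text \<open>
  The functions live on disjoint sets of coordinates, so inner sums add up.
\<close>

lemma disjoint_coordinates_growth:
  fixes f :: "nat \<Rightarrow> real \<times> nat \<Rightarrow> 'k::{real_normed_field, second_countable_topology}"
  assumes rs: "0 < r" "r < s" and c: "0 < c" and C: "0 \<le> C"
    and f [measurable]: "\<And>i. f i \<in> borel_measurable mixed_measure"
    and J: "\<And>k. finite (J k)" "disjoint_family J"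
    and lower: "\<And>S. finite S \<Longrightarrow> S \<noteq> {} \<Longrightarrow> ennreal (c * real (card S) powr \<beta>) \<le>
        mixed_modular s r (\<lambda>z. \<Sum>k\<in>S. restrict_coords (J k) (f k) z)"
    and upper: "\<And>S. finite S \<Longrightarrow> S \<noteq> {} \<Longrightarrow>
        mixed_modular s r (\<lambda>z. \<Sum>k\<in>S. restrict_coords (J k) (f k) z) \<le>
        ennreal (C * real (card S) powr \<beta>)"
  shows "\<beta> = 1 \<or> \<beta> = s / r"
proof -
  define h where "h k x = (\<Sum>n\<in>J k. norm (f k (x, n)) powr r)" for k x
  have hm [measurable]: "h k \<in> borel_measurable unit_measure" for k unfolding h_def by measurable
  have h0: "0 \<le> h k x" for k x by (auto simp: h_def intro: sum_nonneg)
  have inner: "inner_sum r (\<lambda>z. \<Sum>k\<in>S. restrict_coords (J k) (f k) z) x = ennreal (\<Sum>k\<in>S. h k x)"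
    if S: "finite S" for S x
  proof -
    have pt: "norm (\<Sum>k\<in>S. restrict_coords (J k) (f k) (x, n)) powr r =
        (\<Sum>k\<in>S. norm (restrict_coords (J k) (f k) (x, n)) powr r)" for n
    proof (cases "\<exists>k\<in>S. n \<in> J k")
      case True
      then obtain k where k: "k \<in> S" "n \<in> J k" by blast
      have z: "restrict_coords (J l) (f l) (x, n) = 0" if "l \<in> S - {k}" for l
        using that k J(2) by (auto simp: restrict_coords_def disjoint_family_on_def)
      show ?thesis using S k(1) z by (simp add: sum.remove)
    next
      case False
      then have "restrict_coords (J k) (f k) (x, n) = 0" if "k \<in> S" for k
        using that by (auto simp: restrict_coords_def)
      then show ?thesis by simp
    qed
    have "inner_sum r (\<lambda>z. \<Sum>k\<in>S. restrict_coords (J k) (f k) z) x =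
        (\<Sum>n. \<Sum>k\<in>S. ennreal (norm (restrict_coords (J k) (f k) (x, n)) powr r))"
      unfolding inner_sum_def pt by (simp add: sum_ennreal)
    also have "\<dots> = (\<Sum>k\<in>S. inner_sum r (restrict_coords (J k) (f k)) x)"
      unfolding inner_sum_def by (rule suminf_sum) simp
    also have "\<dots> = ennreal (\<Sum>k\<in>S. h k x)"
      using rs J h0 by (simp add: inner_sum_restrict_finite h_def[symmetric] sum_ennreal)
    finally show ?thesis .
  qed
  have mm: "mixed_modular s r (\<lambda>z. \<Sum>k\<in>S. restrict_coords (J k) (f k) z) =
      (\<integral>\<^sup>+x. ennreal ((\<Sum>k\<in>S. h k x) powr (s / r)) \<partial>unit_measure)" if "finite S" for S
    unfolding mixed_modular_def using h0 by (simp add: inner[OF that] ennpowr_ennreal sum_nonneg)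
  have "if s / r \<le> 1 then s / r \<le> \<beta> \<and> \<beta> \<le> 1 else \<beta> = 1 \<or> \<beta> = s / r"
    by (rule positive_sums_growth_unit[where h = h, OF _ c C hm h0])
      (use rs lower upper mm in auto)
  then show ?thesis using rs by (simp split: if_splits)
qed

section \<open>Exponents of embedded sequence spaces\<close>

lemma sum_fun_apply: "(\<Sum>k\<in>S. u k) i = (\<Sum>k\<in>S. u k i)" for u :: "'a \<Rightarrow> 'b \<Rightarrow> 'c::comm_monoid_add"
  by (induction S rule: infinite_finite_induct) auto

definition support :: "(nat \<Rightarrow> 'k::zero) \<Rightarrow> nat set" where
  "support x = {i. x i \<noteq> 0}"

definition unit_vector :: "nat \<Rightarrow> 'k::zero \<Rightarrow> nat \<Rightarrow> 'k" where
  "unit_vector i c j = (if j = i then c else 0)"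

lemma support_unit_vector: "support (unit_vector i c) \<subseteq> {i}"
  by (auto simp: support_def unit_vector_def)

text \<open>
  The common features of \<open>\<ell>\<^sub>p\<close>, where \<open>\<theta> = 1/p\<close>, and of \<open>c\<^sub>0\<close>, where \<open>\<theta> = 0\<close>, that restrict embeddings.
\<close>

locale power_growth_space = quasi_normed X K
  for X :: "('k::{real_normed_field, euclidean_space}, nat \<Rightarrow> 'k) qn_space" and K +
  fixes \<theta> :: real
  assumes exponent_nonneg: "0 \<le> \<theta>"
    and scale_coord: "scale X c x = (\<lambda>n. c * x n)"
    and finite_support_closed: "finite (support x) \<Longrightarrow> x \<in> carrier X"
    and qnorm_unit_vector: "qnorm X (unit_vector i c) = norm c"
    and qnorm_disjoint_sum: "finite (S :: nat set) \<Longrightarrow> S \<noteq> {} \<Longrightarrow> (\<And>k. k \<in> S \<Longrightarrow> finite (support (u k))) \<Longrightarrow>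
      (\<And>k. k \<in> S \<Longrightarrow> qnorm X (u k) = 1) \<Longrightarrow> disjoint_family_on (\<lambda>k. support (u k)) S \<Longrightarrow>
      qnorm X (\<Sum>k\<in>S. u k) = real (card S) powr \<theta>"

locale embedded_growth_space = power_growth_space X K \<theta>
  for X :: "('k::{real_normed_field, euclidean_space}, nat \<Rightarrow> 'k) qn_space" and K \<theta> +
  fixes r s c C :: real and T :: "(nat \<Rightarrow> 'k) \<Rightarrow> 'k mixed_L0"
  assumes rs: "0 < r" "r < s" and cC: "0 < c" "0 < C"
    and T: "linear_operator X (Ls_lr s r) T"
    and T_lower: "\<And>x. x \<in> carrier X \<Longrightarrow> c * qnorm X x \<le> qnorm (Ls_lr s r) (T x)"
    and T_upper: "\<And>x. x \<in> carrier X \<Longrightarrow> qnorm (Ls_lr s r) (T x) \<le> C * qnorm X x"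
begin

lemma s_pos: "0 < s" using rs by simp

text \<open>
  A measurable function in the class \<open>T x\<close>. The choice is additive in \<open>x\<close> only up to null sets, so
  modulars of sums are compared through the classes.
\<close>

definition representative :: "(nat \<Rightarrow> 'k) \<Rightarrow> real \<times> nat \<Rightarrow> 'k" where
  "representative x = (SOME f. f \<in> borel_measurable mixed_measure \<and> T x = abs_mixed_L0 f)"

lemma representative:
  shows measurable_representative [measurable]: "representative x \<in> borel_measurable mixed_measure"
    and abs_representative: "abs_mixed_L0 (representative x) = T x"
proof -
  have "\<exists>f. f \<in> borel_measurable mixed_measure \<and> T x = abs_mixed_L0 f"
    using mixed_L0_cases[of "T x"] by metis
  from someI_ex[OF this] show "representative x \<in> borel_measurable mixed_measure"
    "abs_mixed_L0 (representative x) = T x" unfolding representative_def by auto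
qed

lemma Y_quasi_normed: "quasi_normed (Ls_lr s r :: ('k, 'k mixed_L0) qn_space)
    (2 powr ((s + s / r) / s) * 2 powr (1 / s))"
  by (rule quasi_normed_Ls_lr[OF rs(1) s_pos])

lemma modular_bounds:
  assumes x: "x \<in> carrier X"
  shows "ennreal (c powr s * qnorm X x powr s) \<le> mixed_modular s r (representative x)"
    and "mixed_modular s r (representative x) \<le> ennreal (C powr s * qnorm X x powr s)"
proof -
  have "abs_mixed_L0 (representative x) \<in> carrier (Ls_lr s r)"
    unfolding abs_representative using T x unfolding linear_operator_def by blast
  then have "mixed_modular s r (representative x) < top"
    by (simp only: carrier_Ls_lr[OF measurable_representative])
  then obtain t where t: "0 \<le> t" "mixed_modular s r (representative x) = ennreal t"
    by (metis ennreal_cases less_irrefl)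
  have q: "qnorm (Ls_lr s r) (T x) = t powr (1 / s)"
    using qnorm_Ls_lr[OF measurable_representative, of s r x] t by (simp add: abs_representative)
  have tt: "(t powr (1 / s)) powr s = t" using t s_pos by (simp add: powr_powr)
  have "(c * qnorm X x) powr s \<le> (t powr (1 / s)) powr s"
    using T_lower[OF x] x cC s_pos unfolding q by (intro powr_mono2) auto
  then show "ennreal (c powr s * qnorm X x powr s) \<le> mixed_modular s r (representative x)"
    using x cC unfolding tt by (simp add: t powr_mult ennreal_leI)
  have "(t powr (1 / s)) powr s \<le> (C * qnorm X x) powr s"
    using T_upper[OF x] s_pos unfolding q by (intro powr_mono2) auto
  then show "mixed_modular s r (representative x) \<le> ennreal (C powr s * qnorm X x powr s)"
    using x cC unfolding tt by (simp add: t powr_mult ennreal_leI)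
qed

lemma abs_representative_uminus:
  assumes "x \<in> carrier X"
  shows "abs_mixed_L0 (\<lambda>z. - representative x z) = T (- x)"
proof -
  have "T (0 - x) = T 0 - T x"
    by (rule linear_operator_diff[OF quasi_normed_axioms Y_quasi_normed T]) (use assms in auto)
  then have "T (- x) = - T x"
    using linear_operator_zero[OF quasi_normed_axioms Y_quasi_normed T] by simp
  moreover have "- abs_mixed_L0 (representative x) = abs_mixed_L0 (\<lambda>z. - representative x z)"
    by (rule uminus_mixed_L0.abs_eq) (simp add: ae_eq_refl)
  ultimately show ?thesis by (simp add: abs_representative)
qed

lemma T_sum:
  assumes "\<And>k. k \<in> S \<Longrightarrow> u k \<in> carrier X"
  shows "T (\<Sum>k\<in>S. u k) = (\<Sum>k\<in>S. T (u k))"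
  using assms
proof (induction S rule: infinite_finite_induct)
  case (insert k S)
  then have "T (u k + (\<Sum>k\<in>S. u k)) = T (u k) + T (\<Sum>k\<in>S. u k)"
    using T unfolding linear_operator_def by auto
  moreover have "T (\<Sum>k\<in>S. u k) = (\<Sum>k\<in>S. T (u k))"
    by (rule insert.IH) (use insert.prems in auto)
  ultimately show ?case unfolding sum.insert[OF insert.hyps] by (simp only:)
qed (simp_all add: linear_operator_zero[OF quasi_normed_axioms Y_quasi_normed T])

lemma abs_signed_sum:
  assumes "\<And>k. k \<in> S \<Longrightarrow> u k \<in> carrier X"
  shows "abs_mixed_L0 (\<lambda>z. signed_sum S A (\<lambda>k. representative (u k) z)) = T (signed_sum S A u)"
proof -
  define g where "g k z = (if k \<in> A then representative (u k) z else - representative (u k) z)" for k z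
  have [measurable]: "g k \<in> borel_measurable mixed_measure" for k
    by (cases "k \<in> A") (simp_all add: g_def[abs_def])
  have g: "abs_mixed_L0 (g k) = T (if k \<in> A then u k else - u k)" if "k \<in> S" for k
    using assms[OF that] by (auto simp: g_def[abs_def] abs_representative abs_representative_uminus)
  have "abs_mixed_L0 (\<lambda>z. \<Sum>k\<in>S. g k z) = (\<Sum>k\<in>S. T (if k \<in> A then u k else - u k))"
    using g by (simp add: sum_mixed_L0_abs[symmetric])
  also have "\<dots> = T (signed_sum S A u)"
    unfolding signed_sum_def using assms by (subst T_sum) auto
  finally show ?thesis by (simp add: signed_sum_def g_def)
qed

lemma qnorm_signed_unit_vectors:
  fixes S A :: "nat set"
  assumes "finite S" "S \<noteq> {}" "inj e"
  shows "qnorm X (signed_sum S A (\<lambda>i. unit_vector (e i) 1)) = real (card S) powr \<theta>"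
proof -
  define u where "u k = (unit_vector (e k) (if k \<in> A then 1 else - 1) :: nat \<Rightarrow> 'k)" for k
  have "signed_sum S A (\<lambda>i. unit_vector (e i) (1 :: 'k)) = (\<Sum>k\<in>S. u k)"
    unfolding signed_sum_def u_def by (intro sum.cong) (auto simp: unit_vector_def fun_eq_iff)
  moreover have "qnorm X (\<Sum>k\<in>S. u k) = real (card S) powr \<theta>"
  proof (rule qnorm_disjoint_sum)
    show "finite (support (u k))" for k
      unfolding u_def by (rule finite_subset[OF support_unit_vector]) simp
    show "qnorm X (u k) = 1" for k unfolding u_def by (subst qnorm_unit_vector) simp
    show "disjoint_family_on (\<lambda>k. support (u k)) S"
      using assms(3) by (auto simp: disjoint_family_on_def support_def u_def unit_vector_def inj_def split: if_splits)
  qed (use assms in auto)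
  ultimately show ?thesis by simp
qed

lemma unit_vector_closed: "unit_vector i a \<in> carrier X"
  by (intro finite_support_closed finite_subset[OF support_unit_vector]) simp

text \<open>
  The lower bound for the images survives the restriction to the coordinates below \<open>N\<close>, and so does the
  upper bound. Hence the images of the unit vectors with index at least \<open>M\<close> qualify for the lemma on
  finitely many coordinates.
\<close>

lemma exponent_if_concentrated:
  assumes \<delta>: "0 < \<delta>"
    and conc: "\<And>x. finite (support x) \<Longrightarrow> support x \<subseteq> {M..} \<Longrightarrow>
      ennreal \<delta> * mixed_modular s r (representative x) \<le>
      mixed_modular s r (restrict_coords {..<N} (representative x))"
  shows "if s \<le> 2 then s / 2 \<le> s * \<theta> \<and> s * \<theta> \<le> 1 else s * \<theta> = 1 \<or> s * \<theta> = s / 2"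
proof (rule finite_coordinates_growth[where f = "\<lambda>i. representative (unit_vector (M + i) 1)"
      and c = "\<delta> * c powr s" and C = "C powr s"])
  fix S A :: "nat set" assume S: "finite S" "S \<noteq> {}"
  define x where "x = signed_sum S A (\<lambda>i. unit_vector (M + i) (1 :: 'k))"
  let ?g = "\<lambda>z. signed_sum S A (\<lambda>i. representative (unit_vector (M + i) 1) z)"
  have gm [measurable]: "?g \<in> borel_measurable mixed_measure"
    unfolding signed_sum_def if_distrib[symmetric] by (intro borel_measurable_sum) simp
  have abs: "abs_mixed_L0 ?g = abs_mixed_L0 (representative x)"
    unfolding abs_representative x_def by (rule abs_signed_sum) (rule unit_vector_closed)
  have sx: "support x \<subseteq> (\<lambda>i. M + i) ` S"
    by (rule subsetI, rule ccontr)
      (auto simp: support_def x_def signed_sum_def sum_fun_apply unit_vector_def image_iff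
        intro!: sum.neutral)
  have fx: "finite (support x)" using finite_subset[OF sx] S by simp
  have x: "x \<in> carrier X" by (rule finite_support_closed[OF fx])
  have q: "qnorm X x = real (card S) powr \<theta>"
    unfolding x_def by (rule qnorm_signed_unit_vectors[OF S]) (simp add: inj_def)
  have qs: "qnorm X x powr s = real (card S) powr (s * \<theta>)" unfolding q by (simp add: powr_powr mult.commute)
  note eq = mixed_modular_restrict_cong[OF gm measurable_representative abs]
  have "ennreal (\<delta> * c powr s * real (card S) powr (s * \<theta>)) =
      ennreal \<delta> * ennreal (c powr s * qnorm X x powr s)"
    unfolding qs using \<delta> by (simp add: ennreal_mult mult.assoc)
  also have "\<dots> \<le> ennreal \<delta> * mixed_modular s r (representative x)"
    by (intro mult_left_mono modular_bounds x) auto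
  also have "\<dots> \<le> mixed_modular s r (restrict_coords {..<N} (representative x))"
    using sx by (intro conc fx) auto
  finally show "ennreal (\<delta> * c powr s * real (card S) powr (s * \<theta>)) \<le>
      mixed_modular s r (restrict_coords {..<N} ?g)" unfolding eq .
  have "mixed_modular s r (restrict_coords {..<N} ?g) \<le> mixed_modular s r (representative x)"
    unfolding eq(1) by (rule mixed_modular_restrict_le[OF rs(1) s_pos])
  also have "\<dots> \<le> ennreal (C powr s * real (card S) powr (s * \<theta>))"
    using modular_bounds(2)[OF x] unfolding qs .
  finally show "mixed_modular s r (restrict_coords {..<N} ?g) \<le>
      ennreal (C powr s * real (card S) powr (s * \<theta>))" .
qed (use rs s_pos cC \<delta> in auto)

lemma abs_representative_scale:
  assumes "x \<in> carrier X"
  shows "abs_mixed_L0 (\<lambda>z. a * representative x z) = T (scale X a x)"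
proof -
  have "T (scale X a x) = scale (Ls_lr s r) a (T x)"
    using T assms unfolding linear_operator_def by blast
  moreover have "scale (Ls_lr s r) a (abs_mixed_L0 (representative x)) = abs_mixed_L0 (\<lambda>z. a * representative x z)"
    by (rule scale_Ls_lr[OF measurable_representative])
  ultimately show ?thesis by (simp add: abs_representative)
qed

text \<open>
  One step of the gliding hump: far out there is a normalized vector whose image has little mass on the
  coordinates below \<open>N\<close>; and since its modular is finite, little mass remains beyond some \<open>N'\<close>.
\<close>

lemma block_exists:
  assumes spread: "\<And>N M \<delta>. 0 < \<delta> \<Longrightarrow> \<exists>x. finite (support x) \<and> support x \<subseteq> {M..} \<and>
      mixed_modular s r (restrict_coords {..<N} (representative x)) <
      ennreal \<delta> * mixed_modular s r (representative x)"
    and \<eta>: "0 < \<eta>"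
  shows "\<exists>u N' M'. support u \<subseteq> {M..<M'} \<and> qnorm X u = 1 \<and> N \<le> N' \<and> M \<le> M' \<and>
    mixed_modular s r (restrict_coords {..<N} (representative u)) \<le> ennreal \<eta> \<and>
    mixed_modular s r (restrict_coords {N'..} (representative u)) \<le> ennreal \<eta>"
proof -
  \<comment> \<open>After normalization the modular of the image is at most \<open>C\<^sup>s\<close>.\<close>
  define \<delta> where "\<delta> = \<eta> / C powr s"
  have \<delta>: "\<delta> > 0" using \<eta> cC by (simp add: \<delta>_def)
  obtain x where x: "finite (support x)" "support x \<subseteq> {M..}"
    "mixed_modular s r (restrict_coords {..<N} (representative x)) <
      ennreal \<delta> * mixed_modular s r (representative x)" using spread[OF \<delta>] by blast
  have xX: "x \<in> carrier X" by (rule finite_support_closed[OF x(1)])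
  have "qnorm X x \<noteq> 0"
  proof
    assume "qnorm X x = 0"
    then have "mixed_modular s r (representative x) \<le> 0" using modular_bounds(2)[OF xX] by simp
    then show False using x(3) by simp
  qed
  then have q: "qnorm X x > 0" using xX by (simp add: less_le)
  define a where "a = (of_real (1 / qnorm X x) :: 'k)"
  have na: "norm a = 1 / qnorm X x" using q by (simp add: a_def norm_divide)
  define u where "u = scale X a x"
  have uX: "u \<in> carrier X" using xX by (simp add: u_def)
  have qu: "qnorm X u = 1" using q xX by (simp add: u_def qnorm_scale na)
  have su: "support u \<subseteq> support x" by (auto simp: u_def scale_coord support_def)
  have abs: "abs_mixed_L0 (\<lambda>z. a * representative x z) = abs_mixed_L0 (representative u)"
    unfolding abs_representative u_def by (rule abs_representative_scale[OF xX])
  have am: "(\<lambda>z. a * representative x z) \<in> borel_measurable mixed_measure" by measurable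
  have "mixed_modular s r (restrict_coords {..<N} (representative u)) =
      mixed_modular s r (restrict_coords {..<N} (\<lambda>z. a * representative x z))"
    by (rule mixed_modular_restrict_cong(1)[OF am measurable_representative abs, symmetric])
  also have "restrict_coords {..<N} (\<lambda>z. a * representative x z) =
      (\<lambda>z. a * restrict_coords {..<N} (representative x) z)"
    by (auto simp: restrict_coords_def)
  also have "mixed_modular s r \<dots> = ennreal (norm a powr s) *
      mixed_modular s r (restrict_coords {..<N} (representative x))"
    by (rule mixed_modular_scale) (use rs s_pos in auto)
  also have "\<dots> \<le> ennreal (norm a powr s) * (ennreal \<delta> * mixed_modular s r (representative x))"
    using x(3) by (intro mult_left_mono) auto
  also have "\<dots> \<le> ennreal (norm a powr s) * (ennreal \<delta> * ennreal (C powr s * qnorm X x powr s))"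
    by (intro mult_left_mono modular_bounds xX) auto
  also have "\<dots> = ennreal (norm a powr s * (\<delta> * (C powr s * qnorm X x powr s)))"
    using \<delta> by (simp add: ennreal_mult)
  also have "norm a powr s * (\<delta> * (C powr s * qnorm X x powr s)) = \<eta>"
    using q cC by (simp add: na \<delta>_def powr_divide)
  finally have head: "mixed_modular s r (restrict_coords {..<N} (representative u)) \<le> ennreal \<eta>" .
  have fin: "mixed_modular s r (representative u) < top"
    using modular_bounds(2)[OF uX] by (rule order_le_less_trans) simp
  have "(\<lambda>N. mixed_modular s r (restrict_coords {N..} (representative u))) \<longlonglongrightarrow> 0"
    by (rule mixed_modular_tail[OF measurable_representative rs(1) s_pos fin])
  then have "\<forall>\<^sub>F N' in sequentially. mixed_modular s r (restrict_coords {N'..} (representative u)) < ennreal \<eta>"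
    by (rule order_tendstoD) (use \<eta> in simp)
  then obtain N0 where N0: "\<And>N'. N' \<ge> N0 \<Longrightarrow>
      mixed_modular s r (restrict_coords {N'..} (representative u)) < ennreal \<eta>"
    unfolding eventually_sequentially by blast
  have "finite (support u)" using su x(1) by (rule finite_subset)
  then obtain M0 where M0: "support u \<subseteq> {..<M0}" using finite_nat_bounded by blast
  show ?thesis
  proof (intro exI conjI)
    show "support u \<subseteq> {M..<max M M0}" using su x(2) M0 by fastforce
    show "mixed_modular s r (restrict_coords {max N N0..} (representative u)) \<le> ennreal \<eta>"
      using N0[of "max N N0"] by simp
  qed (use qu head in auto)
qed

lemma disjoint_family_consecutive:
  assumes "\<And>k. a k \<le> a (Suc k)"
  shows "disjoint_family (\<lambda>k. {a k..<a (Suc k) :: nat})"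
proof -
  have "mono a" using assms by (simp add: mono_iff_le_Suc)
  then have "a (Suc k) \<le> a l" if "k < l" for k l using that by (simp add: monoD)
  then show ?thesis unfolding disjoint_family_on_def by (metis (no_types, lifting) Int_emptyI
      atLeastLessThan_iff leD linorder_neqE_nat order.strict_trans1)
qed

text \<open>
  The gliding hump. The errors \<open>\<epsilon>\<^sub>k\<close> are so small that even after the losses in the triangle inequality
  the images of the blocks differ in sum by at most \<open>\<eta>\<close> from functions \<open>H\<^sub>k\<close> with disjoint coordinates, and
  \<open>\<eta>\<close> is small against the lower bound \<open>c\<^sup>s\<close> of a single block.
\<close>

lemma exponent_if_spread:
  assumes spread: "\<And>N M \<delta>. 0 < \<delta> \<Longrightarrow> \<exists>x. finite (support x) \<and> support x \<subseteq> {M..} \<and>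
      mixed_modular s r (restrict_coords {..<N} (representative x)) <
      ennreal \<delta> * mixed_modular s r (representative x)"
  shows "s * \<theta> = 1 \<or> s * \<theta> = s / r"
proof -
  define q where "q = 2 powr (s + s / r)"
  have q: "q > 0" by (simp add: q_def)
  define \<eta> where "\<eta> = c powr s / (2 * q)"
  have \<eta>: "\<eta> > 0" using cC q by (simp add: \<eta>_def)
  define \<epsilon> where "\<epsilon> k = \<eta> * (1/2) ^ Suc k / (2 * q * q ^ (k + 1))" for k
  have \<epsilon>: "\<epsilon> k > 0" for k using \<eta> q by (simp add: \<epsilon>_def)
  \<comment> \<open>The states are tuples \<open>(u, N, M, N', M')\<close>: the block \<open>u\<close> is supported in \<open>{M..<M'}\<close> and its image
    essentially on the coordinates in \<open>{N..<N'}\<close>; the next block starts at \<open>M'\<close> and \<open>N'\<close>.\<close>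
  define P where "P k t \<longleftrightarrow> (case t of (u, N, M, N', M') \<Rightarrow> support u \<subseteq> {M..<M'} \<and> qnorm X u = 1 \<and> N \<le> N' \<and> M \<le> M' \<and>
    mixed_modular s r (restrict_coords {..<N} (representative u)) \<le> ennreal (\<epsilon> k) \<and>
    mixed_modular s r (restrict_coords {N'..} (representative u)) \<le> ennreal (\<epsilon> k))"
    for k and t :: "(nat \<Rightarrow> 'k) \<times> nat \<times> nat \<times> nat \<times> nat"
  define Q where "Q t t' \<longleftrightarrow> (case t of (u, N, M, N', M') \<Rightarrow> case t' of (u2, N2, M2, N2', M2') \<Rightarrow>
      N2 = N' \<and> M2 = M')" for t t' :: "(nat \<Rightarrow> 'k) \<times> nat \<times> nat \<times> nat \<times> nat"
  have "\<exists>\<sigma>. \<forall>k. P k (\<sigma> k) \<and> Q (\<sigma> k) (\<sigma> (Suc k))"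
  proof (rule dependent_nat_choice)
    show "\<exists>t. P 0 t" using block_exists[OF spread \<epsilon>[of 0], of 0 0] unfolding P_def by fastforce
    fix t k assume "P k t"
    obtain u N M N' M' where t: "t = (u, N, M, N', M')" by (cases t) auto
    obtain u2 N2 M2 where "P (Suc k) (u2, N', M', N2, M2)"
      using block_exists[OF spread \<epsilon>[of "Suc k"], of M' N'] unfolding P_def by auto
    then show "\<exists>t'. P (Suc k) t' \<and> Q t t'" unfolding t Q_def by fastforce
  qed
  then obtain \<sigma> where \<sigma>: "\<And>k. P k (\<sigma> k)" "\<And>k. Q (\<sigma> k) (\<sigma> (Suc k))" by blast
  define u where "u k = fst (\<sigma> k)" for k
  define n where "n k = fst (snd (\<sigma> k))" for k
  define m where "m k = fst (snd (snd (\<sigma> k)))" for k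
  have \<sigma>_eq: "\<sigma> k = (u k, n k, m k, n (Suc k), m (Suc k))" for k
    using \<sigma>(2)[of k] by (cases "\<sigma> k"; cases "\<sigma> (Suc k)") (simp add: Q_def u_def n_def m_def)
  have su: "support (u k) \<subseteq> {m k..<m (Suc k)}" and qu: "qnorm X (u k) = 1"
    and n_mono: "n k \<le> n (Suc k)" and m_mono: "m k \<le> m (Suc k)"
    and head: "mixed_modular s r (restrict_coords {..<n k} (representative (u k))) \<le> ennreal (\<epsilon> k)"
    and tail: "mixed_modular s r (restrict_coords {n (Suc k)..} (representative (u k))) \<le> ennreal (\<epsilon> k)" for k
    using \<sigma>(1)[of k] unfolding \<sigma>_eq P_def by auto
  have fu: "finite (support (u k))" for k using finite_subset[OF su] by simp
  have uX: "u k \<in> carrier X" for k by (rule finite_support_closed[OF fu])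
  define J where "J k = {n k..<n (Suc k)}" for k
  have J: "disjoint_family J" unfolding J_def by (rule disjoint_family_consecutive[of n, OF n_mono])
  define H where "H k = restrict_coords (J k) (representative (u k))" for k
  have [measurable]: "H k \<in> borel_measurable mixed_measure" for k unfolding H_def by measurable
  define d where "d k z = representative (u k) z - H k z" for k z
  have [measurable]: "d k \<in> borel_measurable mixed_measure" for k unfolding d_def by measurable
  have dk: "mixed_modular s r (d k) \<le> ennreal (2 * q * \<epsilon> k)" for k
  proof -
    have "d k = (\<lambda>z. restrict_coords {..<n k} (representative (u k)) z +
        restrict_coords {n (Suc k)..} (representative (u k)) z)"
      using n_mono[of k] by (auto simp: fun_eq_iff d_def H_def J_def restrict_coords_def)
    then have "mixed_modular s r (d k) \<le> ennreal q *
        (mixed_modular s r (restrict_coords {..<n k} (representative (u k))) +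
         mixed_modular s r (restrict_coords {n (Suc k)..} (representative (u k))))"
      unfolding q_def using rs s_pos by (simp only:) (intro mixed_modular_add_le; measurable)
    also have "\<dots> \<le> ennreal q * (ennreal (\<epsilon> k) + ennreal (\<epsilon> k))"
      by (intro mult_left_mono add_mono head tail) auto
    also have "\<dots> = ennreal (2 * q * \<epsilon> k)"
      using q \<epsilon>[of k] by (simp add: ennreal_plus[symmetric] ennreal_mult[symmetric] del: ennreal_plus)
    finally show ?thesis .
  qed
  have D: "mixed_modular s r (\<lambda>z. \<Sum>k\<in>S. d k z) \<le> ennreal \<eta>" if S: "finite S" for S
  proof -
    obtain l where l: "S \<subseteq> {..<l}" using S finite_nat_bounded by blast
    define d' where "d' k z = (if k \<in> S then d k z else 0)" for k z
    have [measurable]: "d' k \<in> borel_measurable mixed_measure" for k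
      unfolding d'_def by (cases "k \<in> S") simp_all
    have d': "mixed_modular s r (d' k) \<le> ennreal (2 * q * \<epsilon> k)" for k
      using order.trans[OF mixed_modular_mono[of "d' k" "d k" r s] dk[of k]] rs s_pos by (simp add: d'_def)
    have "(\<Sum>k\<in>S. d k z) = (\<Sum>k\<in>{0..<0 + l}. d' k z)" for z
      using l by (intro sum.mono_neutral_cong_left) (auto simp: d'_def)
    then have "mixed_modular s r (\<lambda>z. \<Sum>k\<in>S. d k z) = mixed_modular s r (\<lambda>z. \<Sum>k\<in>{0..<0 + l}. d' k z)"
      by simp
    also have "\<dots> \<le> (\<Sum>k\<in>{0..<0 + l}. ennreal q ^ (k - 0 + 1) * mixed_modular s r (d' k))"
      unfolding q_def by (rule mixed_modular_sum_le[OF rs(1) s_pos]) simp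
    also have "\<dots> \<le> (\<Sum>k\<in>{0..<0 + l}. ennreal (\<eta> * (1/2) ^ Suc k))"
    proof (rule sum_mono)
      fix k
      have "ennreal q ^ (k - 0 + 1) = ennreal (q ^ (k + 1))"
        using q by (subst ennreal_power) auto
      then have "ennreal q ^ (k - 0 + 1) * mixed_modular s r (d' k) \<le> ennreal (q ^ (k + 1)) * ennreal (2 * q * \<epsilon> k)"
        using d'[of k] by (simp only:) (intro mult_left_mono, auto)
      also have "\<dots> = ennreal (q ^ (k + 1) * (2 * q * \<epsilon> k))"
        using q \<epsilon>[of k] by (intro ennreal_mult[symmetric]) auto
      also have "q ^ (k + 1) * (2 * q * \<epsilon> k) = \<eta> * (1/2) ^ Suc k"
        using q by (simp add: \<epsilon>_def)
      finally show "ennreal q ^ (k - 0 + 1) * mixed_modular s r (d' k) \<le> ennreal (\<eta> * (1/2) ^ Suc k)" .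
    qed
    also have "\<dots> = ennreal (\<Sum>k\<in>{0..<0 + l}. \<eta> * (1/2) ^ Suc k)"
      using \<eta> by (intro sum_ennreal) auto
    also have "(\<Sum>k\<in>{0..<0 + l}. \<eta> * (1/2) ^ Suc k) \<le> \<eta>"
    proof -
      have "(\<Sum>k\<in>{0..<0 + l}. (1/2 :: real) ^ Suc k) \<le> (\<Sum>k. (1/2) ^ Suc k)"
        by (intro sum_le_suminf sums_summable[OF power_half_series]) auto
      also have "\<dots> = 1" by (rule sums_unique[OF power_half_series, symmetric])
      finally show ?thesis using \<eta> unfolding sum_distrib_left[symmetric] by simp
    qed
    finally show ?thesis using \<eta> by (simp add: ennreal_leI)
  qed
  have sumR: "ennreal (c powr s * real (card S) powr (s * \<theta>)) \<le> mixed_modular s r (\<lambda>z. \<Sum>k\<in>S. representative (u k) z)"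
    "mixed_modular s r (\<lambda>z. \<Sum>k\<in>S. representative (u k) z) \<le> ennreal (C powr s * real (card S) powr (s * \<theta>))"
    if S: "finite S" "S \<noteq> {}" for S
  proof -
    let ?x = "\<Sum>k\<in>S. u k"
    have "disjoint_family (\<lambda>k. {m k..<m (Suc k)})" by (rule disjoint_family_consecutive[of m, OF m_mono])
    then have "disjoint_family_on (\<lambda>k. support (u k)) S"
      using su unfolding disjoint_family_on_def by blast
    then have "qnorm X ?x = real (card S) powr \<theta>"
      by (intro qnorm_disjoint_sum S fu qu)
    then have qs: "qnorm X ?x powr s = real (card S) powr (s * \<theta>)" by (simp add: powr_powr mult.commute)
    have "abs_mixed_L0 (\<lambda>z. \<Sum>k\<in>S. representative (u k) z) = abs_mixed_L0 (representative ?x)"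
      using uX by (simp add: sum_mixed_L0_abs[symmetric] abs_representative T_sum)
    from mixed_modular_restrict_cong(2)[OF _ measurable_representative this]
    have eq: "mixed_modular s r (\<lambda>z. \<Sum>k\<in>S. representative (u k) z) = mixed_modular s r (representative ?x)"
      by simp
    have xX: "?x \<in> carrier X" using uX by simp
    show "ennreal (c powr s * real (card S) powr (s * \<theta>)) \<le> mixed_modular s r (\<lambda>z. \<Sum>k\<in>S. representative (u k) z)"
      "mixed_modular s r (\<lambda>z. \<Sum>k\<in>S. representative (u k) z) \<le> ennreal (C powr s * real (card S) powr (s * \<theta>))"
      unfolding eq using modular_bounds[OF xX] unfolding qs by auto
  qed
  have one_le: "1 \<le> real (card S) powr (s * \<theta>)" if "finite S" "S \<noteq> {}" for S :: "nat set"
  proof -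
    have "1 \<le> real (card S)" using that by (simp add: Suc_le_eq card_gt_0_iff)
    then show ?thesis using exponent_nonneg s_pos by (intro ge_one_powr_ge_zero) auto
  qed
  show ?thesis
  proof (rule disjoint_coordinates_growth[where f = "\<lambda>k. representative (u k)" and J = J
        and c = "c powr s / (2 * q)" and C = "q * (C powr s + \<eta>)"])
    fix S :: "nat set" assume S: "finite S" "S \<noteq> {}"
    let ?N = "real (card S) powr (s * \<theta>)"
    let ?H = "\<lambda>z. \<Sum>k\<in>S. H k z" and ?R = "\<lambda>z. \<Sum>k\<in>S. representative (u k) z" and ?D = "\<lambda>z. \<Sum>k\<in>S. d k z"
    have H_eq: "?H = (\<lambda>z. ?R z + - ?D z)" and R_eq: "?R = (\<lambda>z. ?H z + ?D z)"
      by (auto simp: fun_eq_iff d_def sum_subtractf)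
    have "mixed_modular s r ?H \<le> ennreal q * (mixed_modular s r ?R + mixed_modular s r (\<lambda>z. - ?D z))"
      unfolding q_def by (subst H_eq, rule mixed_modular_add_le) (use rs s_pos in auto)
    also have "\<dots> \<le> ennreal q * (ennreal (C powr s * ?N) + ennreal \<eta>)"
      unfolding mixed_modular_uminus by (intro mult_left_mono add_mono sumR(2)[OF S] D[OF S(1)]) auto
    also have "\<dots> \<le> ennreal (q * (C powr s * ?N + \<eta>))"
      using q \<eta> by (simp add: ennreal_plus[symmetric] ennreal_mult[symmetric] del: ennreal_plus)
    also have "\<dots> \<le> ennreal (q * (C powr s + \<eta>) * ?N)"
    proof (rule ennreal_leI)
      have "\<eta> \<le> \<eta> * ?N" using one_le[OF S] \<eta> by simp
      then have "q * (C powr s * ?N + \<eta>) \<le> q * (C powr s * ?N + \<eta> * ?N)"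
        using q by (intro mult_left_mono) auto
      then show "q * (C powr s * ?N + \<eta>) \<le> q * (C powr s + \<eta>) * ?N" by (simp add: algebra_simps)
    qed
    finally have up: "mixed_modular s r ?H \<le> ennreal (q * (C powr s + \<eta>) * ?N)" .
    then show "mixed_modular s r (\<lambda>z. \<Sum>k\<in>S. restrict_coords (J k) (representative (u k)) z) \<le>
        ennreal (q * (C powr s + \<eta>) * ?N)" by (simp add: H_def)
    have "mixed_modular s r ?H < top" using up by (rule order_le_less_trans) simp
    then obtain t where t: "0 \<le> t" "mixed_modular s r ?H = ennreal t"
      by (metis ennreal_cases less_irrefl)
    have "ennreal (c powr s * ?N) \<le> mixed_modular s r ?R" by (rule sumR(1)[OF S])
    also have "\<dots> \<le> ennreal q * (mixed_modular s r ?H + mixed_modular s r ?D)"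
      unfolding q_def by (subst R_eq, rule mixed_modular_add_le) (use rs s_pos in auto)
    also have "\<dots> \<le> ennreal q * (ennreal t + ennreal \<eta>)"
      unfolding t(2) by (intro mult_left_mono add_left_mono D[OF S(1)]) auto
    also have "\<dots> = ennreal (q * (t + \<eta>))"
      using q \<eta> t by (simp add: ennreal_plus[symmetric] ennreal_mult[symmetric] del: ennreal_plus)
    finally have "c powr s * ?N \<le> q * (t + \<eta>)" using q \<eta> t by (simp add: ennreal_le_iff)
    also have "\<dots> = q * t + c powr s / 2" using q by (simp add: \<eta>_def algebra_simps)
    also have "c powr s / 2 \<le> c powr s / 2 * ?N" using one_le[OF S] by (simp add: mult_le_cancel_left1)
    finally have "c powr s / (2 * q) * ?N \<le> t" using q by (simp add: field_simps)
    then have "ennreal (c powr s / (2 * q) * ?N) \<le> mixed_modular s r ?H"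
      unfolding t(2) by (rule ennreal_leI)
    then show "ennreal (c powr s / (2 * q) * ?N) \<le>
        mixed_modular s r (\<lambda>z. \<Sum>k\<in>S. restrict_coords (J k) (representative (u k)) z)" by (simp add: H_def)
  qed (use rs cC q \<eta> J in \<open>auto simp: J_def\<close>)
qed

text \<open>
  Either a finite set of coordinates dominates on some tail, or no such set does on any tail.
\<close>

theorem exponent_cases:
  "\<theta> = 1 / r \<or> \<theta> = 1 / s \<or> (if s \<le> 2 then 1 / 2 \<le> \<theta> \<and> \<theta> \<le> 1 / s else \<theta> = 1 / 2)"
proof (cases "\<exists>N M \<delta>. 0 < \<delta> \<and> (\<forall>x. finite (support x) \<and> support x \<subseteq> {M..} \<longrightarrow>
      ennreal \<delta> * mixed_modular s r (representative x) \<le>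
      mixed_modular s r (restrict_coords {..<N} (representative x)))")
  case True
  then have main: "if s \<le> 2 then s / 2 \<le> s * \<theta> \<and> s * \<theta> \<le> 1 else s * \<theta> = 1 \<or> s * \<theta> = s / 2"
    using exponent_if_concentrated by blast
  show ?thesis
  proof (cases "s \<le> 2")
    case True
    then have "1 / 2 \<le> \<theta>" "\<theta> \<le> 1 / s" using main s_pos by (simp_all add: field_simps)
    then show ?thesis using True by simp
  next
    case False
    then have "s * \<theta> = 1 \<or> s * \<theta> = s / 2" using main by simp
    then have "\<theta> = 1 / s \<or> \<theta> = 1 / 2" using s_pos by (auto simp: field_simps)
    then show ?thesis using False by simp
  qed
next
  case False
  have "s * \<theta> = 1 \<or> s * \<theta> = s / r"
    by (rule exponent_if_spread) (use False in \<open>auto simp: not_le\<close>)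
  then show ?thesis using s_pos rs by (auto simp: field_simps)
qed

end

theorem (in power_growth_space) embeds_imp_exponent_cases:
  assumes rs: "0 < r" "r < s" and emb: "isomorphically_embeds X (Ls_lr s r)"
  shows "\<theta> = 1 / r \<or> \<theta> = 1 / s \<or> (if s \<le> 2 then 1 / 2 \<le> \<theta> \<and> \<theta> \<le> 1 / s else \<theta> = 1 / 2)"
proof -
  have s: "0 < s" using rs by simp
  obtain T c C where T: "linear_operator X (Ls_lr s r) T" "0 < c" "0 < C"
    "\<And>x. x \<in> carrier X \<Longrightarrow> c * qnorm X x \<le> qnorm (Ls_lr s r) (T x)"
    "\<And>x. x \<in> carrier X \<Longrightarrow> qnorm (Ls_lr s r) (T x) \<le> C * qnorm X x"
    using isomorphically_embeds_imp_bounds[OF quasi_normed_axioms quasi_normed_Ls_lr[OF rs(1) s] emb] by blast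
  interpret embedded_growth_space X K \<theta> r s c C T
    by unfold_locales (use rs T in auto)
  show ?thesis by (rule exponent_cases)
qed

lemma power_growth_space_lp:
  assumes p: "0 < p"
  shows "power_growth_space (lp_space p :: ('k::{real_normed_field, euclidean_space}, nat \<Rightarrow> 'k) qn_space)
    (2 * 2 powr (1 / p)) (1 / p)"
proof -
  let ?L = "lp_space p :: ('k, nat \<Rightarrow> 'k) qn_space"
  interpret quasi_normed ?L "2 * 2 powr (1 / p)" by (rule quasi_normed_lp[OF p])
  have fin: "summable (\<lambda>n. norm (x n) powr p)" if "finite (support x)" for x :: "nat \<Rightarrow> 'k"
    using that by (intro summable_finite[of "support x"]) (auto simp: support_def)
  show ?thesis
  proof
    show "0 \<le> 1 / p" using p by simp
    show "scale ?L c x = (\<lambda>n. c * x n)" for c x by (rule scale_lp)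
    show "x \<in> carrier ?L" if "finite (support x)" for x using fin[OF that] by (simp add: carrier_lp)
    show "qnorm ?L (unit_vector i c) = norm c" for i c
    proof -
      have "(\<Sum>n. norm (unit_vector i c n) powr p) = (\<Sum>n\<in>{i}. norm (unit_vector i c n) powr p)"
        by (rule suminf_finite) (auto simp: unit_vector_def)
      then show ?thesis using p by (simp add: qnorm_lp unit_vector_def powr_powr)
    qed
    fix S :: "nat set" and u :: "nat \<Rightarrow> nat \<Rightarrow> 'k"
    assume S: "finite S" "S \<noteq> {}" and fu: "\<And>k. k \<in> S \<Longrightarrow> finite (support (u k))"
      and qu: "\<And>k. k \<in> S \<Longrightarrow> qnorm ?L (u k) = 1"
      and disj: "disjoint_family_on (\<lambda>k. support (u k)) S"
    have pt: "norm ((\<Sum>k\<in>S. u k) n) powr p = (\<Sum>k\<in>S. norm (u k n) powr p)" for n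
    proof (cases "\<exists>k\<in>S. u k n \<noteq> 0")
      case True
      then obtain k where k: "k \<in> S" "u k n \<noteq> 0" by blast
      have "u l n = 0" if "l \<in> S - {k}" for l
        using that k disj by (auto simp: support_def disjoint_family_on_def)
      then show ?thesis using S k(1) by (simp add: sum_fun_apply sum.remove)
    next
      case False
      then show ?thesis by (simp add: sum_fun_apply)
    qed
    have one: "(\<Sum>n. norm (u k n) powr p) = 1" if "k \<in> S" for k
    proof -
      have "((\<Sum>n. norm (u k n) powr p) powr (1 / p)) powr p = 1 powr p"
        using qu[OF that] by (simp add: qnorm_lp)
      then show ?thesis using p fin[OF fu[OF that]] by (simp add: powr_powr suminf_nonneg)
    qed
    have "(\<Sum>n. norm ((\<Sum>k\<in>S. u k) n) powr p) = (\<Sum>k\<in>S. \<Sum>n. norm (u k n) powr p)"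
      unfolding pt by (rule suminf_sum) (rule fin[OF fu])
    also have "\<dots> = real (card S)" using one by simp
    finally show "qnorm ?L (\<Sum>k\<in>S. u k) = real (card S) powr (1 / p)" by (simp add: qnorm_lp)
  qed
qed

lemma power_growth_space_c0:
  "power_growth_space (c0_space :: ('k::{real_normed_field, euclidean_space}, nat \<Rightarrow> 'k) qn_space) 1 0"
proof -
  let ?L = "c0_space :: ('k, nat \<Rightarrow> 'k) qn_space"
  interpret quasi_normed ?L 1 by (rule quasi_normed_c0)
  have fin: "x \<longlonglongrightarrow> 0" if x: "finite (support x)" for x :: "nat \<Rightarrow> 'k"
  proof (rule tendsto_eventually)
    have "\<forall>\<^sub>F n in cofinite. x n = 0" using x by (simp add: support_def eventually_cofinite)
    then show "\<forall>\<^sub>F n in sequentially. x n = 0" by (simp add: cofinite_eq_sequentially)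
  qed
  have qn: "qnorm ?L x = (SUP n. norm (x n))" for x by (simp add: c0_space_def)
  have up: "norm (x n) \<le> qnorm ?L x" if "finite (support x)" for x n
    unfolding qn by (rule cSUP_upper[OF _ qnorm_c0_bdd[OF fin[OF that]]]) simp
  show ?thesis
  proof
    show "0 \<le> (0::real)" by simp
    show "scale ?L c x = (\<lambda>n. c * x n)" for c x by (simp add: c0_space_def)
    show "x \<in> carrier ?L" if "finite (support x)" for x using fin[OF that] by (simp add: c0_space_def)
    show "qnorm ?L (unit_vector i c) = norm c" for i c
    proof (rule antisym)
      show "qnorm ?L (unit_vector i c) \<le> norm c"
        unfolding qn by (rule cSUP_least) (auto simp: unit_vector_def)
      show "norm c \<le> qnorm ?L (unit_vector i c)"
        using up[of "unit_vector i c" i] finite_subset[OF support_unit_vector, of i c]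
        by (simp add: unit_vector_def)
    qed
    fix S :: "nat set" and u :: "nat \<Rightarrow> nat \<Rightarrow> 'k"
    assume S: "finite S" "S \<noteq> {}" and fu: "\<And>k. k \<in> S \<Longrightarrow> finite (support (u k))"
      and qu: "\<And>k. k \<in> S \<Longrightarrow> qnorm ?L (u k) = 1"
      and disj: "disjoint_family_on (\<lambda>k. support (u k)) S"
    have pt: "(\<Sum>k\<in>S. u k) n = u k n" if "k \<in> S" "u k n \<noteq> 0" for k n
    proof -
      have "u l n = 0" if "l \<in> S - {k}" for l
        using that \<open>k \<in> S\<close> \<open>u k n \<noteq> 0\<close> disj by (auto simp: support_def disjoint_family_on_def)
      then show ?thesis using S \<open>k \<in> S\<close> by (simp add: sum_fun_apply sum.remove)
    qed
    have fs: "finite (support (\<Sum>k\<in>S. u k))"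
    proof (rule finite_subset)
      show "support (\<Sum>k\<in>S. u k) \<subseteq> (\<Union>k\<in>S. support (u k))"
        by (auto simp: support_def sum_fun_apply intro: sum.neutral)
      show "finite (\<Union>k\<in>S. support (u k))" using S fu by simp
    qed
    have "qnorm ?L (\<Sum>k\<in>S. u k) = 1"
    proof (rule antisym)
      show "qnorm ?L (\<Sum>k\<in>S. u k) \<le> 1"
        unfolding qn
      proof (rule cSUP_least)
        fix n
        show "norm ((\<Sum>k\<in>S. u k) n) \<le> 1"
        proof (cases "\<exists>k\<in>S. u k n \<noteq> 0")
          case True
          then obtain k where k: "k \<in> S" "u k n \<noteq> 0" by blast
          then show ?thesis using up[OF fu[OF k(1)], of n] by (simp add: pt qu)
        next
          case False
          then show ?thesis by (simp add: sum_fun_apply)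
        qed
      qed simp
      obtain k where k: "k \<in> S" using S by blast
      have "qnorm ?L (u k) \<le> qnorm ?L (\<Sum>k\<in>S. u k)"
        unfolding qn[of "u k"]
      proof (rule cSUP_least)
        fix n
        show "norm (u k n) \<le> qnorm ?L (\<Sum>k\<in>S. u k)"
        proof (cases "u k n = 0")
          case True
          then show ?thesis using order.trans[OF norm_ge_zero up[OF fs]] by simp
        next
          case False
          then show ?thesis using up[OF fs, of n] pt[OF k] by simp
        qed
      qed simp
      then show "1 \<le> qnorm ?L (\<Sum>k\<in>S. u k)" using qu[OF k] by simp
    qed
    then show "qnorm ?L (\<Sum>k\<in>S. u k) = real (card S) powr 0" using S by simp
  qed
qed

section \<open>Embeddings of the admissible sequence spaces\<close>

lemma lp_embeds_Ls_lr_if_modular_bounds: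
  fixes F :: "nat \<Rightarrow> real \<times> nat \<Rightarrow> 'k::{real_normed_field, euclidean_space}"
  assumes rs: "0 < r" "0 < s" and p: "0 < p" and c: "0 < c" and C: "0 \<le> C"
    and F [measurable]: "\<And>i. F i \<in> borel_measurable mixed_measure"
    and lower: "\<And>a n. ennreal (c * (\<Sum>i<n. norm (a i) powr p) powr (s / p)) \<le>
      mixed_modular s r (\<lambda>z. \<Sum>i<n. a i * F i z)"
    and upper: "\<And>a n. mixed_modular s r (\<lambda>z. \<Sum>i<n. a i * F i z) \<le>
      ennreal (C * (\<Sum>i<n. norm (a i) powr p) powr (s / p))"
  shows "isomorphically_embeds (lp_space p) (Ls_lr s r :: ('k, 'k mixed_L0) qn_space)"
proof (rule lp_embeds_if_basis_bounds[OF p complete_quasi_normed_Ls_lr[OF rs]])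
  let ?L = "Ls_lr s r :: ('k, 'k mixed_L0) qn_space"
  show "0 < c powr (1 / s)" using c by simp
  show "abs_mixed_L0 (F i) \<in> carrier ?L" for i
  proof -
    have "(\<Sum>j<Suc i. (if j = i then 1 else 0) * F j z) = F i z" for z by simp
    then have "mixed_modular s r (F i) \<le> ennreal (C * (\<Sum>j<Suc i. norm (if j = i then 1 else 0 :: 'k) powr p) powr (s / p))"
      using upper[where a = "\<lambda>j. if j = i then 1 else 0" and n = "Suc i"] by simp
    then have "mixed_modular s r (F i) < top" by (rule order_le_less_trans) simp
    then show ?thesis by (simp only: carrier_Ls_lr[OF F])
  qed
  fix a :: "nat \<Rightarrow> 'k" and n
  let ?N = "(\<Sum>i<n. norm (a i) powr p)"
  have N: "?N \<ge> 0" by (intro sum_nonneg) auto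
  have sum: "(\<Sum>i<n. scale ?L (a i) (abs_mixed_L0 (F i))) = abs_mixed_L0 (\<lambda>z. \<Sum>i<n. a i * F i z)"
    by (simp add: scale_Ls_lr sum_mixed_L0_abs)
  have "mixed_modular s r (\<lambda>z. \<Sum>i<n. a i * F i z) < top"
    using upper by (rule order_le_less_trans) simp
  then obtain t where t: "0 \<le> t" "mixed_modular s r (\<lambda>z. \<Sum>i<n. a i * F i z) = ennreal t"
    by (metis ennreal_cases less_irrefl)
  have q: "qnorm ?L (\<Sum>i<n. scale ?L (a i) (abs_mixed_L0 (F i))) = t powr (1 / s)"
    unfolding sum by (subst qnorm_Ls_lr) (simp_all add: t)
  have "c * ?N powr (s / p) \<le> t" using lower[where a = a and n = n] t c by (simp add: ennreal_le_iff)
  then have "(c * ?N powr (s / p)) powr (1 / s) \<le> t powr (1 / s)"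
    using rs c by (intro powr_mono2) auto
  then show "c powr (1 / s) * ?N powr (1 / p) \<le> qnorm ?L (\<Sum>i<n. scale ?L (a i) (abs_mixed_L0 (F i)))"
    unfolding q using rs p c by (simp add: powr_mult powr_powr)
  have "t \<le> C * ?N powr (s / p)" using upper[where a = a and n = n] t C by (simp add: ennreal_le_iff)
  then have "t powr (1 / s) \<le> (C * ?N powr (s / p)) powr (1 / s)"
    using rs t by (intro powr_mono2) auto
  then show "qnorm ?L (\<Sum>i<n. scale ?L (a i) (abs_mixed_L0 (F i))) \<le> C powr (1 / s) * ?N powr (1 / p)"
    unfolding q using rs p C by (simp add: powr_mult powr_powr)
qed

lemma measurable_fst_mixed [measurable]: "fst \<in> mixed_measure \<rightarrow>\<^sub>M unit_measure"
  and measurable_snd_mixed [measurable]: "snd \<in> mixed_measure \<rightarrow>\<^sub>M count_space UNIV"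
  unfolding mixed_measure_def by measurable

lemma emeasure_unit_space: "emeasure unit_measure (space unit_measure) = 1"
  by (rule unit.emeasure_space_1)

text \<open>
  The functions \<open>(x, n) \<mapsto> \<delta>\<^sub>n\<^sub>i\<close> do not depend on \<open>x\<close>, so only the inner sum remains.
\<close>

lemma lr_embeds:
  assumes rs: "0 < r" "0 < s"
  shows "isomorphically_embeds (lp_space r) (Ls_lr s r :: ('k::{real_normed_field, euclidean_space}, 'k mixed_L0) qn_space)"
proof (rule lp_embeds_Ls_lr_if_modular_bounds[where c = 1 and C = 1 and
      F = "\<lambda>i z. if snd z = i then 1 else (0::'k)"])
  show "(\<lambda>z. if snd z = i then 1 else (0::'k)) \<in> borel_measurable mixed_measure" for i
    by (rule measurable_compose[OF measurable_snd_mixed]) simp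
  have "mixed_modular s r (\<lambda>z. \<Sum>i<n. a i * (if snd z = i then 1 else 0)) =
      ennreal ((\<Sum>i<n. norm (a i) powr r) powr (s / r))" for a :: "nat \<Rightarrow> 'k" and n
  proof -
    have "(\<lambda>z :: real \<times> nat. \<Sum>i<n. a i * (if snd z = i then 1 else 0)) = restrict_coords {..<n} (\<lambda>z. a (snd z))"
      by (auto simp: fun_eq_iff restrict_coords_def if_distrib cong: if_cong)
    then have "mixed_modular s r (\<lambda>z. \<Sum>i<n. a i * (if snd z = i then 1 else 0)) =
        (\<integral>\<^sup>+x. ennreal ((\<Sum>i<n. norm (a i) powr r) powr (s / r)) \<partial>unit_measure)"
      using rs by (simp add: mixed_modular_def inner_sum_restrict_finite ennpowr_ennreal sum_nonneg)
    then show ?thesis by (simp only: nn_integral_const emeasure_unit_space mult_1_right)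
  qed
  then show "ennreal (1 * (\<Sum>i<n. norm (a i) powr r) powr (s / r)) \<le>
      mixed_modular s r (\<lambda>z. \<Sum>i<n. a i * (if snd z = i then 1 else 0))"
    "mixed_modular s r (\<lambda>z. \<Sum>i<n. a i * (if snd z = i then 1 else 0)) \<le>
      ennreal (1 * (\<Sum>i<n. norm (a i) powr r) powr (s / r))" for a :: "nat \<Rightarrow> 'k" and n
    by simp_all
qed (use rs in auto)

text \<open>
  \<open>L\<^sub>s\<close> is embedded as the functions supported on the coordinate \<open>n = 0\<close>.
\<close>

lemma lp_embeds_if_Ls_bounds:
  fixes f :: "nat \<Rightarrow> real \<Rightarrow> real"
  assumes rs: "0 < r" "0 < s" and p: "0 < p" and c: "0 < c" and C: "0 \<le> C"
    and f [measurable]: "\<And>i. f i \<in> borel_measurable borel"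
    and lower: "\<And>(a :: nat \<Rightarrow> 'k) n. ennreal (c * (\<Sum>i<n. norm (a i) powr p) powr (s / p)) \<le>
      (\<integral>\<^sup>+x. ennreal (norm (\<Sum>i<n. a i * of_real (f i x)) powr s) \<partial>unit_measure)"
    and upper: "\<And>(a :: nat \<Rightarrow> 'k) n. (\<integral>\<^sup>+x. ennreal (norm (\<Sum>i<n. a i * of_real (f i x)) powr s) \<partial>unit_measure) \<le>
      ennreal (C * (\<Sum>i<n. norm (a i) powr p) powr (s / p))"
  shows "isomorphically_embeds (lp_space p) (Ls_lr s r :: ('k::{real_normed_field, euclidean_space}, 'k mixed_L0) qn_space)"
proof (rule lp_embeds_Ls_lr_if_modular_bounds[OF rs p c C])
  define F where "F i = restrict_coords {0} (\<lambda>z. of_real (f i (fst z)) :: 'k)" for i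
  have "f i \<in> borel_measurable unit_measure" for i by measurable
  then have "(\<lambda>z. f i (fst z)) \<in> borel_measurable mixed_measure" for i
    by (rule measurable_compose[OF measurable_fst_mixed])
  moreover have "(of_real :: real \<Rightarrow> 'k) \<in> borel_measurable borel"
    by (intro borel_measurable_continuous_onI continuous_intros)
  ultimately have "(\<lambda>z. of_real (f i (fst z)) :: 'k) \<in> borel_measurable mixed_measure" for i
    by (rule measurable_compose)
  then show "F i \<in> borel_measurable mixed_measure" for i
    unfolding F_def by (rule measurable_restrict_coords)
  have eq: "mixed_modular s r (\<lambda>z. \<Sum>i<n. a i * F i z) =
      (\<integral>\<^sup>+x. ennreal (norm (\<Sum>i<n. a i * of_real (f i x)) powr s) \<partial>unit_measure)" for a n
  proof -
    have "(\<lambda>z. \<Sum>i<n. a i * F i z) = restrict_coords {0} (\<lambda>z. \<Sum>i<n. a i * of_real (f i (fst z)))"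
      by (auto simp: F_def restrict_coords_def fun_eq_iff)
    then show ?thesis
      using rs by (simp add: mixed_modular_def inner_sum_restrict_finite ennpowr_ennreal powr_powr)
  qed
  show "ennreal (c * (\<Sum>i<n. norm (a i) powr p) powr (s / p)) \<le> mixed_modular s r (\<lambda>z. \<Sum>i<n. a i * F i z)" for a n
    unfolding eq by (rule lower)
  show "mixed_modular s r (\<lambda>z. \<Sum>i<n. a i * F i z) \<le> ennreal (C * (\<Sum>i<n. norm (a i) powr p) powr (s / p))" for a n
    unfolding eq by (rule upper)
qed

text \<open>
  The \<open>s\<close>-th powers of disjointly supported functions add up, so normalized indicator functions of dyadic
  intervals span \<open>\<ell>\<^sub>s\<close>.
\<close>

lemma ls_embeds:
  assumes rs: "0 < r" "0 < s"
  shows "isomorphically_embeds (lp_space s) (Ls_lr s r :: ('k::{real_normed_field, euclidean_space}, 'k mixed_L0) qn_space)"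
proof (rule lp_embeds_if_Ls_bounds[where c = 1 and C = 1])
  define A where "A i = {(1/2) ^ Suc i..<(1/2) ^ i :: real}" for i :: nat
  define f where "f i x = 2 powr (real (Suc i) / s) * indicator (A i) x" for i x
  show "f i \<in> borel_measurable borel" for i unfolding f_def A_def by measurable
  have disj: "x \<notin> A j" if "x \<in> A i" "i \<noteq> j" for i j x
  proof -
    have le: "(1/2) ^ l \<le> ((1/2) ^ Suc k :: real)" if "k < l" for k l
      using that by (intro power_decreasing) auto
    show ?thesis
    proof (cases "i < j")
      case True
      then show ?thesis using that le[of i j] by (auto simp: A_def)
    next
      case False
      then show ?thesis using that le[of j i] by (auto simp: A_def)
    qed
  qed
  have pt: "norm (\<Sum>i<n. a i * of_real (f i x)) powr s = (\<Sum>i<n. norm (a i) powr s * (2 ^ Suc i * indicator (A i) x))"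
    for a :: "nat \<Rightarrow> 'k" and n x
  proof (cases "\<exists>k<n. x \<in> A k")
    case True
    then obtain k where k: "k < n" "x \<in> A k" by blast
    have z: "f i x = 0" "indicator (A i) x = (0::real)" if "i \<in> {..<n} - {k}" for i
      using disj[OF k(2), of i] that by (auto simp: f_def)
    have "(\<Sum>i<n. a i * of_real (f i x)) = a k * of_real (f k x)"
      using k z by (subst sum.remove[of _ k]) auto
    moreover have "(\<Sum>i<n. norm (a i) powr s * (2 ^ Suc i * indicator (A i) x)) = norm (a k) powr s * 2 ^ Suc k"
      using k z by (subst sum.remove[of _ k]) auto
    moreover have "norm (a k * of_real (f k x)) powr s = norm (a k) powr s * 2 powr real (Suc k)"
      using k rs by (simp add: f_def norm_mult powr_mult powr_powr)
    ultimately show ?thesis by (simp only: powr_realpow)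
  next
    case False
    then show ?thesis by (auto simp: f_def)
  qed
  have one: "(\<integral>\<^sup>+x. ennreal (2 ^ Suc i * indicator (A i) x) \<partial>unit_measure) = 1" for i
  proof -
    have sub: "A i \<subseteq> {0..<1}" by (auto simp: A_def intro: order.trans[rotated] less_le_trans power_le_one)
    have "(\<integral>\<^sup>+x. ennreal (2 ^ Suc i * indicator (A i) x) \<partial>unit_measure) =
        (\<integral>\<^sup>+x. ennreal (2 ^ Suc i) * indicator (A i) x \<partial>lborel)"
      unfolding nn_integral_unit using sub by (intro nn_integral_cong) (auto simp: indicator_def)
    also have "\<dots> = ennreal (2 ^ Suc i) * emeasure lborel (A i)"
      by (rule nn_integral_cmult_indicator) (simp add: A_def)
    also have "emeasure lborel (A i) = ennreal ((1/2) ^ Suc i)"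
      unfolding A_def by (subst emeasure_lborel_Ico) auto
    also have "ennreal (2 ^ Suc i) * ennreal ((1/2) ^ Suc i) = ennreal (2 ^ Suc i * (1/2) ^ Suc i)"
      by (rule ennreal_mult[symmetric]) auto
    also have "2 ^ Suc i * (1/2) ^ Suc i = (1::real)" by (simp only: power_mult_distrib[symmetric]) simp
    finally show ?thesis by simp
  qed
  have [measurable]: "A i \<in> sets borel" for i unfolding A_def by simp
  have "(\<integral>\<^sup>+x. ennreal (norm (\<Sum>i<n. a i * of_real (f i x)) powr s) \<partial>unit_measure) =
      ennreal (\<Sum>i<n. norm (a i) powr s)" for a :: "nat \<Rightarrow> 'k" and n
  proof -
    have "(\<integral>\<^sup>+x. ennreal (norm (\<Sum>i<n. a i * of_real (f i x)) powr s) \<partial>unit_measure) =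
        (\<integral>\<^sup>+x. (\<Sum>i<n. ennreal (norm (a i) powr s) * ennreal (2 ^ Suc i * indicator (A i) x)) \<partial>unit_measure)"
      unfolding pt by (intro nn_integral_cong) (simp add: sum_ennreal[symmetric] ennreal_mult)
    also have "\<dots> = (\<Sum>i<n. ennreal (norm (a i) powr s) * (\<integral>\<^sup>+x. ennreal (2 ^ Suc i * indicator (A i) x) \<partial>unit_measure))"
      by (subst nn_integral_sum) (auto intro!: sum.cong nn_integral_cmult)
    also have "\<dots> = ennreal (\<Sum>i<n. norm (a i) powr s)" unfolding one by (simp add: sum_ennreal)
    finally show ?thesis .
  qed
  then show "ennreal (1 * (\<Sum>i<n. norm (a i) powr s) powr (s / s)) \<le>
      (\<integral>\<^sup>+x. ennreal (norm (\<Sum>i<n. a i * of_real (f i x)) powr s) \<partial>unit_measure)"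
    "(\<integral>\<^sup>+x. ennreal (norm (\<Sum>i<n. a i * of_real (f i x)) powr s) \<partial>unit_measure) \<le>
      ennreal (1 * (\<Sum>i<n. norm (a i) powr s) powr (s / s))" for a :: "nat \<Rightarrow> 'k" and n
    using rs by (simp_all add: sum_nonneg)
qed (use rs in auto)

text \<open>
  Changing signs does not change the integral on the left. So it equals its mean over all signs, and Khinchine's
  inequality applies at each point.
\<close>

lemma symmetric_seq_square_function:
  assumes s: "0 < s" and w [measurable]: "w \<in> borel_measurable borel"
  obtains c C where "c > 0" "C > 0"
    "\<And>(a :: nat \<Rightarrow> 'k::{real_normed_field, euclidean_space}) n.
      ennreal c * (\<integral>\<^sup>+x. ennreal ((\<Sum>i<n. (norm (a i) * symmetric_seq w i x)\<^sup>2) powr (s / 2)) \<partial>unit_measure) \<le>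
      (\<integral>\<^sup>+x. ennreal (norm (\<Sum>i<n. a i * of_real (symmetric_seq w i x)) powr s) \<partial>unit_measure)"
    "\<And>(a :: nat \<Rightarrow> 'k) n.
      (\<integral>\<^sup>+x. ennreal (norm (\<Sum>i<n. a i * of_real (symmetric_seq w i x)) powr s) \<partial>unit_measure) \<le>
      ennreal C * (\<integral>\<^sup>+x. ennreal ((\<Sum>i<n. (norm (a i) * symmetric_seq w i x)\<^sup>2) powr (s / 2)) \<partial>unit_measure)"
proof -
  obtain c C where cC: "c > 0" "C > 0"
    and low: "\<And>(S::nat set) (z :: nat \<Rightarrow> nat \<Rightarrow> 'k). finite S \<Longrightarrow>
      c * (\<Sum>i\<in>S. \<Sum>n\<in>{0::nat}. (norm (z i n))\<^sup>2) powr (s / 2) \<le>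
      (\<Sum>A\<in>Pow S. (\<Sum>n\<in>{0::nat}. norm (signed_sum S A (\<lambda>i. z i n)) powr 1) powr (s / 1)) / 2 ^ card S"
    and up: "\<And>(S::nat set) (z :: nat \<Rightarrow> nat \<Rightarrow> 'k). finite S \<Longrightarrow>
      (\<Sum>A\<in>Pow S. (\<Sum>n\<in>{0::nat}. norm (signed_sum S A (\<lambda>i. z i n)) powr 1) powr (s / 1)) / 2 ^ card S \<le>
      C * (\<Sum>i\<in>S. \<Sum>n\<in>{0::nat}. (norm (z i n))\<^sup>2) powr (s / 2)"
    using khinchine_tuple[of "{0::nat}" 1 s] s by (metis finite.emptyI finite.insertI zero_less_one)
  let ?Y = "symmetric_seq w"
  define W where "W a n x = (\<Sum>i<n. (norm (a i) * ?Y i x)\<^sup>2) powr (s / 2)" for a :: "nat \<Rightarrow> 'k" and n x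
  define G where "G a n A x = norm (signed_sum {..<n} A (\<lambda>i. a i * of_real (?Y i x))) powr s"
    for a :: "nat \<Rightarrow> 'k" and n :: nat and A x
  have [measurable]: "W a n \<in> borel_measurable unit_measure" for a n unfolding W_def by measurable
  have G_eq: "G a n A x = norm (\<Sum>i<n. a i * of_real (if i \<in> A then ?Y i x else - ?Y i x)) powr s" for a n A x
    unfolding G_def signed_sum_def by (intro arg_cong2[where f = "(powr)"] arg_cong[where f = norm] sum.cong) auto
  have [measurable]: "(\<lambda>x. if i \<in> A then ?Y i x else - ?Y i x) \<in> borel_measurable borel" for i A
    by (cases "i \<in> A") auto
  have [measurable]: "G a n A \<in> borel_measurable unit_measure" for a n A
    unfolding G_eq[abs_def] by measurable
  have nz: "(norm (a i * of_real (?Y i x)))\<^sup>2 = (norm (a i) * ?Y i x)\<^sup>2" for a :: "nat \<Rightarrow> 'k" and i x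
    by (simp add: norm_mult power_mult_distrib)
  have low': "c * W a n x \<le> (\<Sum>A\<in>Pow {..<n}. G a n A x) / 2 ^ n" for a n x
    using low[of "{..<n}" "\<lambda>i _. a i * of_real (?Y i x)"] by (simp add: W_def G_def nz)
  have up': "(\<Sum>A\<in>Pow {..<n}. G a n A x) / 2 ^ n \<le> C * W a n x" for a n x
    using up[of "{..<n}" "\<lambda>i _. a i * of_real (?Y i x)"] by (simp add: W_def G_def nz)
  define I where "I a n = (\<integral>\<^sup>+x. ennreal (norm (\<Sum>i<n. a i * of_real (?Y i x)) powr s) \<partial>unit_measure)"
    for a :: "nat \<Rightarrow> 'k" and n
  have GI: "(\<integral>\<^sup>+x. ennreal (G a n A x) \<partial>unit_measure) = I a n" for a n A
  proof -
    have "(\<lambda>\<omega>. ennreal (norm (\<Sum>i<n. a i * of_real (\<omega> i)) powr s)) \<in> borel_measurable (PiM UNIV (\<lambda>_. borel))"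
      by measurable
    from symmetric_seq_sign_invariant[OF w this, of A] show ?thesis unfolding G_eq I_def .
  qed
  have avg: "(\<integral>\<^sup>+x. ennreal ((\<Sum>A\<in>Pow {..<n}. G a n A x) / 2 ^ n) \<partial>unit_measure) = I a n" for a n
  proof -
    have "ennreal ((\<Sum>A\<in>Pow {..<n}. G a n A x) / 2 ^ n) = (\<Sum>A\<in>Pow {..<n}. ennreal (1 / 2 ^ n) * ennreal (G a n A x))" for x
    proof -
      have "(\<Sum>A\<in>Pow {..<n}. ennreal (1 / 2 ^ n) * ennreal (G a n A x)) = (\<Sum>A\<in>Pow {..<n}. ennreal (1 / 2 ^ n * G a n A x))"
        by (intro sum.cong refl ennreal_mult[symmetric]) (auto simp: G_def)
      also have "\<dots> = ennreal (\<Sum>A\<in>Pow {..<n}. 1 / 2 ^ n * G a n A x)"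
        by (rule sum_ennreal) (simp add: G_def)
      finally show ?thesis by (simp add: sum_divide_distrib)
    qed
    then have "(\<integral>\<^sup>+x. ennreal ((\<Sum>A\<in>Pow {..<n}. G a n A x) / 2 ^ n) \<partial>unit_measure) =
        (\<Sum>A\<in>Pow {..<n}. ennreal (1 / 2 ^ n) * (\<integral>\<^sup>+x. ennreal (G a n A x) \<partial>unit_measure))"
      by (simp only:) (subst nn_integral_sum; auto intro!: sum.cong nn_integral_cmult)
    also have "\<dots> = of_nat (2 ^ n) * (ennreal (1 / 2 ^ n) * I a n)"
      by (simp add: GI card_Pow)
    also have "\<dots> = (ennreal (2 ^ n) * ennreal (1 / 2 ^ n)) * I a n"
      by (simp add: mult.assoc ennreal_power[symmetric])
    also have "ennreal (2 ^ n) * ennreal (1 / 2 ^ n) = 1" by (subst ennreal_mult[symmetric]) auto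
    finally show ?thesis by simp
  qed
  have cW: "(\<integral>\<^sup>+x. ennreal (t * W a n x) \<partial>unit_measure) = ennreal t * (\<integral>\<^sup>+x. ennreal (W a n x) \<partial>unit_measure)"
    if "t > 0" for t a n
    using that by (simp add: ennreal_mult W_def nn_integral_cmult)
  show ?thesis
  proof (rule that[OF cC])
    fix a :: "nat \<Rightarrow> 'k" and n
    show "ennreal c * (\<integral>\<^sup>+x. ennreal ((\<Sum>i<n. (norm (a i) * ?Y i x)\<^sup>2) powr (s / 2)) \<partial>unit_measure) \<le>
      (\<integral>\<^sup>+x. ennreal (norm (\<Sum>i<n. a i * of_real (?Y i x)) powr s) \<partial>unit_measure)"
      unfolding W_def[symmetric] I_def[symmetric] cW[OF cC(1), symmetric] avg[symmetric]
      by (intro nn_integral_mono ennreal_leI low')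
    show "(\<integral>\<^sup>+x. ennreal (norm (\<Sum>i<n. a i * of_real (?Y i x)) powr s) \<partial>unit_measure) \<le>
      ennreal C * (\<integral>\<^sup>+x. ennreal ((\<Sum>i<n. (norm (a i) * ?Y i x)\<^sup>2) powr (s / 2)) \<partial>unit_measure)"
      unfolding W_def[symmetric] I_def[symmetric] cW[OF cC(2), symmetric] avg[symmetric]
      by (intro nn_integral_mono ennreal_leI up')
  qed
qed

lemma lp_embeds_if_square_function_bounds:
  assumes rs: "0 < r" "0 < s" and p: "0 < p" and c: "0 < c" and C: "0 < C"
    and w [measurable]: "w \<in> borel_measurable borel"
    and lower: "\<And>(a :: nat \<Rightarrow> real) n. (\<And>i. 0 \<le> a i) \<Longrightarrow> ennreal (c * (\<Sum>i<n. a i powr p) powr (s / p)) \<le>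
      (\<integral>\<^sup>+x. ennreal ((\<Sum>i<n. (a i * symmetric_seq w i x)\<^sup>2) powr (s / 2)) \<partial>unit_measure)"
    and upper: "\<And>(a :: nat \<Rightarrow> real) n. (\<And>i. 0 \<le> a i) \<Longrightarrow>
      (\<integral>\<^sup>+x. ennreal ((\<Sum>i<n. (a i * symmetric_seq w i x)\<^sup>2) powr (s / 2)) \<partial>unit_measure) \<le>
      ennreal (C * (\<Sum>i<n. a i powr p) powr (s / p))"
  shows "isomorphically_embeds (lp_space p) (Ls_lr s r :: ('k::{real_normed_field, euclidean_space}, 'k mixed_L0) qn_space)"
proof (rule symmetric_seq_square_function[OF rs(2) w])
  let ?Y = "symmetric_seq w"
  fix k K :: real
  assume kK: "k > 0" "K > 0"
    and low: "\<And>(a :: nat \<Rightarrow> 'k) n.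
      ennreal k * (\<integral>\<^sup>+x. ennreal ((\<Sum>i<n. (norm (a i) * ?Y i x)\<^sup>2) powr (s / 2)) \<partial>unit_measure) \<le>
      (\<integral>\<^sup>+x. ennreal (norm (\<Sum>i<n. a i * of_real (?Y i x)) powr s) \<partial>unit_measure)"
    and up: "\<And>(a :: nat \<Rightarrow> 'k) n.
      (\<integral>\<^sup>+x. ennreal (norm (\<Sum>i<n. a i * of_real (?Y i x)) powr s) \<partial>unit_measure) \<le>
      ennreal K * (\<integral>\<^sup>+x. ennreal ((\<Sum>i<n. (norm (a i) * ?Y i x)\<^sup>2) powr (s / 2)) \<partial>unit_measure)"
  show ?thesis
  proof (rule lp_embeds_if_Ls_bounds[where f = ?Y and c = "k * c" and C = "K * C"])
    fix a :: "nat \<Rightarrow> 'k" and n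
    let ?N = "(\<Sum>i<n. norm (a i) powr p) powr (s / p)"
    have "ennreal (k * c * ?N) = ennreal k * ennreal (c * ?N)"
      using kK c by (subst ennreal_mult[symmetric]) (auto simp: mult.assoc)
    also have "\<dots> \<le> ennreal k *
        (\<integral>\<^sup>+x. ennreal ((\<Sum>i<n. (norm (a i) * ?Y i x)\<^sup>2) powr (s / 2)) \<partial>unit_measure)"
      by (intro mult_left_mono lower) auto
    also note low
    finally show "ennreal (k * c * ?N) \<le>
        (\<integral>\<^sup>+x. ennreal (norm (\<Sum>i<n. a i * of_real (?Y i x)) powr s) \<partial>unit_measure)" .
    note up
    also have "ennreal K *
        (\<integral>\<^sup>+x. ennreal ((\<Sum>i<n. (norm (a i) * ?Y i x)\<^sup>2) powr (s / 2)) \<partial>unit_measure) \<le>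
        ennreal K * ennreal (C * ?N)"
      by (intro mult_left_mono upper) auto
    also have "\<dots> = ennreal (K * C * ?N)"
      using kK C by (subst ennreal_mult[symmetric]) (auto simp: mult.assoc)
    finally show "(\<integral>\<^sup>+x. ennreal (norm (\<Sum>i<n. a i * of_real (?Y i x)) powr s) \<partial>unit_measure) \<le>
        ennreal (K * C * ?N)" .
  qed (use rs p kK c C in auto)
qed

text \<open>
  With \<open>w = 1\<close> the variables are independent signs, and the square function is constant.
\<close>

lemma l2_embeds:
  assumes rs: "0 < r" "0 < s"
  shows "isomorphically_embeds (lp_space 2) (Ls_lr s r :: ('k::{real_normed_field, euclidean_space}, 'k mixed_L0) qn_space)"
proof (rule lp_embeds_if_square_function_bounds[where w = "\<lambda>_. 1" and c = 1 and C = 1])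
  have one: "(symmetric_seq (\<lambda>_. 1) i x)\<^sup>2 = 1" for i x by (simp add: symmetric_seq_def Let_def)
  have "(\<integral>\<^sup>+x. ennreal ((\<Sum>i<n. (a i * symmetric_seq (\<lambda>_. 1) i x)\<^sup>2) powr (s / 2)) \<partial>unit_measure) =
      ennreal ((\<Sum>i<n. a i powr 2) powr (s / 2))" if "\<And>i. 0 \<le> a i" for a :: "nat \<Rightarrow> real" and n
  proof -
    have "(\<Sum>i<n. (a i * symmetric_seq (\<lambda>_. 1) i x)\<^sup>2) = (\<Sum>i<n. a i powr 2)" for x
      using that by (intro sum.cong) (auto simp: power_mult_distrib one)
    then show ?thesis by (simp only: nn_integral_const emeasure_unit_space mult_1_right)
  qed
  then show "ennreal (1 * (\<Sum>i<n. a i powr 2) powr (s / 2)) \<le>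
      (\<integral>\<^sup>+x. ennreal ((\<Sum>i<n. (a i * symmetric_seq (\<lambda>_. 1) i x)\<^sup>2) powr (s / 2)) \<partial>unit_measure)"
    "(\<integral>\<^sup>+x. ennreal ((\<Sum>i<n. (a i * symmetric_seq (\<lambda>_. 1) i x)\<^sup>2) powr (s / 2)) \<partial>unit_measure) \<le>
      ennreal (1 * (\<Sum>i<n. a i powr 2) powr (s / 2))" if "\<And>i. 0 \<le> a i" for a :: "nat \<Rightarrow> real" and n
    using that by (simp_all only: mult_1_left order.refl)
qed (use rs in auto)

text \<open>
  For \<open>v\<close> uniform on the unit interval this variable has the tail \<open>t\<^bsup>-p\<^esup>\<close>, \<open>t \<ge> 1\<close>.
\<close>

definition pareto_quantile :: "real \<Rightarrow> real \<Rightarrow> real" where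
  "pareto_quantile p v = v powr (- 1 / p)"

lemma measurable_pareto_quantile [measurable]: "pareto_quantile p \<in> borel_measurable borel"
  unfolding pareto_quantile_def by measurable

lemma pareto_quantile_scaled_less_one_iff:
  assumes "0 < p" "0 < v" "0 \<le> t"
  shows "t * pareto_quantile p v < 1 \<longleftrightarrow> t powr p < v"
proof -
  have e: "pareto_quantile p v = 1 / v powr (1 / p)"
    by (simp add: pareto_quantile_def powr_minus_divide)
  have v: "(v powr (1 / p)) powr p = v" using assms by (simp add: powr_powr)
  have "t * pareto_quantile p v < 1 \<longleftrightarrow> t < v powr (1 / p)"
    using assms by (simp add: e)
  also have "\<dots> \<longleftrightarrow> t powr p < (v powr (1 / p)) powr p"
  proof
    assume "t < v powr (1 / p)"
    then show "t powr p < (v powr (1 / p)) powr p" using assms by (intro powr_less_mono2) auto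
  next
    assume "t powr p < (v powr (1 / p)) powr p"
    then show "t < v powr (1 / p)" using assms powr_mono2[of p "v powr (1 / p)" t] by force
  qed
  finally show ?thesis unfolding v .
qed

lemma nn_integral_symmetric_seq_even:
  fixes f :: "real \<Rightarrow> ennreal"
  assumes [measurable]: "w \<in> borel_measurable borel" "f \<in> borel_measurable borel" and even: "\<And>y. f (- y) = f y"
  shows "(\<integral>\<^sup>+x. f (symmetric_seq w i x) \<partial>unit_measure) = (\<integral>\<^sup>+x. f (w x) \<partial>unit_measure)"
proof -
  have half: "ennreal (1/2) + ennreal (1/2) = 1" by (subst ennreal_plus[symmetric]) simp_all
  have "(\<integral>\<^sup>+x. f (symmetric_seq w i x) \<partial>unit_measure) =
      (ennreal (1/2) + ennreal (1/2)) * (\<integral>\<^sup>+x. f (w x) \<partial>unit_measure)"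
    by (subst nn_integral_symmetric_seq) (simp_all only: even distrib_right assms(1,2))
  then show ?thesis unfolding half by simp
qed

lemma AE_unit_positive: "AE v in unit_measure. 0 < v \<and> v < 1"
proof -
  have "AE v in lebesgue. v \<noteq> (0::real)"
    using AE_completion[OF AE_lborel_singleton[of "0::real"]] by simp
  then have "AE v in lebesgue. v \<in> {0..1} \<longrightarrow> v \<noteq> (0::real)" by eventually_elim auto
  then have "AE v in unit_measure. v \<noteq> 0" by (subst AE_restrict_space_iff) auto
  with AE_unit_less_one show ?thesis by eventually_elim auto
qed

lemma nn_integral_unit_le:
  assumes AE: "AE v in unit_measure. f v \<le> ennreal (g v) * indicator A v"
    and g: "\<And>v. v \<in> A \<Longrightarrow> 0 \<le> g v" "(g has_integral I) A"
  shows "(\<integral>\<^sup>+v. f v \<partial>unit_measure) \<le> ennreal I"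
proof -
  have "(\<integral>\<^sup>+v. f v \<partial>unit_measure) \<le> (\<integral>\<^sup>+v. ennreal (g v) * indicator A v \<partial>unit_measure)"
    by (rule nn_integral_mono_AE[OF AE])
  also have "\<dots> \<le> (\<integral>\<^sup>+v. ennreal (g v) * indicator A v \<partial>lborel)"
    unfolding nn_integral_unit by (intro nn_integral_mono) (auto simp: indicator_def)
  also have "\<dots> = ennreal I" by (rule nn_integral_has_integral_lebesgue'[OF g])
  finally show ?thesis .
qed

text \<open>
  Below the truncation the second moment is finite and proportional to \<open>t\<^sup>p\<close>, because \<open>p < 2\<close>.
\<close>

lemma pareto_small_part:
  assumes p: "0 < p" "p < 2" and t: "0 \<le> t"
  shows "(\<integral>\<^sup>+x. ennreal (if \<bar>t * symmetric_seq (pareto_quantile p) i x\<bar> < 1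
      then (t * symmetric_seq (pareto_quantile p) i x)\<^sup>2 else 0) \<partial>unit_measure) \<le> ennreal (t powr p / (2 / p - 1))"
proof (cases "t = 0")
  case False
  then have t0: "t > 0" using t by simp
  define f where "f y = ennreal (if \<bar>t * y\<bar> < 1 then (t * y)\<^sup>2 else 0)" for y
  have [measurable]: "f \<in> borel_measurable borel" unfolding f_def by measurable
  have "(\<integral>\<^sup>+x. f (symmetric_seq (pareto_quantile p) i x) \<partial>unit_measure) = (\<integral>\<^sup>+v. f (pareto_quantile p v) \<partial>unit_measure)"
    by (rule nn_integral_symmetric_seq_even) (auto simp: f_def)
  also have "\<dots> \<le> ennreal (t\<^sup>2 * (- ((t powr p) powr (- 2 / p + 1)) / (- 2 / p + 1)))"
  proof (rule nn_integral_unit_le[where A = "{t powr p..}" and g = "\<lambda>v. t\<^sup>2 * v powr (- 2 / p)"])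
    have "- 2 / p < - 1" using p by (simp add: field_simps)
    then show "((\<lambda>v. t\<^sup>2 * v powr (- 2 / p)) has_integral
        t\<^sup>2 * (- ((t powr p) powr (- 2 / p + 1)) / (- 2 / p + 1))) {t powr p..}"
      using t0 by (intro has_integral_mult_right has_integral_powr_to_inf) auto
    show "AE v in unit_measure. f (pareto_quantile p v) \<le>
        ennreal (t\<^sup>2 * v powr (- 2 / p)) * indicator {t powr p..} v"
      using AE_unit_positive
    proof eventually_elim
      case (elim v)
      have sq: "(pareto_quantile p v)\<^sup>2 = v powr (- 2 / p)"
        using elim by (simp add: pareto_quantile_def power2_eq_square powr_add[symmetric])
      have nn: "0 \<le> t * pareto_quantile p v" using t by (simp add: pareto_quantile_def)
      show ?case
        using pareto_quantile_scaled_less_one_iff[OF p(1), of v t] elim t nn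
        by (auto simp: f_def power_mult_distrib sq indicator_def)
    qed
  qed auto
  also have "t\<^sup>2 * (- ((t powr p) powr (- 2 / p + 1)) / (- 2 / p + 1)) = t powr p / (2 / p - 1)"
  proof -
    have "p * (- 2 / p + 1) = p - 2" using p by (simp add: field_simps)
    then have "(t powr p) powr (- 2 / p + 1) = t powr (p - 2)" by (simp only: powr_powr)
    also have "\<dots> = t powr p / t\<^sup>2" using t0 by (simp add: powr_diff)
    finally have e: "(t powr p) powr (- 2 / p + 1) = t powr p / t\<^sup>2" .
    define D where "D = 2 / p - 1"
    have d: "- 2 / p + 1 = - D" by (simp add: D_def)
    show ?thesis using e t0 unfolding d D_def[symmetric] by simp
  qed
  finally show ?thesis by (simp only: f_def)
qed simp

text \<open>
  Above the truncation the \<open>s\<close>-th moment is finite and proportional to \<open>t\<^sup>p\<close>, because \<open>s < p\<close>.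
\<close>

lemma pareto_large_part:
  assumes p: "0 < s" "s < p" and t: "0 \<le> t"
  shows "(\<integral>\<^sup>+x. ennreal (if \<bar>t * symmetric_seq (pareto_quantile p) i x\<bar> < 1
      then 0 else \<bar>t * symmetric_seq (pareto_quantile p) i x\<bar> powr s) \<partial>unit_measure) \<le> ennreal (t powr p / (1 - s / p))"
proof (cases "t = 0")
  case False
  then have t0: "t > 0" using t by simp
  have p0: "p > 0" using p by simp
  define f where "f y = ennreal (if \<bar>t * y\<bar> < 1 then 0 else \<bar>t * y\<bar> powr s)" for y
  have [measurable]: "f \<in> borel_measurable borel" unfolding f_def by measurable
  have "(\<integral>\<^sup>+x. f (symmetric_seq (pareto_quantile p) i x) \<partial>unit_measure) = (\<integral>\<^sup>+v. f (pareto_quantile p v) \<partial>unit_measure)"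
    by (rule nn_integral_symmetric_seq_even) (auto simp: f_def)
  also have "\<dots> \<le> ennreal (t powr s * ((t powr p) powr (- s / p + 1) / (- s / p + 1)))"
  proof (rule nn_integral_unit_le[where A = "{0..t powr p}" and g = "\<lambda>v. t powr s * v powr (- s / p)"])
    have "- 1 < - s / p" using p by (simp add: field_simps)
    then show "((\<lambda>v. t powr s * v powr (- s / p)) has_integral
        t powr s * ((t powr p) powr (- s / p + 1) / (- s / p + 1))) {0..t powr p}"
      by (intro has_integral_mult_right has_integral_powr_from_0) auto
    show "AE v in unit_measure. f (pareto_quantile p v) \<le>
        ennreal (t powr s * v powr (- s / p)) * indicator {0..t powr p} v"
      using AE_unit_positive
    proof eventually_elim
      case (elim v)
      have sq: "pareto_quantile p v powr s = v powr (- s / p)"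
        by (simp add: pareto_quantile_def powr_powr)
      have nn: "0 \<le> t * pareto_quantile p v" using t by (simp add: pareto_quantile_def)
      have "0 \<le> pareto_quantile p v" by (simp add: pareto_quantile_def)
      then have "(t * pareto_quantile p v) powr s = t powr s * v powr (- s / p)"
        using t by (simp add: powr_mult sq)
      then show ?case
        using pareto_quantile_scaled_less_one_iff[OF p0, of v t] elim t nn
        by (auto simp: f_def indicator_def)
    qed
  qed auto
  also have "t powr s * ((t powr p) powr (- s / p + 1) / (- s / p + 1)) = t powr p / (1 - s / p)"
  proof -
    have e: "t powr s * (t powr p) powr (- s / p + 1) = t powr p"
    proof -
      have "s + p * (- s / p + 1) = p" using p0 by (simp add: field_simps)
      then show ?thesis by (simp only: powr_powr powr_add[symmetric])
    qed
    have d: "- s / p + 1 = 1 - s / p" by simp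
    show ?thesis using e unfolding d by (simp only: times_divide_eq_right)
  qed
  finally show ?thesis by (simp only: f_def)
qed simp

text \<open>
  The entries of the square function below one are summed up in \<open>S\<close>, the others in \<open>L\<close>. As \<open>s \<le> 2\<close>, the power
  \<open>s/2\<close> is subadditive, and it is at most linear above one.
\<close>

lemma pareto_square_function_upper:
  assumes sp: "0 < s" "s < p" "p < 2" and a: "\<And>i. 0 \<le> a i" and sum: "(\<Sum>i<n. a i powr p) = 1"
  shows "(\<integral>\<^sup>+x. ennreal ((\<Sum>i<n. (a i * symmetric_seq (pareto_quantile p) i x)\<^sup>2) powr (s / 2)) \<partial>unit_measure) \<le>
    ennreal (1 + 1 / (2 / p - 1) + 1 / (1 - s / p))"
proof -
  let ?Y = "symmetric_seq (pareto_quantile p)"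
  have p: "0 < p" using sp by simp
  define S where "S i x = (if \<bar>a i * ?Y i x\<bar> < 1 then (a i * ?Y i x)\<^sup>2 else 0)" for i x
  define L where "L i x = (if \<bar>a i * ?Y i x\<bar> < 1 then 0 else \<bar>a i * ?Y i x\<bar> powr s)" for i x
  have [measurable]: "S i \<in> borel_measurable borel" "L i \<in> borel_measurable borel" for i
    unfolding S_def L_def by measurable
  have SL: "S i x \<ge> 0" "L i x \<ge> 0" for i x by (auto simp: S_def L_def)
  have pt: "(\<Sum>i<n. (a i * ?Y i x)\<^sup>2) powr (s / 2) \<le> 1 + (\<Sum>i<n. S i x) + (\<Sum>i<n. L i x)" for x
  proof -
    let ?l = "\<lambda>i. if \<bar>a i * ?Y i x\<bar> < 1 then 0 else (a i * ?Y i x)\<^sup>2"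
    have split: "(\<Sum>i<n. (a i * ?Y i x)\<^sup>2) = (\<Sum>i<n. S i x) + (\<Sum>i<n. ?l i)"
      unfolding sum.distrib[symmetric] S_def by (intro sum.cong) auto
    have add: "(u + v) powr (s / 2) \<le> u powr (s / 2) + v powr (s / 2)" if "0 \<le> u" "0 \<le> v" for u v :: real
      using powr_sum_le_sum_powr[of "{True, False}" "\<lambda>b. if b then u else v" "s / 2"] that sp by simp
    have "(\<Sum>i<n. (a i * ?Y i x)\<^sup>2) powr (s / 2) \<le> (\<Sum>i<n. S i x) powr (s / 2) + (\<Sum>i<n. ?l i) powr (s / 2)"
      unfolding split by (intro add sum_nonneg) (auto simp: SL)
    also have "(\<Sum>i<n. ?l i) powr (s / 2) \<le> (\<Sum>i<n. ?l i powr (s / 2))"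
      using sp by (intro powr_sum_le_sum_powr) auto
    also have "(\<Sum>i<n. ?l i powr (s / 2)) = (\<Sum>i<n. L i x)"
    proof (intro sum.cong refl)
      fix i
      have "((a i * ?Y i x)\<^sup>2) powr (s / 2) = (\<bar>a i * ?Y i x\<bar> powr 2) powr (s / 2)" by simp
      also have "\<dots> = \<bar>a i * ?Y i x\<bar> powr s" unfolding powr_powr by simp
      finally show "?l i powr (s / 2) = L i x" by (simp add: L_def)
    qed
    also have "(\<Sum>i<n. S i x) powr (s / 2) \<le> 1 + (\<Sum>i<n. S i x)"
    proof (cases "(\<Sum>i<n. S i x) \<le> 1")
      case True
      then have "(\<Sum>i<n. S i x) powr (s / 2) \<le> 1 powr (s / 2)"
        using sp SL by (intro powr_mono2 sum_nonneg) auto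
      moreover have "0 \<le> (\<Sum>i<n. S i x)" using SL by (intro sum_nonneg) auto
      ultimately show ?thesis by simp
    next
      case False
      then have "(\<Sum>i<n. S i x) powr (s / 2) \<le> (\<Sum>i<n. S i x) powr 1"
        using sp by (intro powr_mono) auto
      then show ?thesis using False by simp
    qed
    finally show ?thesis by simp
  qed
  have "(\<integral>\<^sup>+x. ennreal ((\<Sum>i<n. (a i * ?Y i x)\<^sup>2) powr (s / 2)) \<partial>unit_measure) \<le>
      (\<integral>\<^sup>+x. 1 + (\<Sum>i<n. ennreal (S i x)) + (\<Sum>i<n. ennreal (L i x)) \<partial>unit_measure)"
  proof (rule nn_integral_mono)
    fix x
    have "1 + (\<Sum>i<n. ennreal (S i x)) + (\<Sum>i<n. ennreal (L i x)) =
        ennreal (1 + (\<Sum>i<n. S i x) + (\<Sum>i<n. L i x))"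
      using SL by (simp add: sum_ennreal ennreal_plus sum_nonneg)
    then show "ennreal ((\<Sum>i<n. (a i * ?Y i x)\<^sup>2) powr (s / 2)) \<le>
        1 + (\<Sum>i<n. ennreal (S i x)) + (\<Sum>i<n. ennreal (L i x))"
      using ennreal_leI[OF pt[of x]] by simp
  qed
  also have "\<dots> = 1 + (\<Sum>i<n. \<integral>\<^sup>+x. ennreal (S i x) \<partial>unit_measure) + (\<Sum>i<n. \<integral>\<^sup>+x. ennreal (L i x) \<partial>unit_measure)"
    using emeasure_unit_space by (simp add: nn_integral_add nn_integral_sum)
  also have "\<dots> \<le> 1 + (\<Sum>i<n. ennreal (a i powr p / (2 / p - 1))) + (\<Sum>i<n. ennreal (a i powr p / (1 - s / p)))"
    unfolding S_def L_def
    by (intro add_mono sum_mono order.refl pareto_small_part pareto_large_part a p sp)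
  also have "\<dots> = 1 + ennreal (1 / (2 / p - 1)) + ennreal (1 / (1 - s / p))"
    using sp p sum by (simp add: sum_ennreal sum_divide_distrib[symmetric])
  also have "\<dots> = ennreal (1 + 1 / (2 / p - 1) + 1 / (1 - s / p))"
    using sp p by (simp add: ennreal_plus)
  finally show ?thesis .
qed

text \<open>
  The square function is at least one as soon as one of the variables \<open>a\<^sub>i Y\<^sub>i\<close> reaches one in absolute
  value. These events are independent with probabilities \<open>a\<^sub>i\<^sup>p\<close> that add up to one.
\<close>

lemma pareto_square_function_lower:
  assumes sp: "0 < s" and p: "0 < p" and a: "\<And>i. 0 \<le> a i" and sum: "(\<Sum>i<n. a i powr p) = 1"
  shows "ennreal (1 - exp (- 1)) \<le>
    (\<integral>\<^sup>+x. ennreal ((\<Sum>i<n. (a i * symmetric_seq (pareto_quantile p) i x)\<^sup>2) powr (s / 2)) \<partial>unit_measure)"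
proof -
  let ?Y = "symmetric_seq (pareto_quantile p)"
  define B where "B i = {y. \<bar>a i * y\<bar> < 1}" for i
  have [measurable]: "B i \<in> sets borel" for i unfolding B_def by measurable
  define Q where "Q i = ?Y i -` B i \<inter> space unit_measure" for i
  have Q: "Q i \<in> unit.events" for i unfolding Q_def by (intro measurable_sets[of _ _ borel]) measurable
  have n: "n \<noteq> 0" using sum by (intro notI) simp
  have le1: "a i powr p \<le> 1" if "i < n" for i
    using member_le_sum[of i "{..<n}" "\<lambda>i. a i powr p"] that sum by simp
  have Qi: "unit.prob (Q i) \<le> exp (- (a i powr p))" if i: "i < n" for i
  proof -
    have "ennreal (unit.prob (Q i)) = (\<integral>\<^sup>+x. indicator (B i) (?Y i x) \<partial>unit_measure)"
    proof -
      have "ennreal (unit.prob (Q i)) = (\<integral>\<^sup>+x. indicator (Q i) x \<partial>unit_measure)"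
        using Q by (simp add: unit.emeasure_eq_measure)
      also have "\<dots> = (\<integral>\<^sup>+x. indicator (B i) (?Y i x) \<partial>unit_measure)"
        by (intro nn_integral_cong) (auto simp: Q_def indicator_def)
      finally show ?thesis .
    qed
    also have "\<dots> = (\<integral>\<^sup>+v. indicator (B i) (pareto_quantile p v) \<partial>unit_measure)"
      by (rule nn_integral_symmetric_seq_even) (auto simp: B_def indicator_def)
    also have "\<dots> \<le> ennreal (1 - a i powr p)"
    proof (rule nn_integral_unit_le[where A = "{a i powr p..1}" and g = "\<lambda>_. 1"])
      show "((\<lambda>_. 1) has_integral 1 - a i powr p) {a i powr p..1}"
        using has_integral_const_real[of "1::real" "a i powr p" 1] le1[OF i] by simp
      show "AE v in unit_measure. indicator (B i) (pareto_quantile p v) \<le> ennreal 1 * indicator {a i powr p..1} v"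
        using AE_unit_positive
      proof eventually_elim
        case (elim v)
        have nn: "0 \<le> a i * pareto_quantile p v" using a by (simp add: pareto_quantile_def)
        show ?case
          using pareto_quantile_scaled_less_one_iff[OF p, of v "a i"] elim a nn by (auto simp: B_def indicator_def)
      qed
    qed simp
    finally have "unit.prob (Q i) \<le> 1 - a i powr p" using le1[OF i] by (simp add: ennreal_le_iff)
    also have "\<dots> \<le> exp (- (a i powr p))" using exp_ge_add_one_self[of "- (a i powr p)"] by simp
    finally show ?thesis .
  qed
  have "unit.prob (\<Inter>i\<in>{..<n}. Q i) = (\<Prod>i\<in>{..<n}. unit.prob (Q i))"
    unfolding Q_def using n
    by (intro unit.indep_varsD[OF indep_symmetric_seq]) auto
  also have "\<dots> \<le> (\<Prod>i\<in>{..<n}. exp (- (a i powr p)))"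
    using Qi by (intro prod_mono) auto
  also have "\<dots> = exp (- 1)" using sum by (simp add: exp_sum[symmetric] sum_negf)
  finally have prob: "unit.prob (\<Inter>i\<in>{..<n}. Q i) \<le> exp (- 1)" .
  have Qev: "(\<Inter>i\<in>{..<n}. Q i) \<in> unit.events" using n by (intro sets.finite_INT Q) auto
  have "ennreal (1 - exp (- 1)) \<le> ennreal (1 - unit.prob (\<Inter>i\<in>{..<n}. Q i))"
    using prob by (intro ennreal_leI) simp
  also have "\<dots> = emeasure unit_measure (space unit_measure - (\<Inter>i\<in>{..<n}. Q i))"
    using unit.prob_compl[OF Qev] by (simp only: unit.emeasure_eq_measure)
  also have "\<dots> = (\<integral>\<^sup>+x. indicator (space unit_measure - (\<Inter>i\<in>{..<n}. Q i)) x \<partial>unit_measure)"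
    using Qev by (intro nn_integral_indicator[symmetric] sets.compl_sets)
  also have "\<dots> \<le> (\<integral>\<^sup>+x. ennreal ((\<Sum>i<n. (a i * ?Y i x)\<^sup>2) powr (s / 2)) \<partial>unit_measure)"
  proof (rule nn_integral_mono)
    fix x assume x: "x \<in> space unit_measure"
    show "indicator (space unit_measure - (\<Inter>i\<in>{..<n}. Q i)) x \<le>
        ennreal ((\<Sum>i<n. (a i * ?Y i x)\<^sup>2) powr (s / 2))"
    proof (cases "x \<in> (\<Inter>i\<in>{..<n}. Q i)")
      case False
      then obtain i where i: "i < n" "x \<notin> Q i" by auto
      then have "1 \<le> \<bar>a i * ?Y i x\<bar>" using x unfolding Q_def B_def by auto
      then have "1\<^sup>2 \<le> \<bar>a i * ?Y i x\<bar>\<^sup>2" by (intro power_mono) auto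
      then have "1 \<le> (a i * ?Y i x)\<^sup>2" by simp
      also have "\<dots> \<le> (\<Sum>i<n. (a i * ?Y i x)\<^sup>2)" using i by (intro member_le_sum) auto
      finally have "1 powr (s / 2) \<le> (\<Sum>i<n. (a i * ?Y i x)\<^sup>2) powr (s / 2)"
        using sp by (intro powr_mono2) auto
      then have "1 \<le> ennreal ((\<Sum>i<n. (a i * ?Y i x)\<^sup>2) powr (s / 2))"
        by (simp only: powr_one_eq_one ennreal_ge_1)
      then show ?thesis by (auto simp: indicator_def)
    qed simp
  qed
  finally show ?thesis .
qed

text \<open>
  The estimates for \<open>\<Sum> a\<^sub>i\<^sup>p = 1\<close> extend by homogeneity.
\<close>

lemma lp_embeds_between:
  assumes rs: "0 < r" and sp: "0 < s" "s < p" "p < 2"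
  shows "isomorphically_embeds (lp_space p) (Ls_lr s r :: ('k::{real_normed_field, euclidean_space}, 'k mixed_L0) qn_space)"
proof -
  let ?Y = "symmetric_seq (pareto_quantile p)"
  let ?C = "1 + 1 / (2 / p - 1) + 1 / (1 - s / p)" and ?c = "1 - exp (- 1 :: real)"
  have p: "0 < p" using sp by simp
  have c: "0 < ?c" by simp
  have "0 < 2 / p - 1" "0 < 1 - s / p" using sp p by (auto simp: field_simps)
  then have C: "0 < ?C" by (intro add_pos_pos) auto
  define I where "I a n = (\<integral>\<^sup>+x. ennreal ((\<Sum>i<n. (a i * ?Y i x)\<^sup>2) powr (s / 2)) \<partial>unit_measure)"
    for a :: "nat \<Rightarrow> real" and n
  have both: "ennreal (?c * (\<Sum>i<n. a i powr p) powr (s / p)) \<le> I a n \<and>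
      I a n \<le> ennreal (?C * (\<Sum>i<n. a i powr p) powr (s / p))" if a: "\<And>i. 0 \<le> a i" for a n
  proof (cases "(\<Sum>i<n. a i powr p) = 0")
    case True
    then have "\<forall>i\<in>{..<n}. a i powr p = 0" by (subst (asm) sum_nonneg_eq_0_iff) auto
    then have "I a n = 0" by (simp add: I_def)
    then show ?thesis by (simp add: True)
  next
    case False
    define N where "N = (\<Sum>i<n. a i powr p)"
    have "N \<ge> 0" unfolding N_def by (intro sum_nonneg) auto
    then have N: "N > 0" using False by (simp add: N_def)
    define t where "t = N powr (1 / p)"
    have t: "t > 0" using N by (simp add: t_def)
    have tp: "t powr p = N" "t powr s = N powr (s / p)" using N p by (simp_all add: t_def powr_powr)
    define b where "b i = a i / t" for i
    have b: "0 \<le> b i" for i using a t by (simp add: b_def)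
    have "(\<Sum>i<n. b i powr p) = (\<Sum>i<n. a i powr p) / N"
      using a t by (simp add: b_def powr_divide tp sum_divide_distrib)
    then have sum: "(\<Sum>i<n. b i powr p) = 1" using N by (simp add: N_def)
    have pt: "(\<Sum>i<n. (a i * ?Y i x)\<^sup>2) powr (s / 2) = t powr s * (\<Sum>i<n. (b i * ?Y i x)\<^sup>2) powr (s / 2)" for x
    proof -
      have "(\<Sum>i<n. (a i * ?Y i x)\<^sup>2) = t\<^sup>2 * (\<Sum>i<n. (b i * ?Y i x)\<^sup>2)"
        using t by (simp add: b_def sum_distrib_left power_mult_distrib power_divide)
      moreover have "(t\<^sup>2) powr (s / 2) = t powr s"
        using t by (simp add: powr_powr flip: powr_numeral)
      ultimately show ?thesis by (simp add: powr_mult sum_nonneg)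
    qed
    have I: "I a n = ennreal (N powr (s / p)) * I b n"
      unfolding I_def pt tp by (simp add: ennreal_mult nn_integral_cmult)
    have up: "I b n \<le> ennreal ?C" unfolding I_def by (rule pareto_square_function_upper[OF sp b sum])
    have low: "ennreal ?c \<le> I b n" unfolding I_def by (rule pareto_square_function_lower[OF sp(1) p b sum])
    have "ennreal (?c * N powr (s / p)) = ennreal (N powr (s / p)) * ennreal ?c"
      using c by (subst ennreal_mult[symmetric]) (auto simp: mult.commute)
    also have "\<dots> \<le> I a n" unfolding I by (intro mult_left_mono low) auto
    finally have 1: "ennreal (?c * N powr (s / p)) \<le> I a n" .
    have "I a n \<le> ennreal (N powr (s / p)) * ennreal ?C" unfolding I by (intro mult_left_mono up) auto
    also have "\<dots> = ennreal (?C * N powr (s / p))"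
      using C by (subst ennreal_mult[symmetric]) (auto simp: mult.commute)
    finally show ?thesis using 1 unfolding N_def by blast
  qed
  show ?thesis
  proof (rule lp_embeds_if_square_function_bounds[OF rs sp(1) p c C measurable_pareto_quantile])
    fix a :: "nat \<Rightarrow> real" and n assume a: "\<And>i. 0 \<le> a i"
    show "ennreal (?c * (\<Sum>i<n. a i powr p) powr (s / p)) \<le>
        (\<integral>\<^sup>+x. ennreal ((\<Sum>i<n. (a i * ?Y i x)\<^sup>2) powr (s / 2)) \<partial>unit_measure)"
      "(\<integral>\<^sup>+x. ennreal ((\<Sum>i<n. (a i * ?Y i x)\<^sup>2) powr (s / 2)) \<partial>unit_measure) \<le>
        ennreal (?C * (\<Sum>i<n. a i powr p) powr (s / p))"
      using both[OF a, where n = n] unfolding I_def by auto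
  qed
qed

theorem Lambda_Ls_lr:
  assumes rs: "0 < r" "r < s"
  shows "Lambda (Ls_lr s r :: ('k::{real_normed_field, euclidean_space}, 'k mixed_L0) qn_space) =
    (if s \<le> 2 then {ereal r} \<union> {ereal s..2} else {2, ereal r, ereal s})"
proof -
  let ?L = "Ls_lr s r :: ('k, 'k mixed_L0) qn_space"
  have s: "0 < s" using rs by simp
  have two: "(2 :: ereal) = ereal 2" by simp
  have not_c0: "\<not> isomorphically_embeds (c0_space :: ('k, nat \<Rightarrow> 'k) qn_space) ?L"
  proof
    assume emb: "isomorphically_embeds (c0_space :: ('k, nat \<Rightarrow> 'k) qn_space) ?L"
    have "0 = 1 / r \<or> 0 = 1 / s \<or> (if s \<le> 2 then 1 / 2 \<le> (0::real) \<and> 0 \<le> 1 / s else 0 = (1 / 2 :: real))"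
      by (rule power_growth_space.embeds_imp_exponent_cases[OF power_growth_space_c0 rs emb])
    then show False using rs s by (auto split: if_splits)
  qed
  have emb_iff: "isomorphically_embeds (lp_space p :: ('k, nat \<Rightarrow> 'k) qn_space) ?L \<longleftrightarrow>
      (if s \<le> 2 then p = r \<or> s \<le> p \<and> p \<le> 2 else p = 2 \<or> p = r \<or> p = s)" if p: "0 < p" for p
  proof
    assume emb: "isomorphically_embeds (lp_space p :: ('k, nat \<Rightarrow> 'k) qn_space) ?L"
    have main: "1 / p = 1 / r \<or> 1 / p = 1 / s \<or> (if s \<le> 2 then 1 / 2 \<le> 1 / p \<and> 1 / p \<le> 1 / s else 1 / p = 1 / 2)"
      by (rule power_growth_space.embeds_imp_exponent_cases[OF power_growth_space_lp[OF p] rs emb])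
    show "if s \<le> 2 then p = r \<or> s \<le> p \<and> p \<le> 2 else p = 2 \<or> p = r \<or> p = s"
    proof (cases "s \<le> 2")
      case True
      have "1 / 2 \<le> 1 / p \<Longrightarrow> p \<le> 2" "1 / p \<le> 1 / s \<Longrightarrow> s \<le> p"
        using p s by (simp_all add: field_simps)
      then show ?thesis using main True by auto
    next
      case False
      then show ?thesis using main by auto
    qed
  next
    assume "if s \<le> 2 then p = r \<or> s \<le> p \<and> p \<le> 2 else p = 2 \<or> p = r \<or> p = s"
    then consider "p = r" | "p = s" | "p = 2" | "s < p" "p < 2" by (force split: if_splits)
    then show "isomorphically_embeds (lp_space p :: ('k, nat \<Rightarrow> 'k) qn_space) ?L"
      using lr_embeds[OF rs(1) s] ls_embeds[OF rs(1) s] l2_embeds[OF rs(1) s] lp_embeds_between[OF rs(1) s]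
      by cases auto
  qed
  have "q \<in> Lambda ?L \<longleftrightarrow> q \<in> (if s \<le> 2 then {ereal r} \<union> {ereal s..2} else {2, ereal r, ereal s})" for q
  proof (cases q)
    case (real p)
    show ?thesis
    proof (cases "0 < p")
      case True
      then show ?thesis using emb_iff[OF True] by (simp add: real Lambda_def two)
    next
      case False
      then show ?thesis using rs s by (auto simp: real Lambda_def two)
    qed
  next
    case PInf
    then show ?thesis using not_c0 by (simp add: Lambda_def two)
  next
    case MInf
    then show ?thesis by (simp add: Lambda_def two)
  qed
  then show ?thesis by blast
qed

theorem theorem3p8:
  fixes r s :: real
  assumes "0 < r" and "r < s"
  shows "(s \<ge> 2 \<longrightarrow>
            Lambda (Ls_lr s r :: (real, real mixed_L0) qn_space) = {2, ereal r, ereal s} \<and>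
            Lambda (Ls_lr s r :: (complex, complex mixed_L0) qn_space) = {2, ereal r, ereal s}) \<and>
         (s \<le> 2 \<longrightarrow>
            Lambda (Ls_lr s r :: (real, real mixed_L0) qn_space) = {ereal r} \<union> {ereal s..2} \<and>
            Lambda (Ls_lr s r :: (complex, complex mixed_L0) qn_space) = {ereal r} \<union> {ereal s..2})"
proof -
  have "{ereal r} \<union> {ereal s..2} = {2, ereal r, ereal s}" if "s = 2"
    using that by auto
  then show ?thesis
    using Lambda_Ls_lr[OF assms, where 'k = real] Lambda_Ls_lr[OF assms, where 'k = complex]
    by (cases "s = 2") auto
qed

end
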